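(* Fix $d>0$. For every measurable set $S\subset[0,2\pi]$ of positive measure there exists a set $\Lambda\subset\mathbb{Z}$ such that the limit $D^{\sharp}(\Lambda)=\lim_{n\to\infty}\frac{|\Lambda\cap[-n,n]|}{2n}$ exists and $D^{\sharp}(\Lambda)<(1+d)|S|$, and \[ C(d)\,|S|\,\|f\|_{L^2(\mathbb{R})}^2\le \sum_{\lambda\in\Lambda}|f(\lambda)|^2\qquad\text{for all } f\in PW_S, \] where $C(d)>0$ is a constant depending only on $d$.
   Context: $|S|$ denotes the normalized Lebesgue measure on $[0,2\pi]$, i.e. $|S|=\frac{1}{2\pi}\,\mathrm{Leb}(S)$; for a finite set, $|\cdot|$ denotes cardinality. The Fourier transform is $\hat f(t)=\int_{\mathbb{R}}e^{-ixt}f(x)\,\frac{dx}{2\pi}$. For $S\subset[0,2\pi]$, $PW_S$ is the space of all $f\in L^2(\mathbb{R})$ whose Fourier transform is supported in $S$, with the $L^2(\mathbb{R})$ norm. *)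

theory Defs
  imports "HOL-Analysis.Analysis"
begin

definition nmeasure :: "real set \<Rightarrow> real" where
  "nmeasure S = measure lebesgue S / (2 * pi)"

definition L2norm_sq :: "(real \<Rightarrow> complex) \<Rightarrow> real" where
  "L2norm_sq f = (\<integral>x. (cmod (f x))\<^sup>2 \<partial>lebesgue)"

text \<open>Paley--Wiener space PW_S for bounded measurable S: the L2(R) functions whose
  Fourier transform (convention hat f(t) = int e^{-ixt} f(x) dx/2pi) vanishes outside S.
  Equivalently (Fourier inversion / Plancherel) f(x) = int_S F(t) e^{ixt} dt with
  F = hat f in L2(S); this gives the continuous representative evaluated pointwise.\<close>
definition PW :: "real set \<Rightarrow> (real \<Rightarrow> complex) set" where
  "PW S = {f. f \<in> borel_measurable lebesgue \<and> integrable lebesgue (\<lambda>x. (cmod (f x))\<^sup>2) \<and>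
     (\<exists>F :: real \<Rightarrow> complex. F \<in> borel_measurable lebesgue \<and>
        integrable lebesgue (\<lambda>t. indicator S t * (cmod (F t))\<^sup>2) \<and>
        (\<forall>x. f x = (\<integral>t. indicator S t *\<^sub>R (F t * cis (x * t)) \<partial>lebesgue)))}"

definition has_density :: "int set \<Rightarrow> real \<Rightarrow> bool" where
  "has_density \<Lambda> D \<longleftrightarrow>
     ((\<lambda>n::nat. real (card (\<Lambda> \<inter> {- int n..int n})) / (2 * real n)) \<longlonglongrightarrow> D)"

end

theory Submission
  imports Defs "HOL-Complex_Analysis.Great_Picard"
begin

text \<open>
  Exhaust \<open>S\<close>, up to a null set, by an increasing sequence of compact sets \<open>K\<close> and cover \<open>K\<close> by cells of a fine
  partition of \<open>[0,2\<pi>)\<close> into \<open>m\<close> intervals, \<open>n\<close> of them meeting \<open>K\<close>. Sampling \<open>PW\<close> of these cells along a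
  union of residue classes modulo \<open>m\<close> is the choice of rows of an \<open>m \<times> n\<close> block of the discrete Fourier matrix.
  At most \<open>(1 + d) n\<close> rows with lower frame bound of order \<open>n\<close> are found by the lower half of the barrier
  method of Batson, Spielman and Srivastava; selecting without repetition makes the upper barrier and the
  weights unnecessary.

  The sets obtained in this way sample only \<open>PW\<close> of \<open>K\<close>, and densities are not preserved in the limit.
  However, the family of all sets \<open>\<Lambda> \<subseteq> \<int>\<close> with the required sampling bound is invariant under translations
  and closed under pointwise limits (since the squared samples along \<open>\<int>\<close> are summable). In such a family the
  minimal number of points in windows of length \<open>N\<close> grows like \<open>h N\<close>, and a maximal inequality yields a member
  whose density exists and equals \<open>h\<close>.
\<close>

section \<open>Selecting rows of a tight frame\<close>

locale finite_matrices =
  fixes L :: "'i set"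
  assumes finite_index [simp]: "finite L"
begin

definition mat_vec :: "('i \<Rightarrow> 'i \<Rightarrow> complex) \<Rightarrow> ('i \<Rightarrow> complex) \<Rightarrow> 'i \<Rightarrow> complex" where
  "mat_vec A x = (\<lambda>i. \<Sum>j\<in>L. A i j * x j)"

definition inner_prod :: "('i \<Rightarrow> complex) \<Rightarrow> ('i \<Rightarrow> complex) \<Rightarrow> complex" where
  "inner_prod x y = (\<Sum>i\<in>L. cnj (x i) * y i)"

definition norm_sq :: "('i \<Rightarrow> complex) \<Rightarrow> real" where
  "norm_sq x = (\<Sum>i\<in>L. (cmod (x i))\<^sup>2)"

definition quad_form :: "('i \<Rightarrow> 'i \<Rightarrow> complex) \<Rightarrow> ('i \<Rightarrow> complex) \<Rightarrow> real" where
  "quad_form A x = Re (inner_prod x (mat_vec A x))"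

definition unit_vec :: "'i \<Rightarrow> 'i \<Rightarrow> complex" where
  "unit_vec i j = of_bool (j = i)"

definition hermitian :: "('i \<Rightarrow> 'i \<Rightarrow> complex) \<Rightarrow> bool" where
  "hermitian A \<longleftrightarrow> (\<forall>i\<in>L. \<forall>j\<in>L. cnj (A i j) = A j i)"

definition pos_def :: "('i \<Rightarrow> 'i \<Rightarrow> complex) \<Rightarrow> bool" where
  "pos_def A \<longleftrightarrow> (\<forall>x. (\<exists>i\<in>L. x i \<noteq> 0) \<longrightarrow> 0 < quad_form A x)"

definition re_trace :: "('i \<Rightarrow> 'i \<Rightarrow> complex) \<Rightarrow> real" where
  "re_trace A = (\<Sum>i\<in>L. Re (A i i))"

definition frobenius_sq :: "('i \<Rightarrow> 'i \<Rightarrow> complex) \<Rightarrow> real" where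
  "frobenius_sq A = (\<Sum>j\<in>L. \<Sum>i\<in>L. (cmod (A i j))\<^sup>2)"

definition inverses :: "('i \<Rightarrow> 'i \<Rightarrow> complex) \<Rightarrow> ('i \<Rightarrow> 'i \<Rightarrow> complex) \<Rightarrow> bool" where
  "inverses B R \<longleftrightarrow> hermitian B \<and> hermitian R \<and> (\<forall>x. \<forall>i\<in>L. mat_vec B (mat_vec R x) i = x i)"

definition diag_shift :: "'i set \<Rightarrow> ('i \<Rightarrow> 'i \<Rightarrow> complex) \<Rightarrow> real \<Rightarrow> 'i \<Rightarrow> 'i \<Rightarrow> complex" where
  "diag_shift T A c = (\<lambda>i j. A i j - (if i = j \<and> i \<in> T then of_real c else 0))"

definition rank_one_update :: "('i \<Rightarrow> 'i \<Rightarrow> complex) \<Rightarrow> real \<Rightarrow> ('i \<Rightarrow> complex) \<Rightarrow> 'i \<Rightarrow> 'i \<Rightarrow> complex" where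
  "rank_one_update A s u = (\<lambda>i j. A i j + of_real s * u i * cnj (u j))"

subsection \<open>Vectors and hermitian forms\<close>

lemma norm_sq_nonneg [simp]: "0 \<le> norm_sq x"
  by (simp add: norm_sq_def sum_nonneg)

lemma norm_sq_pos: "i \<in> L \<Longrightarrow> x i \<noteq> 0 \<Longrightarrow> 0 < norm_sq x"
  unfolding norm_sq_def by (rule sum_pos2[of L i]) auto

lemma inner_prod_cong:
  "(\<And>i. i \<in> L \<Longrightarrow> x i = x' i) \<Longrightarrow> (\<And>i. i \<in> L \<Longrightarrow> y i = y' i) \<Longrightarrow> inner_prod x y = inner_prod x' y'"
  by (simp add: inner_prod_def)

lemma inner_prod_self: "inner_prod x x = of_real (norm_sq x)"
  unfolding inner_prod_def norm_sq_def of_real_sum complex_norm_square by (simp add: mult.commute)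

lemma cnj_inner_prod: "cnj (inner_prod x y) = inner_prod y x"
  by (simp add: inner_prod_def mult.commute)

lemma inner_prod_scaled_right: "inner_prod x (\<lambda>i. c * y i) = c * inner_prod x y"
  by (simp add: inner_prod_def sum_distrib_left mult_ac)

lemma inner_prod_diff_scaled_right: "inner_prod x (\<lambda>i. y i - c * z i) = inner_prod x y - c * inner_prod x z"
  by (simp add: inner_prod_def sum_subtractf sum_distrib_left algebra_simps)

lemma inner_prod_diff_scaled_left: "inner_prod (\<lambda>i. y i - c * z i) x = inner_prod y x - cnj c * inner_prod z x"
  by (simp add: inner_prod_def sum_subtractf sum_distrib_left algebra_simps)

lemma inner_prod_unit_vec [simp]: "i \<in> L \<Longrightarrow> inner_prod (unit_vec i) x = x i"
  by (simp add: inner_prod_def unit_vec_def of_bool_def if_distrib[of cnj] if_distrib[of "\<lambda>z. z * _"]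
      cong: if_cong)

lemma mat_vec_unit_vec [simp]: "j \<in> L \<Longrightarrow> mat_vec A (unit_vec j) i = A i j"
  by (simp add: mat_vec_def unit_vec_def of_bool_def if_distrib[of "\<lambda>z. _ * z"] cong: if_cong)

lemma unit_vec_same [simp]: "unit_vec i i = 1"
  by (simp add: unit_vec_def)

lemma mat_vec_cong: "(\<And>i. i \<in> L \<Longrightarrow> x i = y i) \<Longrightarrow> mat_vec A x = mat_vec A y"
  by (simp add: mat_vec_def)

lemma mat_vec_scaled: "mat_vec A (\<lambda>i. c * x i) i = c * mat_vec A x i"
  by (simp add: mat_vec_def sum_distrib_left mult_ac)

lemma mat_vec_add_scaled: "mat_vec A (\<lambda>i. x i + c * y i) = (\<lambda>i. mat_vec A x i + c * mat_vec A y i)"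
  by (simp add: mat_vec_def sum.distrib sum_distrib_left algebra_simps)

lemma mat_vec_diff_scaled: "mat_vec A (\<lambda>i. x i - c * y i) = (\<lambda>i. mat_vec A x i - c * mat_vec A y i)"
  using mat_vec_add_scaled[of A x "- c" y] by simp

lemma hermitianI: "(\<And>i j. i \<in> L \<Longrightarrow> j \<in> L \<Longrightarrow> cnj (A i j) = A j i) \<Longrightarrow> hermitian A"
  by (simp add: hermitian_def)

lemma hermitianD: "hermitian A \<Longrightarrow> i \<in> L \<Longrightarrow> j \<in> L \<Longrightarrow> cnj (A i j) = A j i"
  by (simp add: hermitian_def)

lemma hermitian_inner_prod:
  assumes "hermitian A"
  shows "inner_prod x (mat_vec A y) = inner_prod (mat_vec A x) y"
proof -
  have "inner_prod x (mat_vec A y) = (\<Sum>j\<in>L. \<Sum>i\<in>L. cnj (x i) * A i j * y j)"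
    unfolding inner_prod_def mat_vec_def sum_distrib_left by (subst sum.swap) (simp add: mult.assoc)
  also have "\<dots> = (\<Sum>j\<in>L. \<Sum>i\<in>L. cnj (A j i) * cnj (x i) * y j)"
    by (intro sum.cong refl) (simp add: hermitianD[OF assms] mult_ac)
  also have "\<dots> = inner_prod (mat_vec A x) y"
    by (simp add: inner_prod_def mat_vec_def sum_distrib_right)
  finally show ?thesis .
qed

lemma inner_prod_mat_vec_self:
  assumes "hermitian A"
  shows "inner_prod x (mat_vec A x) = of_real (quad_form A x)"
proof -
  have "cnj (inner_prod x (mat_vec A x)) = inner_prod x (mat_vec A x)"
    by (simp add: cnj_inner_prod hermitian_inner_prod[OF assms])
  then show ?thesis
    by (simp add: quad_form_def complex_eq_iff)
qed

lemma quad_form_unit_vec: "i \<in> L \<Longrightarrow> quad_form A (unit_vec i) = Re (A i i)"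
  by (simp add: quad_form_def)

lemma quad_form_diff_scaled:
  assumes "hermitian A"
  shows "quad_form A (\<lambda>i. x i - c * y i)
    = quad_form A x - 2 * Re (c * inner_prod x (mat_vec A y)) + (cmod c)\<^sup>2 * quad_form A y"
proof -
  define p where "p = inner_prod x (mat_vec A y)"
  have swapped: "inner_prod y (mat_vec A x) = cnj p"
    unfolding p_def cnj_inner_prod by (rule hermitian_inner_prod[OF assms])
  have "inner_prod (\<lambda>i. x i - c * y i) (mat_vec A (\<lambda>i. x i - c * y i))
      = of_real (quad_form A x) - (c * p + cnj (c * p)) + (c * cnj c) * of_real (quad_form A y)"
    unfolding mat_vec_diff_scaled inner_prod_diff_scaled_left inner_prod_diff_scaled_right swapped
      p_def[symmetric] inner_prod_mat_vec_self[OF assms]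
    by (simp add: algebra_simps)
  also have "\<dots> = of_real (quad_form A x - 2 * Re (c * p) + (cmod c)\<^sup>2 * quad_form A y)"
    by (simp only: complex_add_cnj complex_norm_square[symmetric] of_real_add of_real_diff of_real_mult)
  finally have "Re (inner_prod (\<lambda>i. x i - c * y i) (mat_vec A (\<lambda>i. x i - c * y i)))
      = quad_form A x - 2 * Re (c * p) + (cmod c)\<^sup>2 * quad_form A y"
    by (simp only: Re_complex_of_real)
  then show ?thesis
    unfolding p_def by (simp only: quad_form_def)
qed

lemma pos_def_nonneg:
  assumes "pos_def A"
  shows "0 \<le> quad_form A x"
proof (cases "\<exists>i\<in>L. x i \<noteq> 0")
  case True
  then show ?thesis
    using assms by (auto simp: pos_def_def intro: less_imp_le)
qed (simp add: quad_form_def inner_prod_def)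

lemma trace_sq_le_frobenius_sq: "(re_trace A)\<^sup>2 \<le> card L * frobenius_sq A"
proof -
  have "(Re (A i i))\<^sup>2 \<le> (\<Sum>k\<in>L. (cmod (A k i))\<^sup>2)" if "i \<in> L" for i
  proof -
    have "(Re (A i i))\<^sup>2 \<le> (cmod (A i i))\<^sup>2"
      by (simp add: cmod_power2)
    also have "\<dots> \<le> (\<Sum>k\<in>L. (cmod (A k i))\<^sup>2)"
      using that by (intro member_le_sum) auto
    finally show ?thesis .
  qed
  then have diag: "(\<Sum>i\<in>L. (Re (A i i))\<^sup>2) \<le> frobenius_sq A"
    unfolding frobenius_sq_def by (intro sum_mono)
  have "(re_trace A)\<^sup>2 \<le> (\<Sum>i\<in>L. (Re (A i i))\<^sup>2) * (\<Sum>i\<in>L. 1\<^sup>2)"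
    unfolding re_trace_def using Cauchy_Schwarz_ineq_sum[of "\<lambda>i. Re (A i i)" "\<lambda>_. 1" L] by simp
  also have "\<dots> \<le> frobenius_sq A * card L"
    using diag by (simp add: mult_right_mono)
  finally show ?thesis
    by (simp add: mult.commute)
qed

subsection \<open>Diagonal shifts and rank one updates\<close>

lemma hermitian_rank_one_update: "hermitian A \<Longrightarrow> hermitian (rank_one_update A s u)"
  by (rule hermitianI) (simp add: rank_one_update_def hermitianD mult_ac)

lemma diag_shift_diag_shift: "diag_shift T (diag_shift T A b) c = diag_shift T A (b + c)"
  by (auto simp: diag_shift_def fun_eq_iff)

lemma mat_vec_diag_shift:
  assumes "T \<subseteq> L" "i \<in> L"
  shows "mat_vec (diag_shift T A c) x i = mat_vec A x i - of_real c * (indicator T i * x i)"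
proof -
  have "mat_vec (diag_shift T A c) x i
      = (\<Sum>j\<in>L. A i j * x j - (if i = j then of_real c * (indicator T i * x i) else 0))"
    unfolding mat_vec_def diag_shift_def
    by (intro sum.cong refl) (auto simp: algebra_simps)
  then show ?thesis
    using assms by (simp add: sum_subtractf mat_vec_def)
qed

lemma mat_vec_rank_one_update:
  "mat_vec (rank_one_update A s u) x i = mat_vec A x i + of_real s * inner_prod u x * u i"
  by (simp add: mat_vec_def rank_one_update_def inner_prod_def sum.distrib sum_distrib_left sum_distrib_right
      algebra_simps)

lemma quad_form_diag_shift:
  assumes "T \<subseteq> L"
  shows "quad_form (diag_shift T A c) x = quad_form A x - c * (\<Sum>i\<in>T. (cmod (x i))\<^sup>2)"
proof -
  have "inner_prod x (mat_vec (diag_shift T A c) x)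
      = inner_prod x (\<lambda>i. mat_vec A x i - of_real c * (indicator T i * x i))"
    by (intro inner_prod_cong mat_vec_diag_shift assms refl)
  moreover have "inner_prod x (\<lambda>i. indicator T i * x i) = (\<Sum>i\<in>T. of_real ((cmod (x i))\<^sup>2))"
    unfolding inner_prod_def complex_norm_square using assms
    by (intro sum.mono_neutral_cong_right) (auto simp: mult.commute)
  ultimately show ?thesis
    by (simp add: quad_form_def inner_prod_diff_scaled_right)
qed

lemma quad_form_rank_one_update:
  "quad_form (rank_one_update A s u) x = quad_form A x + s * (cmod (inner_prod u x))\<^sup>2"
proof -
  have "mat_vec (rank_one_update A s u) x = (\<lambda>i. mat_vec A x i - (- of_real s * inner_prod u x) * u i)"
    by (simp add: mat_vec_rank_one_update fun_eq_iff)
  then have "inner_prod x (mat_vec (rank_one_update A s u) x)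
      = inner_prod x (mat_vec A x) + of_real s * (inner_prod u x * cnj (inner_prod u x))"
    by (simp only: inner_prod_diff_scaled_right cnj_inner_prod) (simp add: mult_ac)
  then show ?thesis
    unfolding quad_form_def complex_norm_square[symmetric] by simp
qed

lemma diag_shift_insert:
  "e \<notin> T \<Longrightarrow> diag_shift (insert e T) A c = rank_one_update (diag_shift T A c) (- c) (unit_vec e)"
  by (auto simp: diag_shift_def rank_one_update_def unit_vec_def fun_eq_iff)

lemma trace_rank_one_update: "re_trace (rank_one_update A s u) = re_trace A + s * norm_sq u"
proof -
  have "Re (rank_one_update A s u i i) = Re (A i i) + s * (cmod (u i))\<^sup>2" for i
    unfolding rank_one_update_def mult.assoc complex_norm_square[symmetric] by simp
  then show ?thesis
    by (simp add: re_trace_def norm_sq_def sum.distrib sum_distrib_left)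
qed

subsection \<open>Inverses\<close>

lemma inversesD:
  assumes "inverses B R"
  shows "hermitian B" "hermitian R" "i \<in> L \<Longrightarrow> mat_vec B (mat_vec R x) i = x i"
  using assms by (auto simp: inverses_def)

lemma inverses_commute:
  assumes "inverses B R"
  shows "inverses R B"
proof -
  note inv = inversesD[OF assms]
  have "mat_vec R (mat_vec B x) i = x i" if "i \<in> L" for x i
  proof -
    have "mat_vec R (mat_vec B x) i = inner_prod (mat_vec B (mat_vec R (unit_vec i))) x"
      using that by (simp flip: hermitian_inner_prod[OF inv(1)] hermitian_inner_prod[OF inv(2)])
    also have "\<dots> = inner_prod (unit_vec i) x"
      by (intro inner_prod_cong inv(3) refl)
    finally show ?thesis
      using that by simp
  qed
  then show ?thesis
    using inv by (auto simp: inverses_def)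
qed

lemma quad_form_inverse:
  assumes "inverses B R"
  shows "quad_form R x = quad_form B (mat_vec R x)"
proof -
  note inv = inversesD[OF assms]
  have "quad_form B (mat_vec R x) = Re (inner_prod (mat_vec R x) x)"
    unfolding quad_form_def by (simp add: inv(3) cong: inner_prod_cong)
  then show ?thesis
    by (simp add: quad_form_def hermitian_inner_prod[OF inv(2)])
qed

lemma quad_form_inverse_nonneg: "inverses B R \<Longrightarrow> pos_def B \<Longrightarrow> 0 \<le> quad_form R x"
  by (simp add: quad_form_inverse pos_def_nonneg)

text \<open>Cauchy--Schwarz for the form of \<open>B\<close>, applied to \<open>x\<close> and the \<open>i\<close>-th column of its inverse.\<close>
lemma coordinate_sq_le:
  assumes inv: "inverses B R" and pos: "pos_def B" and i: "i \<in> L"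
  shows "(cmod (x i))\<^sup>2 \<le> Re (R i i) * quad_form B x"
proof -
  define r where "r = Re (R i i)"
  define v where "v = mat_vec R (unit_vec i)"
  have mat_vec_v: "mat_vec B v j = unit_vec i j" if "j \<in> L" for j
    unfolding v_def using inversesD(3)[OF inv that] .
  have form_v: "quad_form B v = r"
    unfolding v_def r_def using i by (simp add: quad_form_inverse[OF inv, symmetric] quad_form_unit_vec)
  have "r \<noteq> 0"
  proof
    assume "r = 0"
    then have "v j = 0" if "j \<in> L" for j
      using pos that unfolding pos_def_def form_v[symmetric] by (metis less_irrefl)
    then have "mat_vec B v i = 0"
      by (simp add: mat_vec_def)
    then show False
      using mat_vec_v[OF i] by simp
  qed
  moreover have "0 \<le> r"
    unfolding form_v[symmetric] by (rule pos_def_nonneg[OF pos])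
  ultimately have "0 < r"
    by simp
  have "inner_prod x (mat_vec B v) = cnj (x i)"
    using i by (simp add: mat_vec_v cnj_inner_prod[of "unit_vec i", symmetric] cong: inner_prod_cong)
  moreover have "x i * cnj (x i) = of_real ((cmod (x i))\<^sup>2)"
    by (simp only: complex_norm_square)
  ultimately have "quad_form B (\<lambda>j. x j - x i / of_real r * v j) = quad_form B x - (cmod (x i))\<^sup>2 / r"
    unfolding quad_form_diff_scaled[OF inversesD(1)[OF inv]] form_v
    using \<open>0 < r\<close> by (simp add: norm_divide power_divide power2_eq_square)
  then have "(cmod (x i))\<^sup>2 / r \<le> quad_form B x"
    using pos_def_nonneg[OF pos] by (metis diff_ge_0_iff_ge)
  then show ?thesis
    using \<open>0 < r\<close> by (simp add: r_def field_simps)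
qed

lemma norm_sq_le_trace_inverse:
  assumes "inverses B R" "pos_def B"
  shows "norm_sq x \<le> re_trace R * quad_form B x"
  unfolding norm_sq_def re_trace_def sum_distrib_right
  by (intro sum_mono coordinate_sq_le[OF assms])

lemma sherman_morrison:
  assumes inv: "inverses B R" and nz: "1 + s * quad_form R u \<noteq> 0"
  shows "inverses (rank_one_update B s u) (rank_one_update R (- s / (1 + s * quad_form R u)) (mat_vec R u))"
    (is "inverses ?B (rank_one_update R ?c ?w)")
proof -
  note hB = inversesD(1)[OF inv] and hR = inversesD(2)[OF inv]
  define c q where "c = ?c" and "q = quad_form R u"
  have "mat_vec ?B (mat_vec (rank_one_update R c ?w) x) i = x i" if i: "i \<in> L" for x i
  proof -
    define p where "p = inner_prod ?w x"
    have inner_u: "inner_prod u (mat_vec R x) = p" "inner_prod u ?w = of_real q"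
      unfolding p_def q_def by (fact hermitian_inner_prod[OF hR]) (fact inner_prod_mat_vec_self[OF hR])
    have update: "mat_vec (rank_one_update R c ?w) x = (\<lambda>i. mat_vec R x i - (- of_real c * p) * ?w i)"
      by (simp add: mat_vec_rank_one_update p_def fun_eq_iff)
    have "mat_vec ?B (mat_vec (rank_one_update R c ?w) x) i
        = x i + of_real c * p * u i + of_real s * (p + of_real c * p * of_real q) * u i"
      unfolding update mat_vec_rank_one_update mat_vec_diff_scaled inner_prod_diff_scaled_right inner_u
      by (simp add: inversesD(3)[OF inv i] algebra_simps)
    also have "\<dots> = x i + of_real (s + c * (1 + s * q)) * p * u i"
      by (simp add: algebra_simps)
    also have "s + c * (1 + s * q) = 0"
      using nz by (simp add: c_def q_def)
    finally show ?thesis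
      by simp
  qed
  then show ?thesis
    using hB hR unfolding c_def by (auto simp: inverses_def intro: hermitian_rank_one_update)
qed

lemma rank_one_update_invertible:
  assumes inv: "inverses B R" and pos: "pos_def (rank_one_update B s u)"
  shows "\<exists>R'. inverses (rank_one_update B s u) R'"
proof -
  define w where "w = mat_vec R u"
  define q where "q = quad_form R u"
  have q: "inner_prod u w = of_real q"
    unfolding w_def q_def by (rule inner_prod_mat_vec_self[OF inversesD(2)[OF inv]])
  have "1 + s * q \<noteq> 0"
  proof (cases "\<exists>i\<in>L. w i \<noteq> 0")
    case True
    then have "0 < quad_form (rank_one_update B s u) w"
      using pos by (simp add: pos_def_def)
    also have "\<dots> = q * (1 + s * q)"
      unfolding quad_form_rank_one_update q using quad_form_inverse[OF inv, of u]
      by (simp add: w_def q_def power2_eq_square algebra_simps)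
    finally show ?thesis
      by auto
  next
    case False
    then have "q = 0"
      using q by (simp add: inner_prod_def)
    then show ?thesis
      by simp
  qed
  then show ?thesis
    using sherman_morrison[OF inv] unfolding q_def by blast
qed

text \<open>The diagonal entries are shifted one at a time, each shift being a rank one update.\<close>
lemma diag_shift_invertible:
  assumes inv: "inverses B R" and c: "0 \<le> c" and pos: "pos_def (diag_shift L B c)"
  shows "\<exists>R'. inverses (diag_shift L B c) R'"
proof -
  have pos_T: "pos_def (diag_shift T B c)" if "T \<subseteq> L" for T
    unfolding pos_def_def
  proof (intro allI impI)
    fix x :: "'i \<Rightarrow> complex" assume "\<exists>i\<in>L. x i \<noteq> 0"
    then have "0 < quad_form (diag_shift L B c) x"
      using pos by (simp add: pos_def_def)
    also have "\<dots> \<le> quad_form (diag_shift T B c) x"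
      unfolding quad_form_diag_shift[OF subset_refl] quad_form_diag_shift[OF that]
      using that c by (intro diff_left_mono mult_left_mono sum_mono2) auto
    finally show "0 < quad_form (diag_shift T B c) x" .
  qed
  have "\<exists>R'. inverses (diag_shift T B c) R'" if "T \<subseteq> L" for T
    using finite_subset[OF that finite_index] that
  proof (induction T)
    case empty
    then show ?case
      using inv by (auto simp: diag_shift_def)
  next
    case (insert e T)
    then obtain R' where "inverses (diag_shift T B c) R'"
      by blast
    then show ?case
      using pos_T[OF insert.prems] unfolding diag_shift_insert[OF insert.hyps(2)]
      by (rule rank_one_update_invertible)
  qed
  then show ?thesis
    by blast
qed

subsection \<open>The trace of the inverse under a diagonal shift\<close>

lemma pos_def_diag_shift:
  assumes inv: "inverses B R" and pos: "pos_def B" and tr: "re_trace R \<le> \<phi>"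
    and \<delta>: "0 \<le> \<delta>" "\<delta> * \<phi> < 1"
  shows "pos_def (diag_shift L B \<delta>)"
  unfolding pos_def_def
proof (intro allI impI)
  fix x :: "'i \<Rightarrow> complex" assume "\<exists>i\<in>L. x i \<noteq> 0"
  then have q: "0 < quad_form B x"
    using pos by (simp add: pos_def_def)
  have "norm_sq x \<le> re_trace R * quad_form B x"
    by (rule norm_sq_le_trace_inverse[OF inv pos])
  also have "\<dots> \<le> \<phi> * quad_form B x"
    using tr q by (intro mult_right_mono) auto
  finally have "\<delta> * norm_sq x \<le> \<delta> * (\<phi> * quad_form B x)"
    using \<delta>(1) by (rule mult_left_mono)
  also have "\<dots> < quad_form B x"
    using mult_strict_right_mono[OF \<delta>(2) q] by (simp add: mult.assoc)
  finally show "0 < quad_form (diag_shift L B \<delta>) x"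
    by (simp add: quad_form_diag_shift norm_sq_def)
qed

lemma resolvent_identity:
  assumes inv: "inverses B R" and inv': "inverses (diag_shift L B \<delta>) R'" and i: "i \<in> L"
  shows "mat_vec R' x i - mat_vec R x i = of_real \<delta> * mat_vec R (mat_vec R' x) i"
proof -
  have "mat_vec B (mat_vec R' x) k = x k - (- of_real \<delta>) * mat_vec R' x k" if "k \<in> L" for k
    using inversesD(3)[OF inv' that, of x] that by (simp add: mat_vec_diag_shift algebra_simps)
  then have "mat_vec R (mat_vec B (mat_vec R' x)) i = mat_vec R (\<lambda>k. x k - (- of_real \<delta>) * mat_vec R' x k) i"
    by (subst mat_vec_cong) auto
  then show ?thesis
    unfolding mat_vec_diff_scaled by (simp add: inversesD(3)[OF inverses_commute[OF inv] i])
qed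

lemma quad_form_resolvent_column:
  assumes inv: "inverses B R" and inv': "inverses (diag_shift L B \<delta>) R'" and \<delta>: "\<delta> > 0" and j: "j \<in> L"
  defines "\<beta> \<equiv> (Re (R' j j) - Re (R j j)) / \<delta>"
  shows "quad_form R (\<lambda>i. unit_vec j i - of_real s * mat_vec R' (unit_vec j) i)
    = Re (R j j) - 2 * s * \<beta> + s\<^sup>2 * ((norm_sq (\<lambda>i. R' i j) - \<beta>) / \<delta>)"
proof -
  define v where "v = mat_vec R' (unit_vec j)"
  note herm = inversesD(2)[OF inv]
  have mat_vec_v: "mat_vec R v i = v i / of_real \<delta> - (1 / of_real \<delta>) * mat_vec R (unit_vec j) i"
    if "i \<in> L" for i
    using resolvent_identity[OF inv inv' that, of "unit_vec j"] \<delta> by (simp add: v_def field_simps)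
  have cross_term: "Re (inner_prod (unit_vec j) (mat_vec R v)) = \<beta>"
    unfolding inner_prod_unit_vec[OF j] mat_vec_v[OF j] using j
    by (simp add: v_def \<beta>_def diff_divide_distrib)
  have "inner_prod v (mat_vec R (unit_vec j)) = cnj (inner_prod (unit_vec j) (mat_vec R v))"
    unfolding cnj_inner_prod by (rule hermitian_inner_prod[OF herm])
  moreover have "inner_prod v (mat_vec R v)
      = inner_prod v (\<lambda>i. v i / of_real \<delta> - (1 / of_real \<delta>) * mat_vec R (unit_vec j) i)"
    by (intro inner_prod_cong refl mat_vec_v)
  moreover have "inner_prod v (\<lambda>i. v i / of_real \<delta>) = of_real (norm_sq v / \<delta>)"
    using inner_prod_scaled_right[of v "1 / of_real \<delta>" v] by (simp add: inner_prod_self)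
  ultimately have "quad_form R v = (norm_sq v - \<beta>) / \<delta>"
    unfolding quad_form_def inner_prod_diff_scaled_right by (simp add: cross_term diff_divide_distrib)
  moreover have "norm_sq v = norm_sq (\<lambda>i. R' i j)"
    using j by (simp add: v_def norm_sq_def)
  ultimately show ?thesis
    unfolding quad_form_diff_scaled[OF herm] v_def[symmetric] quad_form_unit_vec[OF j]
    by (simp add: cross_term)
qed

text \<open>The sum over \<open>j \<in> L\<close> of the nonnegative values of the form of \<open>R\<close> at \<open>e\<^sub>j - s R'e\<^sub>j\<close>, evaluated by means of
  the resolvent identity.\<close>
lemma trace_increment_quadratic:
  assumes inv: "inverses B R" and inv': "inverses (diag_shift L B \<delta>) R'"
    and pos: "pos_def B" and \<delta>: "\<delta> > 0"
  defines "b \<equiv> (re_trace R' - re_trace R) / \<delta>"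
  shows "0 \<le> re_trace R - 2 * s * b + s\<^sup>2 * ((frobenius_sq R' - b) / \<delta>)"
proof -
  define \<beta> where "\<beta> = (\<lambda>j. (Re (R' j j) - Re (R j j)) / \<delta>)"
  have "0 \<le> (\<Sum>j\<in>L. quad_form R (\<lambda>i. unit_vec j i - of_real s * mat_vec R' (unit_vec j) i))"
    by (intro sum_nonneg quad_form_inverse_nonneg[OF inv pos])
  also have "\<dots> = (\<Sum>j\<in>L. Re (R j j) - 2 * s * \<beta> j + s\<^sup>2 * ((norm_sq (\<lambda>i. R' i j) - \<beta> j) / \<delta>))"
    unfolding \<beta>_def by (intro sum.cong refl quad_form_resolvent_column[OF inv inv' \<delta>])
  also have "\<dots> = re_trace R - 2 * s * (\<Sum>j\<in>L. \<beta> j) + s\<^sup>2 * ((frobenius_sq R' - (\<Sum>j\<in>L. \<beta> j)) / \<delta>)"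
    by (simp add: re_trace_def frobenius_sq_def norm_sq_def sum.distrib sum_subtractf
        sum_distrib_left[symmetric] sum_divide_distrib[symmetric])
  also have "(\<Sum>j\<in>L. \<beta> j) = b"
    by (simp add: b_def \<beta>_def re_trace_def sum_subtractf sum_divide_distrib[symmetric])
  finally show ?thesis .
qed

lemma frobenius_sq_lower_bound:
  assumes inv: "inverses B R" and inv': "inverses (diag_shift L B \<delta>) R'"
    and pos: "pos_def B" and \<delta>: "\<delta> > 0" and \<phi>: "\<phi> > 0" and tr: "re_trace R \<le> \<phi>" "\<phi> < re_trace R'"
  defines "b \<equiv> (re_trace R' - re_trace R) / \<delta>"
  shows "b + \<delta> * b\<^sup>2 / \<phi> \<le> frobenius_sq R'"
proof -
  have b: "b > 0"
    using tr \<delta> by (simp add: b_def)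
  have "0 \<le> (b / \<phi>)\<^sup>2 * (re_trace R - 2 * (\<phi> / b) * b + (\<phi> / b)\<^sup>2 * ((frobenius_sq R' - b) / \<delta>))"
    unfolding b_def by (intro mult_nonneg_nonneg zero_le_power2 trace_increment_quadratic[OF inv inv' pos \<delta>])
  also have "\<dots> = (b / \<phi>)\<^sup>2 * (re_trace R - 2 * \<phi>) + (b / \<phi>)\<^sup>2 * (\<phi> / b)\<^sup>2 * ((frobenius_sq R' - b) / \<delta>)"
    using b by (simp add: algebra_simps)
  also have "(b / \<phi>)\<^sup>2 * (\<phi> / b)\<^sup>2 = 1"
    using b \<phi> by (simp flip: power_mult_distrib)
  finally have "0 \<le> (b / \<phi>)\<^sup>2 * (re_trace R - 2 * \<phi>) + (frobenius_sq R' - b) / \<delta>"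
    by simp
  also have "\<dots> \<le> (b / \<phi>)\<^sup>2 * (- \<phi>) + (frobenius_sq R' - b) / \<delta>"
    using tr by (intro add_right_mono mult_left_mono) auto
  also have "\<dots> = (frobenius_sq R' - b) / \<delta> - b\<^sup>2 / \<phi>"
    using \<phi> by (simp add: power2_eq_square)
  finally show ?thesis
    using \<delta> by (simp add: field_simps)
qed

subsection \<open>Gram matrices\<close>

definition gram :: "('t \<Rightarrow> 'i \<Rightarrow> complex) \<Rightarrow> 't set \<Rightarrow> 'i \<Rightarrow> 'i \<Rightarrow> complex" where
  "gram u J = (\<lambda>i j. \<Sum>t\<in>J. u t i * cnj (u t j))"

lemma gram_insert: "finite J \<Longrightarrow> t \<notin> J \<Longrightarrow> gram u (insert t J) = rank_one_update (gram u J) 1 (u t)"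
  by (simp add: gram_def rank_one_update_def fun_eq_iff add.commute)

lemma mat_vec_gram: "mat_vec (gram u J) x i = (\<Sum>t\<in>J. inner_prod (u t) x * u t i)"
  unfolding mat_vec_def gram_def inner_prod_def sum_distrib_right
  by (subst sum.swap) (simp add: mult_ac)

lemma quad_form_gram: "quad_form (gram u J) x = (\<Sum>t\<in>J. (cmod (inner_prod (u t) x))\<^sup>2)"
proof (induction J rule: infinite_finite_induct)
  case (insert t J)
  then show ?case
    by (simp add: gram_insert quad_form_rank_one_update)
qed (simp_all add: gram_def quad_form_def inner_prod_def mat_vec_def)

lemma sum_quad_form_gram:
  assumes inv: "inverses B R"
    and gram: "\<And>x i. i \<in> L \<Longrightarrow> mat_vec (gram u J) x i = of_real c * x i - mat_vec B x i"
  shows "(\<Sum>t\<in>J. quad_form R (u t)) = c * re_trace R - card L"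
proof -
  have "(\<Sum>t\<in>J. inner_prod (u t) (mat_vec R (u t)))
      = (\<Sum>i\<in>L. mat_vec R (mat_vec (gram u J) (unit_vec i)) i)"
  proof -
    have "mat_vec R (mat_vec (gram u J) (unit_vec i)) i = (\<Sum>t\<in>J. cnj (u t i) * mat_vec R (u t) i)"
      if "i \<in> L" for i
      unfolding mat_vec_gram using that
      by (subst cnj_inner_prod[symmetric]) (simp add: mat_vec_def sum_distrib_left sum.swap[of _ J] mult_ac)
    then show ?thesis
      by (simp add: inner_prod_def sum.swap[of _ J])
  qed
  also have "\<dots> = (\<Sum>i\<in>L. of_real c * R i i - 1)"
  proof (intro sum.cong refl)
    fix i assume i: "i \<in> L"
    have "mat_vec R (mat_vec (gram u J) (unit_vec i)) i
        = mat_vec R (\<lambda>k. of_real c * unit_vec i k - 1 * mat_vec B (unit_vec i) k) i"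
      by (subst mat_vec_cong) (auto simp: gram)
    also have "\<dots> = of_real c * R i i - 1"
      using i unfolding mat_vec_diff_scaled inversesD(3)[OF inverses_commute[OF inv] i]
      by (simp add: mat_vec_scaled)
    finally show "mat_vec R (mat_vec (gram u J) (unit_vec i)) i = of_real c * R i i - 1" .
  qed
  finally show ?thesis
    unfolding quad_form_def Re_sum[symmetric] by (simp add: re_trace_def sum_subtractf sum_distrib_left)
qed

lemma sum_norm_sq_mat_vec_gram:
  assumes inv: "inverses B R"
    and gram: "\<And>x i. i \<in> L \<Longrightarrow> mat_vec (gram u J) x i = of_real c * x i - mat_vec B x i"
  shows "(\<Sum>t\<in>J. norm_sq (mat_vec R (u t))) = c * frobenius_sq R - re_trace R"
proof -
  have "norm_sq (mat_vec R (u t)) = (\<Sum>i\<in>L. (cmod (inner_prod (u t) (mat_vec R (unit_vec i))))\<^sup>2)" for t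
    unfolding norm_sq_def
  proof (intro sum.cong refl)
    fix i assume "i \<in> L"
    then have "mat_vec R (u t) i = inner_prod (mat_vec R (unit_vec i)) (u t)"
      by (simp flip: hermitian_inner_prod[OF inversesD(2)[OF inv]])
    then show "(cmod (mat_vec R (u t) i))\<^sup>2 = (cmod (inner_prod (u t) (mat_vec R (unit_vec i))))\<^sup>2"
      by (metis cnj_inner_prod complex_mod_cnj)
  qed
  then have "(\<Sum>t\<in>J. norm_sq (mat_vec R (u t))) = (\<Sum>i\<in>L. quad_form (gram u J) (mat_vec R (unit_vec i)))"
    by (simp add: quad_form_gram sum.swap[of _ J])
  also have "\<dots> = (\<Sum>i\<in>L. c * norm_sq (\<lambda>k. R k i) - Re (R i i))"
  proof (intro sum.cong refl)
    fix i assume i: "i \<in> L"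
    define v where "v = mat_vec R (unit_vec i)"
    have "inner_prod v (mat_vec (gram u J) v) = inner_prod v (\<lambda>k. of_real c * v k - 1 * mat_vec B v k)"
      by (intro inner_prod_cong refl) (simp add: gram)
    then have "quad_form (gram u J) v = c * norm_sq v - quad_form B v"
      unfolding quad_form_def inner_prod_diff_scaled_right
      by (simp add: inner_prod_scaled_right inner_prod_self)
    then show "quad_form (gram u J) v = c * norm_sq (\<lambda>k. R k i) - Re (R i i)"
      unfolding v_def quad_form_inverse[OF inv, symmetric] quad_form_unit_vec[OF i] using i
      by (simp add: norm_sq_def)
  qed
  also have "\<dots> = c * frobenius_sq R - re_trace R"
    by (simp add: frobenius_sq_def norm_sq_def re_trace_def sum_subtractf sum_distrib_left)
  finally show ?thesis .
qed

lemma barrier_average_gain: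
  fixes \<Phi> n M N D :: real
  assumes \<delta>: "\<delta> > 0" and \<phi>: "\<phi> > 0" and n: "0 \<le> n" and D: "0 < D"
    and \<Phi>: "\<Phi> = \<phi> + D" and D_le: "D \<le> \<delta> * b" and F: "b + \<delta> * b\<^sup>2 / \<phi> \<le> F" and \<Phi>F: "\<phi> * \<Phi> \<le> n * F"
    and a: "0 \<le> M - n / \<phi>" "M * \<delta> \<le> (M - n / \<phi>) / \<phi>" and N: "N < (M - n / \<phi>) / \<delta> - M * \<phi> + n"
  shows "D * (N + (M * \<Phi> - n)) < M * F - \<Phi>"
proof -
  define a where "a = M - n / \<phi>"
  have b: "0 < b"
    using D D_le \<delta> by (metis order_less_le_trans zero_less_mult_pos)
  have M: "0 \<le> M"
    using a(1) n \<phi> by (smt (verit) divide_nonneg_pos)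
  have "M * \<Phi> \<le> M * (\<phi> + \<delta> * b)"
    unfolding \<Phi> using M D_le by (intro mult_left_mono) auto
  then have "N + (M * \<Phi> - n) < a / \<delta> + M * \<delta> * b"
    using N by (simp add: a_def algebra_simps)
  then have "D * (N + (M * \<Phi> - n)) < D * (a / \<delta> + M * \<delta> * b)"
    using D by (rule mult_strict_left_mono)
  also have "\<dots> \<le> D * (a / \<delta> + a / \<phi> * b)"
    using D b a(2) unfolding a_def by (intro mult_left_mono add_left_mono mult_right_mono) auto
  also have "\<dots> \<le> (\<delta> * b) * (a / \<delta> + a / \<phi> * b)"
    using D_le a(1) \<delta> \<phi> b by (intro mult_right_mono) (auto simp: a_def)
  also have "\<dots> = a * (b + \<delta> * b\<^sup>2 / \<phi>)"
    using \<delta> by (simp add: field_simps power2_eq_square)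
  also have "\<dots> \<le> a * F"
    using F a(1) by (intro mult_left_mono) (auto simp: a_def)
  also have "\<dots> = M * F - n * F / \<phi>"
    by (simp add: a_def algebra_simps)
  also have "\<dots> \<le> M * F - \<Phi>"
    using \<Phi>F \<phi> by (simp add: field_simps)
  finally show ?thesis .
qed

end

subsection \<open>The barrier argument\<close>

locale tight_frame = finite_matrices L for L :: "'i set" +
  fixes u :: "'t \<Rightarrow> 'i \<Rightarrow> complex" and T :: "'t set"
  assumes finite_rows: "finite T" and nonempty_index: "L \<noteq> {}"
    and tight: "i \<in> L \<Longrightarrow> j \<in> L \<Longrightarrow> gram u T i j = (if i = j then of_nat (card T) else 0)"
begin

definition barrier :: "real \<Rightarrow> 't set \<Rightarrow> real \<Rightarrow> bool" where
  "barrier \<phi> J l \<longleftrightarrow> pos_def (diag_shift L (gram u J) l) \<and>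
     (\<exists>R. inverses (diag_shift L (gram u J) l) R \<and> re_trace R \<le> \<phi>)"

lemma barrier_lower_bound:
  assumes "barrier \<phi> J l"
  shows "l * norm_sq x \<le> (\<Sum>t\<in>J. (cmod (inner_prod (u t) x))\<^sup>2)"
  using assms pos_def_nonneg[of "diag_shift L (gram u J) l" x]
  by (simp add: barrier_def quad_form_diag_shift quad_form_gram norm_sq_def)

lemma barrier_empty:
  assumes \<phi>: "\<phi> > 0"
  shows "barrier \<phi> {} (- (card L / \<phi>))"
proof -
  define s where "s = card L / \<phi>"
  have s: "s > 0"
    using \<phi> nonempty_index by (simp add: s_def card_gt_0_iff)
  have B: "diag_shift L (gram u {}) (- s) = (\<lambda>i j. if i = j \<and> i \<in> L then of_real s else 0)"
    by (auto simp: diag_shift_def gram_def fun_eq_iff)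
  have scalar: "mat_vec (\<lambda>i j. if i = j \<and> i \<in> L then of_real c else 0) x i = of_real c * x i"
    if "i \<in> L" for c x i
    using that by (simp add: mat_vec_def if_distrib[of "\<lambda>z. z * _"] cong: if_cong)
  have "pos_def (diag_shift L (gram u {}) (- s))"
    unfolding pos_def_def quad_form_diag_shift[OF subset_refl] quad_form_gram
    using s norm_sq_pos by (auto simp: norm_sq_def)
  moreover have "inverses (diag_shift L (gram u {}) (- s)) (\<lambda>i j. if i = j \<and> i \<in> L then of_real (1 / s) else 0)"
    unfolding inverses_def B using s by (auto simp: hermitian_def scalar)
  moreover have "re_trace (\<lambda>i j. if i = j \<and> i \<in> L then of_real (1 / s) else 0) \<le> \<phi>"
    using \<phi> s by (simp add: re_trace_def s_def)
  ultimately show ?thesis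
    unfolding barrier_def s_def by blast
qed

lemma mat_vec_gram_unused_rows:
  assumes "J \<subseteq> T" "i \<in> L"
  shows "mat_vec (gram u (T - J)) x i
    = of_real (real (card T) - l) * x i - mat_vec (diag_shift L (gram u J) l) x i"
proof -
  have "mat_vec (gram u T) x i = (\<Sum>j\<in>L. if i = j then of_nat (card T) * x i else 0)"
    unfolding mat_vec_def using assms(2) by (intro sum.cong refl) (auto simp: tight)
  moreover have "mat_vec (gram u T) x i = mat_vec (gram u (T - J)) x i + mat_vec (gram u J) x i"
    unfolding mat_vec_gram by (rule sum.subset_diff[OF assms(1) finite_rows])
  ultimately show ?thesis
    using assms(2) by (simp add: mat_vec_diag_shift algebra_simps)
qed

lemma barrier_insert:
  assumes inv: "inverses (diag_shift L (gram u J) l) R" and pos: "pos_def (diag_shift L (gram u J) l)"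
    and t: "finite J" "t \<notin> J"
    and gain: "(re_trace R - \<phi>) * (1 + quad_form R (u t)) \<le> norm_sq (mat_vec R (u t))"
  shows "barrier \<phi> (insert t J) l"
proof -
  let ?R = "rank_one_update R (- 1 / (1 + 1 * quad_form R (u t))) (mat_vec R (u t))"
  have q: "0 \<le> quad_form R (u t)"
    by (rule quad_form_inverse_nonneg[OF inv pos])
  have upd: "diag_shift L (gram u (insert t J)) l = rank_one_update (diag_shift L (gram u J) l) 1 (u t)"
    using t by (simp add: gram_insert diag_shift_def rank_one_update_def fun_eq_iff)
  have "inverses (diag_shift L (gram u (insert t J)) l) ?R"
    unfolding upd by (rule sherman_morrison[OF inv]) (use q in simp)
  moreover have "pos_def (diag_shift L (gram u (insert t J)) l)"
    using pos unfolding pos_def_def upd quad_form_rank_one_update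
    by (metis add_pos_nonneg mult_1 zero_le_power2)
  moreover have "re_trace ?R \<le> \<phi>"
    unfolding trace_rank_one_update using gain q by (simp add: field_simps)
  ultimately show ?thesis
    unfolding barrier_def by blast
qed

text \<open>Adding a row \<open>u\<close> lowers the trace of the inverse \<open>R'\<close> by \<open>|R'u|\<^sup>2 / (1 + u\<^sup>*R'u)\<close>. Numerators and
  denominators, summed over the unused rows, are explicit in \<open>tr R'\<close> and \<open>tr R'\<^sup>2\<close>, so some unused row
  lowers the trace below \<open>\<phi>\<close>.\<close>
lemma exists_trace_lowering_row:
  assumes J: "J \<subseteq> T" and \<delta>: "\<delta> > 0" and \<phi>: "\<phi> > 0"
    and inv: "inverses (diag_shift L (gram u J) l) R" and pos: "pos_def (diag_shift L (gram u J) l)"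
    and inv': "inverses (diag_shift L (gram u J) (l + \<delta>)) R'"
    and tr: "re_trace R \<le> \<phi>" "\<phi> < re_trace R'"
  defines "n \<equiv> real (card L)" and "M \<equiv> real (card T) - (l + \<delta>)"
  assumes M: "0 \<le> M - n / \<phi>" "M * \<delta> \<le> (M - n / \<phi>) / \<phi>"
    "real (card T) < (M - n / \<phi>) / \<delta> - M * \<phi> + n"
  shows "\<exists>t\<in>T-J. (re_trace R' - \<phi>) * (1 + quad_form R' (u t)) \<le> norm_sq (mat_vec R' (u t))"
proof -
  define D where "D = re_trace R' - \<phi>"
  define N where "N = real (card (T - J))"
  have "N \<le> card T"
    using finite_rows by (simp add: N_def card_mono)
  then have "D * (N + (M * re_trace R' - n)) < M * frobenius_sq R' - re_trace R'"
  proof (intro barrier_average_gain[OF \<delta> \<phi>])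
    show "(re_trace R' - re_trace R) / \<delta> + \<delta> * ((re_trace R' - re_trace R) / \<delta>)\<^sup>2 / \<phi> \<le> frobenius_sq R'"
      by (rule frobenius_sq_lower_bound[OF inv inv'[folded diag_shift_diag_shift] pos \<delta> \<phi> tr])
    have "\<phi> * re_trace R' \<le> (re_trace R')\<^sup>2"
      using tr \<phi> by (simp add: power2_eq_square)
    then show "\<phi> * re_trace R' \<le> n * frobenius_sq R'"
      using trace_sq_le_frobenius_sq[of R'] by (simp add: n_def)
  qed (use tr M \<delta> in \<open>auto simp: D_def n_def\<close>)
  moreover have "(\<Sum>t\<in>T-J. quad_form R' (u t)) = M * re_trace R' - n"
    and "(\<Sum>t\<in>T-J. norm_sq (mat_vec R' (u t))) = M * frobenius_sq R' - re_trace R'"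
    unfolding M_def n_def
    by (rule sum_quad_form_gram[OF inv' mat_vec_gram_unused_rows[OF J]]
        sum_norm_sq_mat_vec_gram[OF inv' mat_vec_gram_unused_rows[OF J]]; assumption)+
  ultimately have "(\<Sum>t\<in>T-J. D * (1 + quad_form R' (u t))) < (\<Sum>t\<in>T-J. norm_sq (mat_vec R' (u t)))"
    unfolding sum_distrib_left[symmetric] sum.distrib by (simp add: N_def)
  then show ?thesis
    unfolding D_def by (meson linear not_le sum_mono)
qed

lemma barrier_step:
  assumes J: "J \<subseteq> T" and bar: "barrier \<phi> J l" and \<delta>: "\<delta> > 0" and \<phi>: "\<phi> > 0" "\<delta> * \<phi> < 1"
  defines "n \<equiv> real (card L)" and "M \<equiv> real (card T) - (l + \<delta>)"
  assumes M: "0 \<le> M - n / \<phi>" "M * \<delta> \<le> (M - n / \<phi>) / \<phi>"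
    "real (card T) < (M - n / \<phi>) / \<delta> - M * \<phi> + n"
  shows "\<exists>J'\<subseteq>T. card J' \<le> Suc (card J) \<and> barrier \<phi> J' (l + \<delta>)"
proof -
  let ?B = "diag_shift L (gram u J) l" and ?B' = "diag_shift L (gram u J) (l + \<delta>)"
  have finJ: "finite J"
    using J finite_rows finite_subset by blast
  obtain R where inv: "inverses ?B R" and pos: "pos_def ?B" and tr: "re_trace R \<le> \<phi>"
    using bar by (auto simp: barrier_def)
  have pos': "pos_def ?B'"
    unfolding diag_shift_diag_shift[symmetric] using \<delta> \<phi> by (intro pos_def_diag_shift[OF inv pos tr]) auto
  then obtain R' where inv': "inverses ?B' R'"
    unfolding diag_shift_diag_shift[symmetric] using diag_shift_invertible[OF inv less_imp_le[OF \<delta>]] by blast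
  show ?thesis
  proof (cases "re_trace R' \<le> \<phi>")
    case True
    then show ?thesis
      using J inv' pos' by (auto simp: barrier_def)
  next
    case False
    then obtain t where t: "t \<in> T - J"
      "(re_trace R' - \<phi>) * (1 + quad_form R' (u t)) \<le> norm_sq (mat_vec R' (u t))"
      using exists_trace_lowering_row[OF J \<delta> \<phi>(1) inv pos inv' tr] M unfolding M_def n_def by auto
    then have "barrier \<phi> (insert t J) (l + \<delta>)"
      using finJ by (intro barrier_insert[OF inv' pos']) auto
    then show ?thesis
      using t J finJ by (intro exI[of _ "insert t J"]) (auto simp: card_insert_if)
  qed
qed

end

lemma barrier_parameters:
  fixes d n m l :: real
  assumes d: "d > 0" and n: "0 < n" "n \<le> m" and l: "(1 + d) * l < n * d / 2"
  defines "\<phi> \<equiv> 2 * (1 + d) / d" and "\<delta> \<equiv> d / ((1 + d) * (d + 2))" and "M \<equiv> m - l"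
  shows "0 \<le> M - n / \<phi>" "M * \<delta> \<le> (M - n / \<phi>) / \<phi>" "m < (M - n / \<phi>) / \<delta> - M * \<phi> + n"
proof -
  have \<phi>: "\<phi> > 0" "n / \<phi> = n * d / (2 * (1 + d))" "\<delta> * \<phi> = 2 / (d + 2)" "1 / \<delta> = 1 + d + \<phi>"
    using d by (simp_all add: \<phi>_def \<delta>_def divide_simps) (simp_all add: algebra_simps)
  have nm: "n * d \<le> m * d"
    using n d by simp
  have M: "(1 + d) * M > n * (1 + d) - n * d / 2"
    using l n nm by (simp add: M_def algebra_simps)
  have a: "(1 + d) * (M - n / \<phi>) = (1 + d) * M - n * d / 2"
    unfolding \<phi>(2) using d by (simp add: field_simps)
  have "0 < (1 + d) * (M - n / \<phi>)"
    unfolding a using M n by (simp add: algebra_simps)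
  then show "0 \<le> M - n / \<phi>"
    using d by (simp add: zero_less_mult_iff)
  have "d * (n * (d + 2)) \<le> d * (2 * (1 + d) * M)"
    using M d by (intro mult_left_mono) (auto simp: algebra_simps)
  then have "n / \<phi> \<le> M * (d / (d + 2))"
    unfolding \<phi>(2) using d by (simp add: field_simps)
  also have "d / (d + 2) = 1 - \<delta> * \<phi>"
    unfolding \<phi>(3) using d by (simp add: field_simps)
  finally show "M * \<delta> \<le> (M - n / \<phi>) / \<phi>"
    using \<phi>(1) by (simp add: pos_le_divide_eq algebra_simps)
  have "(M - n / \<phi>) / \<delta> - M * \<phi> + n = (M - n / \<phi>) * (1 / \<delta>) - M * \<phi> + n"
    by simp
  also have "\<dots> = (1 + d) * (M - n / \<phi>)"
    unfolding \<phi>(4) using \<phi>(1) by (simp add: field_simps)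
  also have "\<dots> = (1 + d) * m - (1 + d) * l - n * d / 2"
    unfolding a by (simp add: M_def algebra_simps)
  finally show "m < (M - n / \<phi>) / \<delta> - M * \<phi> + n"
    using l nm by (simp add: algebra_simps)
qed

lemma barrier_height_less:
  fixes d n K :: real
  assumes d: "d > 0" and n: "n > 0" and K: "K \<le> (1 + d) * n"
  defines "\<phi> \<equiv> 2 * (1 + d) / d" and "\<delta> \<equiv> d / ((1 + d) * (d + 2))"
  shows "(1 + d) * (\<delta> * K - n / \<phi>) < n * d / 2"
proof -
  have "\<delta> * K \<le> \<delta> * ((1 + d) * n)"
    using K d by (intro mult_left_mono) (auto simp: \<delta>_def)
  then have "\<delta> * K - n / \<phi> \<le> \<delta> * ((1 + d) * n) - n / \<phi>"
    by simp
  also have "\<dots> = n * d\<^sup>2 / (2 * (1 + d) * (d + 2))"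
    unfolding \<phi>_def \<delta>_def using d by (simp add: divide_simps) (simp add: algebra_simps power2_eq_square)
  finally have "(1 + d) * (\<delta> * K - n / \<phi>) \<le> (1 + d) * (n * d\<^sup>2 / (2 * (1 + d) * (d + 2)))"
    using d by (intro mult_left_mono) auto
  also have "\<dots> = n * d / 2 * (d / (d + 2))"
    using d by (simp add: divide_simps) (simp add: algebra_simps power2_eq_square)
  also have "\<dots> < n * d / 2 * 1"
    using n d by (intro mult_strict_left_mono) auto
  finally show ?thesis
    by simp
qed

definition frame_constant :: "real \<Rightarrow> real" where
  "frame_constant d = d\<^sup>2 / (4 * (1 + d) * (d + 2))"

lemma frame_constant_pos: "d > 0 \<Longrightarrow> 0 < frame_constant d"
  by (simp add: frame_constant_def)

context tight_frame
begin

lemma barrier_iterate: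
  fixes d \<phi> \<delta> :: real and K :: nat
  assumes d: "d > 0" and ge: "card L \<le> card T" and K: "K \<le> (1 + d) * card L"
  defines "\<phi> \<equiv> 2 * (1 + d) / d" and "\<delta> \<equiv> d / ((1 + d) * (d + 2))"
  shows "\<exists>J\<subseteq>T. card J \<le> K \<and> barrier \<phi> J (\<delta> * K - card L / \<phi>)"
  using K
proof (induction K)
  case 0
  have "\<phi> > 0"
    using d by (simp add: \<phi>_def)
  then show ?case
    using barrier_empty by (intro exI[of _ "{}"]) auto
next
  case (Suc K)
  define n where "n = real (card L)"
  define l where "l = \<delta> * K - n / \<phi>"
  have n: "0 < n" "n \<le> card T"
    using ge nonempty_index by (auto simp: n_def card_gt_0_iff)
  have pos: "\<delta> > 0" "\<phi> > 0"
    using d by (auto simp: \<phi>_def \<delta>_def)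
  have "\<delta> * \<phi> = 2 / (d + 2)"
    using d by (simp add: \<phi>_def \<delta>_def divide_simps)
  then have \<delta>\<phi>: "\<delta> * \<phi> < 1"
    using d by simp
  obtain J where J: "J \<subseteq> T" "card J \<le> K" "barrier \<phi> J l"
    using Suc unfolding l_def n_def by auto
  have "l + \<delta> = \<delta> * Suc K - n / \<phi>"
    by (simp add: l_def algebra_simps)
  then have "(1 + d) * (l + \<delta>) < n * d / 2"
    using barrier_height_less[OF d n(1) Suc.prems[folded n_def], folded \<phi>_def \<delta>_def] by simp
  note M = barrier_parameters[OF d n this, folded \<phi>_def \<delta>_def]
  obtain J' where "J' \<subseteq> T" "card J' \<le> Suc (card J)" "barrier \<phi> J' (l + \<delta>)"
    using barrier_step[OF J(1,3) pos \<delta>\<phi> M[unfolded n_def]] by blast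
  then show ?case
    using J(2) by (intro exI[of _ J']) (auto simp: l_def n_def algebra_simps)
qed

theorem row_selection:
  fixes d :: real
  assumes d: "d > 0" and ge: "card L \<le> card T" and large: "4 \<le> d * card L"
  shows "\<exists>J\<subseteq>T. card J \<le> (1 + d) * card L \<and>
    (\<forall>x. frame_constant d * card L * norm_sq x \<le> (\<Sum>t\<in>J. (cmod (inner_prod (u t) x))\<^sup>2))"
proof -
  define \<phi> \<delta> n where "\<phi> = 2 * (1 + d) / d" and "\<delta> = d / ((1 + d) * (d + 2))" and "n = real (card L)"
  define K where "K = nat \<lfloor>(1 + d) * n\<rfloor>"
  have "0 \<le> (1 + d) * n"
    using d by (simp add: n_def)
  then have K: "K \<le> (1 + d) * n" "(1 + d) * n - 1 \<le> K"
    unfolding K_def by (auto simp: of_nat_nat)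
  obtain J where J: "J \<subseteq> T" "card J \<le> K" "barrier \<phi> J (\<delta> * K - n / \<phi>)"
    using barrier_iterate[OF d ge K(1)[unfolded n_def]] unfolding \<phi>_def \<delta>_def n_def by blast
  have "frame_constant d * n = \<delta> * (d / 4 * n)"
    using d by (simp add: frame_constant_def \<delta>_def divide_simps power2_eq_square)
  also have "\<dots> \<le> \<delta> * ((1 + d) * n - 1 - n * (d + 2) / 2)"
    using d large by (intro mult_left_mono) (auto simp: \<delta>_def n_def field_simps)
  also have "\<dots> = \<delta> * ((1 + d) * n - 1) - n / \<phi>"
    using d by (simp add: \<phi>_def \<delta>_def divide_simps) (simp add: algebra_simps)
  also have "\<dots> \<le> \<delta> * K - n / \<phi>"
    using K d by (intro diff_right_mono mult_left_mono) (auto simp: \<delta>_def)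
  finally have bound: "frame_constant d * n \<le> \<delta> * K - n / \<phi>" .
  have "frame_constant d * n * norm_sq x \<le> (\<Sum>t\<in>J. (cmod (inner_prod (u t) x))\<^sup>2)" for x
    using mult_right_mono[OF bound norm_sq_nonneg] barrier_lower_bound[OF J(3)] by (rule order_trans)
  then show ?thesis
    using J K(1) unfolding n_def by (intro exI[of _ J]) auto
qed

end

section \<open>Fourier coefficients of square integrable functions on a period\<close>

definition L2per :: "(real \<Rightarrow> complex) set" where
  "L2per = {g. g \<in> borel_measurable borel \<and> (\<forall>t. t \<notin> {0..2*pi} \<longrightarrow> g t = 0) \<and>
     integrable lborel (\<lambda>t. (cmod (g t))\<^sup>2)}"

definition L2_sq :: "(real \<Rightarrow> complex) \<Rightarrow> real" where
  "L2_sq g = (\<integral>t. (cmod (g t))\<^sup>2 \<partial>lborel)"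

definition fourier :: "(real \<Rightarrow> complex) \<Rightarrow> real \<Rightarrow> complex" where
  "fourier g x = (\<integral>t. g t * cis (x * t) \<partial>lborel)"

lemma L2perD:
  assumes "g \<in> L2per"
  shows "g \<in> borel_measurable borel" "t \<notin> {0..2*pi} \<Longrightarrow> g t = 0" "integrable lborel (\<lambda>t. (cmod (g t))\<^sup>2)"
  using assms by (auto simp: L2per_def)

lemma measurable_cnj [measurable]: "cnj \<in> borel_measurable borel"
  by (intro borel_measurable_continuous_onI continuous_intros)

lemma measurable_cis [measurable]: "cis \<in> borel_measurable borel"
  by (intro borel_measurable_continuous_onI continuous_intros)

lemma cmod_add_sq_le: "(cmod (a + b))\<^sup>2 \<le> 2 * (cmod a)\<^sup>2 + 2 * (cmod b)\<^sup>2"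
proof -
  have "(cmod (a + b))\<^sup>2 \<le> (cmod a + cmod b)\<^sup>2"
    by (intro power_mono norm_triangle_ineq) auto
  also have "\<dots> \<le> 2 * (cmod a)\<^sup>2 + 2 * (cmod b)\<^sup>2"
    using zero_le_power2[of "cmod a - cmod b"] by (simp add: power2_eq_square algebra_simps)
  finally show ?thesis .
qed

lemma L2per_mult_bounded:
  assumes g: "g \<in> L2per" and h: "h \<in> borel_measurable borel" and B: "\<And>t. cmod (h t) \<le> B"
  shows "(\<lambda>t. h t * g t) \<in> L2per"
proof -
  have "integrable lborel (\<lambda>t. (cmod (h t * g t))\<^sup>2)"
  proof (rule Bochner_Integration.integrable_bound)
    show "integrable lborel (\<lambda>t. B\<^sup>2 * (cmod (g t))\<^sup>2)"
      using L2perD(3)[OF g] by simp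
    show "(\<lambda>t. (cmod (h t * g t))\<^sup>2) \<in> borel_measurable lborel"
      using h L2perD(1)[OF g] by measurable
    show "AE t in lborel. norm ((cmod (h t * g t))\<^sup>2) \<le> norm (B\<^sup>2 * (cmod (g t))\<^sup>2)"
    proof (rule AE_I2)
      fix t
      have "(cmod (h t))\<^sup>2 \<le> B\<^sup>2"
        using B[of t] by (intro power_mono) auto
      then show "norm ((cmod (h t * g t))\<^sup>2) \<le> norm (B\<^sup>2 * (cmod (g t))\<^sup>2)"
        by (simp add: norm_mult power_mult_distrib mult_right_mono)
    qed
  qed
  then show ?thesis
    using g h by (auto simp: L2per_def)
qed

lemma L2per_scale: "g \<in> L2per \<Longrightarrow> (\<lambda>t. c * g t) \<in> L2per"
  by (rule L2per_mult_bounded[where B = "cmod c"]) auto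

lemma L2per_add:
  assumes g: "g \<in> L2per" and h: "h \<in> L2per"
  shows "(\<lambda>t. g t + h t) \<in> L2per"
proof -
  have "integrable lborel (\<lambda>t. (cmod (g t + h t))\<^sup>2)"
  proof (rule Bochner_Integration.integrable_bound)
    show "integrable lborel (\<lambda>t. 2 * (cmod (g t))\<^sup>2 + 2 * (cmod (h t))\<^sup>2)"
      using L2perD(3)[OF g] L2perD(3)[OF h] by simp
    show "(\<lambda>t. (cmod (g t + h t))\<^sup>2) \<in> borel_measurable lborel"
      using L2perD(1)[OF h] L2perD(1)[OF g] by measurable
  qed (use cmod_add_sq_le in auto)
  then show ?thesis
    using g h by (auto simp: L2per_def)
qed

lemma L2per_diff: "g \<in> L2per \<Longrightarrow> h \<in> L2per \<Longrightarrow> (\<lambda>t. g t - h t) \<in> L2per"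
  using L2per_add[of g "\<lambda>t. (-1) * h t"] L2per_scale[of h "-1"] by simp

lemma L2per_sum: "(\<And>k. k \<in> K \<Longrightarrow> g k \<in> L2per) \<Longrightarrow> (\<lambda>t. \<Sum>k\<in>K. g k t) \<in> L2per"
proof (induction K rule: infinite_finite_induct)
  case (insert k K)
  then show ?case
    by (auto intro!: L2per_add)
qed (simp_all add: L2per_def)

lemma L2per_indicator:
  assumes "A \<in> sets borel"
  shows "(\<lambda>t. indicator (A \<inter> {0..2*pi}) t :: complex) \<in> L2per"
proof -
  have "(\<lambda>t. (cmod (indicator (A \<inter> {0..2*pi}) t))\<^sup>2) = (indicator (A \<inter> {0..2*pi}) :: real \<Rightarrow> real)"
    by (auto simp: indicator_def)
  moreover have "integrable lborel (indicator (A \<inter> {0..2*pi}) :: real \<Rightarrow> real)"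
  proof (rule integrable_real_indicator)
    have "emeasure lborel (A \<inter> {0..2*pi}) \<le> emeasure lborel {0..2*pi}"
      using assms by (intro emeasure_mono) auto
    then show "emeasure lborel (A \<inter> {0..2*pi}) < \<infinity>"
      by (simp add: order_le_less_trans)
  qed (use assms in auto)
  ultimately show ?thesis
    using assms by (auto simp: L2per_def)
qed

lemma L2per_prod_integrable:
  assumes g: "g \<in> L2per" and h: "h \<in> L2per"
  shows "integrable lborel (\<lambda>t. g t * cnj (h t))"
proof (rule Bochner_Integration.integrable_bound)
  show "integrable lborel (\<lambda>t. (cmod (g t))\<^sup>2 + (cmod (h t))\<^sup>2)"
    using L2perD(3)[OF g] L2perD(3)[OF h] by simp
  show "(\<lambda>t. g t * cnj (h t)) \<in> borel_measurable lborel"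
    using L2perD(1)[OF h] L2perD(1)[OF g] by measurable
  show "AE t in lborel. norm (g t * cnj (h t)) \<le> norm ((cmod (g t))\<^sup>2 + (cmod (h t))\<^sup>2)"
  proof (rule AE_I2)
    fix t
    have "2 * (cmod (g t) * cmod (h t)) \<le> (cmod (g t))\<^sup>2 + (cmod (h t))\<^sup>2"
      using zero_le_power2[of "cmod (g t) - cmod (h t)"] by (simp add: power2_eq_square algebra_simps)
    moreover have "0 \<le> cmod (g t) * cmod (h t)"
      by simp
    ultimately have "cmod (g t) * cmod (h t) \<le> (cmod (g t))\<^sup>2 + (cmod (h t))\<^sup>2"
      by linarith
    then show "norm (g t * cnj (h t)) \<le> norm ((cmod (g t))\<^sup>2 + (cmod (h t))\<^sup>2)"
      by (simp add: norm_mult)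
  qed
qed

definition cexp :: "real \<Rightarrow> real \<Rightarrow> complex" where
  "cexp x t = indicator {0..2*pi} t * cis (x * t)"

lemma cexp_L2per: "cexp x \<in> L2per"
proof -
  have "(\<lambda>t. cis (x * t) * indicator (UNIV \<inter> {0..2*pi}) t) \<in> L2per"
    by (rule L2per_mult_bounded[OF L2per_indicator, where B = 1]) auto
  moreover have "(\<lambda>t. cis (x * t) * indicator (UNIV \<inter> {0..2*pi}) t) = cexp x"
    by (auto simp: cexp_def)
  ultimately show ?thesis
    by simp
qed

lemma L2per_mult_cnj_cexp: "g \<in> L2per \<Longrightarrow> g t * cnj (cexp (- x) t) = g t * cis (x * t)"
  by (cases "t \<in> {0..2*pi}") (auto simp: cexp_def cis_cnj dest: L2perD(2))

lemma fourier_eq: "g \<in> L2per \<Longrightarrow> fourier g x = (\<integral>t. g t * cnj (cexp (- x) t) \<partial>lborel)"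
  unfolding fourier_def by (simp add: L2per_mult_cnj_cexp)

lemma fourier_integrable: "g \<in> L2per \<Longrightarrow> integrable lborel (\<lambda>t. g t * cis (x * t))"
  using L2per_prod_integrable[OF _ cexp_L2per, of g "- x"] by (simp add: L2per_mult_cnj_cexp)

lemma fourier_diff: "g \<in> L2per \<Longrightarrow> h \<in> L2per \<Longrightarrow> fourier (\<lambda>t. g t - h t) x = fourier g x - fourier h x"
  unfolding fourier_def by (simp add: left_diff_distrib fourier_integrable)

lemma fourier_scale: "fourier (\<lambda>t. c * g t) x = c * fourier g x"
  unfolding fourier_def by (simp add: mult.assoc)

lemma fourier_sum:
  "finite K \<Longrightarrow> (\<And>k. k \<in> K \<Longrightarrow> g k \<in> L2per) \<Longrightarrow> fourier (\<lambda>t. \<Sum>k\<in>K. g k t) x = (\<Sum>k\<in>K. fourier (g k) x)"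
  unfolding fourier_def sum_distrib_right by (simp add: fourier_integrable)

lemma L2_sq_nonneg: "0 \<le> L2_sq g"
  by (simp add: L2_sq_def)

lemma L2_sq_scale: "L2_sq (\<lambda>t. c * g t) = (cmod c)\<^sup>2 * L2_sq g"
  unfolding L2_sq_def by (simp add: norm_mult power_mult_distrib)

lemma L2_sq_add_le:
  assumes "g \<in> L2per" "h \<in> L2per"
  shows "L2_sq (\<lambda>t. g t + h t) \<le> 2 * L2_sq g + 2 * L2_sq h"
proof -
  have "L2_sq (\<lambda>t. g t + h t) \<le> (\<integral>t. 2 * (cmod (g t))\<^sup>2 + 2 * (cmod (h t))\<^sup>2 \<partial>lborel)"
    unfolding L2_sq_def using assms L2perD(3) L2per_add[OF assms]
    by (intro integral_mono) (auto simp: cmod_add_sq_le)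
  then show ?thesis
    unfolding L2_sq_def using assms by (simp add: L2perD(3))
qed

lemma L2_sq_diff:
  assumes g: "g \<in> L2per" and h: "h \<in> L2per"
  shows "L2_sq (\<lambda>t. g t - h t) = L2_sq g - 2 * Re (\<integral>t. g t * cnj (h t) \<partial>lborel) + L2_sq h"
proof -
  note integrable = L2per_prod_integrable[OF g h]
  have "(cmod (a - b))\<^sup>2 = (cmod a)\<^sup>2 - 2 * Re (a * cnj b) + (cmod b)\<^sup>2" for a b
    unfolding cmod_power2 by (simp add: power2_eq_square algebra_simps)
  then show ?thesis
    unfolding L2_sq_def integral_Re[OF integrable, symmetric] using integrable_Re[OF integrable] L2perD(3) g h
    by (simp del: times_complex.sel)
qed

lemma integral_cexp:
  "(\<integral>t. cexp (of_int k) t \<partial>lborel) = (if k = 0 then 2 * complex_of_real pi else 0)"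
proof (cases "k = 0")
  case True
  have "(\<integral>t. cexp (of_int k) t \<partial>lborel) = (\<integral>t. indicator {0..2*pi} t *\<^sub>R (1::complex) \<partial>lborel)"
    using True by (intro Bochner_Integration.integral_cong refl) (auto simp: cexp_def indicator_def)
  then show ?thesis
    using True by (simp add: scaleR_conv_of_real)
next
  case False
  have "has_bochner_integral lborel (\<lambda>t. indicator {0..2*pi} t *\<^sub>R cis (of_int k * t))
     (cis (of_int k * (2*pi)) / (\<i> * of_int k) - cis (of_int k * 0) / (\<i> * of_int k))"
  proof (rule has_bochner_integral_FTC_Icc)
    fix x :: real
    have "((\<lambda>t. exp (\<i> * of_int k * complex_of_real t) / (\<i> * of_int k))
        has_vector_derivative exp (\<i> * of_int k * complex_of_real x)) (at x within {0..2*pi})"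
      by (rule has_vector_derivative_real_field) (use False in \<open>auto intro!: derivative_eq_intros\<close>)
    then show "((\<lambda>t. cis (of_int k * t) / (\<i> * of_int k))
        has_vector_derivative cis (of_int k * x)) (at x within {0..2*pi})"
      by (simp add: cis_conv_exp mult_ac)
  qed (auto intro!: continuous_intros)
  moreover have "cis (of_int k * (2*pi)) = 1"
    using cis_multiple_2pi[of "of_int k"] by (simp add: mult_ac)
  ultimately have "(\<integral>t. indicator {0..2*pi} t *\<^sub>R cis (of_int k * t) \<partial>lborel) = 0"
    by (simp add: has_bochner_integral_integral_eq)
  then show ?thesis
    using False by (simp add: cexp_def scaleR_conv_of_real of_real_indicator)
qed

lemma fourier_cexp: "fourier (cexp (of_int j)) (of_int k) = (if j + k = 0 then 2 * complex_of_real pi else 0)"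
proof -
  have "fourier (cexp (of_int j)) (of_int k) = (\<integral>t. cexp (of_int (j + k)) t \<partial>lborel)"
    unfolding fourier_def cexp_def
    by (intro Bochner_Integration.integral_cong refl) (simp add: cis_mult[symmetric] algebra_simps)
  then show ?thesis
    unfolding integral_cexp .
qed

definition trigpoly :: "int set \<Rightarrow> (int \<Rightarrow> complex) \<Rightarrow> real \<Rightarrow> complex" where
  "trigpoly K c = (\<lambda>t. \<Sum>k\<in>K. c k * cexp (- of_int k) t)"

lemma trigpoly_L2per: "trigpoly K c \<in> L2per"
  unfolding trigpoly_def by (intro L2per_sum L2per_scale cexp_L2per)

lemma integral_mult_cnj_trigpoly:
  assumes g: "g \<in> L2per"
  shows "(\<integral>t. g t * cnj (trigpoly K c t) \<partial>lborel) = (\<Sum>k\<in>K. cnj (c k) * fourier g (of_int k))"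
proof -
  have "(\<integral>t. g t * cnj (trigpoly K c t) \<partial>lborel)
      = (\<integral>t. (\<Sum>k\<in>K. cnj (c k) * (g t * cnj (cexp (- of_int k) t))) \<partial>lborel)"
    unfolding trigpoly_def
    by (intro Bochner_Integration.integral_cong refl) (simp add: sum_distrib_left mult_ac)
  also have "\<dots> = (\<Sum>k\<in>K. cnj (c k) * (\<integral>t. g t * cnj (cexp (- of_int k) t) \<partial>lborel))"
    using L2per_prod_integrable[OF g cexp_L2per] by simp
  finally show ?thesis
    by (simp add: fourier_eq[OF g])
qed

lemma fourier_trigpoly:
  assumes K: "finite K" and k: "k \<in> K"
  shows "fourier (trigpoly K c) (of_int k) = 2 * complex_of_real pi * c k"
proof -
  have "fourier (trigpoly K c) (of_int k) = (\<Sum>j\<in>K. c j * fourier (cexp (of_int (- j))) (of_int k))"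
    unfolding trigpoly_def using K
    by (subst fourier_sum) (auto intro!: L2per_scale cexp_L2per simp: fourier_scale)
  also have "\<dots> = (\<Sum>j\<in>K. if j = k then c k * (2 * complex_of_real pi) else 0)"
    unfolding fourier_cexp by (intro sum.cong refl) auto
  finally show ?thesis
    using K k by simp
qed

lemma L2_sq_trigpoly:
  assumes "finite K"
  shows "L2_sq (trigpoly K c) = (\<Sum>k\<in>K. 2 * pi * (cmod (c k))\<^sup>2)"
proof -
  have "L2_sq (trigpoly K c) = Re (\<integral>t. trigpoly K c t * cnj (trigpoly K c t) \<partial>lborel)"
    unfolding L2_sq_def integral_complex_of_real[symmetric] complex_norm_square
    by (simp add: complex_norm_square[symmetric] del: of_real_power)
  also have "\<dots> = (\<Sum>k\<in>K. Re (cnj (c k) * (2 * complex_of_real pi * c k)))"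
    unfolding integral_mult_cnj_trigpoly[OF trigpoly_L2per] Re_sum
    by (intro sum.cong refl) (simp only: fourier_trigpoly[OF assms])
  also have "\<dots> = (\<Sum>k\<in>K. 2 * pi * (cmod (c k))\<^sup>2)"
    unfolding cmod_power2 by (simp add: power2_eq_square algebra_simps)
  finally show ?thesis .
qed

lemma L2_sq_diff_trigpoly:
  assumes g: "g \<in> L2per" and K: "finite K"
  shows "L2_sq (\<lambda>t. g t - trigpoly K c t) = L2_sq g - (\<Sum>k\<in>K. (cmod (fourier g k))\<^sup>2) / (2 * pi)
    + (\<Sum>k\<in>K. (cmod (fourier g k - 2 * complex_of_real pi * c k))\<^sup>2) / (2 * pi)"
proof -
  have complete_square: "(cmod (z - 2 * complex_of_real pi * w))\<^sup>2 / (2 * pi)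
      = (cmod z)\<^sup>2 / (2 * pi) - 2 * Re (cnj w * z) + 2 * pi * (cmod w)\<^sup>2" for z w
    unfolding cmod_power2 by (simp add: field_simps power2_eq_square)
  show ?thesis
    unfolding L2_sq_diff[OF g trigpoly_L2per] integral_mult_cnj_trigpoly[OF g] L2_sq_trigpoly[OF K]
      sum_divide_distrib complete_square sum.distrib sum_subtractf Re_sum sum_distrib_left
    by simp
qed

lemma bessel:
  assumes "g \<in> L2per" "finite K"
  shows "(\<Sum>k\<in>K. (cmod (fourier g (of_int k)))\<^sup>2) \<le> 2 * pi * L2_sq g"
proof -
  have "0 \<le> L2_sq (\<lambda>t. g t - trigpoly K (\<lambda>k. fourier g k / (2 * pi)) t)"
    by (rule L2_sq_nonneg)
  also have "\<dots> = L2_sq g - (\<Sum>k\<in>K. (cmod (fourier g k))\<^sup>2) / (2 * pi)"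
    unfolding L2_sq_diff_trigpoly[OF assms] by simp
  finally show ?thesis
    by (simp add: field_simps)
qed

definition trigpolys :: "(real \<Rightarrow> complex) set" where
  "trigpolys = {trigpoly K c | K c. finite K}"

lemma trigpolysE:
  assumes "p \<in> trigpolys"
  obtains K c where "finite K" "p = trigpoly K c"
  using assms by (auto simp: trigpolys_def)

lemma trigpolys_L2per: "p \<in> trigpolys \<Longrightarrow> p \<in> L2per"
  by (auto simp: trigpolys_def trigpoly_L2per)

lemma trigpolys_cexp: "(\<lambda>t. c * cexp (of_int j) t) \<in> trigpolys"
proof -
  have "(\<lambda>t. c * cexp (of_int j) t) = trigpoly {- j} (\<lambda>_. c)"
    by (simp add: trigpoly_def)
  then show ?thesis
    unfolding trigpolys_def by blast
qed

lemma trigpolys_zero: "(\<lambda>t. 0) \<in> trigpolys"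
  using trigpolys_cexp[of 0 0] by simp

lemma trigpolys_scale:
  assumes "p \<in> trigpolys"
  shows "(\<lambda>t. a * p t) \<in> trigpolys"
proof -
  obtain K c where "finite K" "p = trigpoly K c"
    using assms by (rule trigpolysE)
  moreover have "(\<lambda>t. a * trigpoly K c t) = trigpoly K (\<lambda>k. a * c k)"
    by (simp add: trigpoly_def sum_distrib_left mult.assoc)
  ultimately show ?thesis
    unfolding trigpolys_def by blast
qed

lemma trigpoly_superset:
  "finite K' \<Longrightarrow> K \<subseteq> K' \<Longrightarrow> trigpoly K c = trigpoly K' (\<lambda>k. if k \<in> K then c k else 0)"
  unfolding trigpoly_def by (intro ext sum.mono_neutral_cong_left) auto

lemma trigpolys_add:
  assumes "p \<in> trigpolys" "q \<in> trigpolys"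
  shows "(\<lambda>t. p t + q t) \<in> trigpolys"
proof -
  obtain K c where p: "finite K" "p = trigpoly K c"
    using assms(1) by (rule trigpolysE)
  obtain K' c' where q: "finite K'" "q = trigpoly K' c'"
    using assms(2) by (rule trigpolysE)
  let ?c = "\<lambda>k. (if k \<in> K then c k else 0) + (if k \<in> K' then c' k else 0)"
  have "p = trigpoly (K \<union> K') (\<lambda>k. if k \<in> K then c k else 0)"
    "q = trigpoly (K \<union> K') (\<lambda>k. if k \<in> K' then c' k else 0)"
    unfolding p(2) q(2) using p(1) q(1) by (intro trigpoly_superset; auto)+
  then have "(\<lambda>t. p t + q t) = trigpoly (K \<union> K') ?c"
    by (simp add: trigpoly_def sum.distrib[symmetric] distrib_right)
  then show ?thesis
    using p(1) q(1) unfolding trigpolys_def by blast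
qed

lemma trigpolys_sum: "(\<And>k. k \<in> K \<Longrightarrow> p k \<in> trigpolys) \<Longrightarrow> (\<lambda>t. \<Sum>k\<in>K. p k t) \<in> trigpolys"
  by (induction K rule: infinite_finite_induct) (simp_all add: trigpolys_zero trigpolys_add)

lemma cexp_mult: "cexp x t * cexp y t = cexp (x + y) t"
  by (auto simp: cexp_def indicator_def cis_mult algebra_simps)

lemma trigpolys_mult:
  assumes "p \<in> trigpolys" "q \<in> trigpolys"
  shows "(\<lambda>t. p t * q t) \<in> trigpolys"
proof -
  obtain K c where p: "p = trigpoly K c"
    using assms(1) by (rule trigpolysE)
  obtain K' c' where q: "q = trigpoly K' c'"
    using assms(2) by (rule trigpolysE)
  have "cexp (of_int (- k - j)) t = cexp (- of_int k) t * cexp (- of_int j) t" for k j t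
    by (simp add: cexp_mult)
  then have "(\<lambda>t. p t * q t) = (\<lambda>t. \<Sum>k\<in>K. \<Sum>j\<in>K'. (c k * c' j) * cexp (of_int (- k - j)) t)"
    unfolding p q trigpoly_def sum_product by (intro ext sum.cong refl) (simp only: mult_ac)
  also have "\<dots> \<in> trigpolys"
    by (intro trigpolys_sum trigpolys_cexp)
  finally show ?thesis .
qed

subsection \<open>Density of the trigonometric polynomials\<close>

definition approximable :: "(real \<Rightarrow> complex) \<Rightarrow> bool" where
  "approximable g \<longleftrightarrow> g \<in> L2per \<and> (\<forall>e>0. \<exists>p\<in>trigpolys. L2_sq (\<lambda>t. g t - p t) < e)"

lemma approximable_imp_L2per: "approximable g \<Longrightarrow> g \<in> L2per"
  by (simp add: approximable_def)

lemma approximableE: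
  assumes "approximable g" "e > 0"
  obtains p where "p \<in> trigpolys" "L2_sq (\<lambda>t. g t - p t) < e"
  using assms by (auto simp: approximable_def)

lemma approximable_trigpolys: "p \<in> trigpolys \<Longrightarrow> approximable p"
  unfolding approximable_def by (auto intro!: bexI[of _ p] simp: trigpolys_L2per L2_sq_def)

lemma approximable_closure:
  assumes g: "g \<in> L2per" and dense: "\<And>e. e > 0 \<Longrightarrow> \<exists>h. approximable h \<and> L2_sq (\<lambda>t. g t - h t) < e"
  shows "approximable g"
  unfolding approximable_def
proof (intro conjI g allI impI)
  fix e :: real assume "e > 0"
  then have e: "e / 4 > 0"
    by simp
  obtain h where h: "approximable h" "L2_sq (\<lambda>t. g t - h t) < e / 4"
    using dense[OF e] by blast
  obtain p where p: "p \<in> trigpolys" "L2_sq (\<lambda>t. h t - p t) < e / 4"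
    using approximableE[OF h(1) e] .
  have "L2_sq (\<lambda>t. g t - p t) = L2_sq (\<lambda>t. (g t - h t) + (h t - p t))"
    by simp
  also have "\<dots> \<le> 2 * L2_sq (\<lambda>t. g t - h t) + 2 * L2_sq (\<lambda>t. h t - p t)"
    by (intro L2_sq_add_le L2per_diff g approximable_imp_L2per[OF h(1)] trigpolys_L2per p)
  also have "\<dots> < e"
    using h p by simp
  finally show "\<exists>p\<in>trigpolys. L2_sq (\<lambda>t. g t - p t) < e"
    using p by blast
qed

lemma approximable_add:
  assumes g: "approximable g" and h: "approximable h"
  shows "approximable (\<lambda>t. g t + h t)"
  unfolding approximable_def
proof (intro conjI allI impI)
  note L2per = approximable_imp_L2per[OF g] approximable_imp_L2per[OF h]
  show "(\<lambda>t. g t + h t) \<in> L2per"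
    by (intro L2per_add L2per)
  fix e :: real assume "e > 0"
  then have e: "e / 4 > 0"
    by simp
  obtain p where p: "p \<in> trigpolys" "L2_sq (\<lambda>t. g t - p t) < e / 4"
    using approximableE[OF g e] .
  obtain q where q: "q \<in> trigpolys" "L2_sq (\<lambda>t. h t - q t) < e / 4"
    using approximableE[OF h e] .
  have "L2_sq (\<lambda>t. g t + h t - (p t + q t)) = L2_sq (\<lambda>t. (g t - p t) + (h t - q t))"
    by (simp add: algebra_simps)
  also have "\<dots> \<le> 2 * L2_sq (\<lambda>t. g t - p t) + 2 * L2_sq (\<lambda>t. h t - q t)"
    by (intro L2_sq_add_le L2per_diff L2per trigpolys_L2per p q)
  also have "\<dots> < e"
    using p q by simp
  finally show "\<exists>p\<in>trigpolys. L2_sq (\<lambda>t. g t + h t - p t) < e"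
    by (intro bexI[of _ "\<lambda>t. p t + q t"] trigpolys_add p q)
qed

lemma approximable_scale:
  assumes g: "approximable g"
  shows "approximable (\<lambda>t. c * g t)"
  unfolding approximable_def
proof (intro conjI allI impI)
  show "(\<lambda>t. c * g t) \<in> L2per"
    by (intro L2per_scale approximable_imp_L2per g)
  fix e :: real assume e: "e > 0"
  have C: "(cmod c)\<^sup>2 + 1 > 0"
    by (simp add: add_nonneg_pos)
  then obtain p where p: "p \<in> trigpolys" "L2_sq (\<lambda>t. g t - p t) < e / ((cmod c)\<^sup>2 + 1)"
    using approximableE[OF g] e by (metis divide_pos_pos)
  have "L2_sq (\<lambda>t. c * g t - c * p t) = (cmod c)\<^sup>2 * L2_sq (\<lambda>t. g t - p t)"
    unfolding L2_sq_scale[symmetric] by (simp add: right_diff_distrib)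
  also have "\<dots> \<le> ((cmod c)\<^sup>2 + 1) * L2_sq (\<lambda>t. g t - p t)"
    by (intro mult_right_mono L2_sq_nonneg) auto
  also have "\<dots> < e"
    using p C by (simp add: field_simps)
  finally show "\<exists>p\<in>trigpolys. L2_sq (\<lambda>t. c * g t - p t) < e"
    by (intro bexI[of _ "\<lambda>t. c * p t"] trigpolys_scale p)
qed

lemma approximable_sum: "(\<And>k. k \<in> K \<Longrightarrow> approximable (g k)) \<Longrightarrow> approximable (\<lambda>t. \<Sum>k\<in>K. g k t)"
  by (induction K rule: infinite_finite_induct)
    (simp_all add: approximable_trigpolys trigpolys_zero approximable_add)

lemma approximable_limit:
  fixes f :: "nat \<Rightarrow> real \<Rightarrow> complex"
  assumes f: "\<And>n. approximable (f n)" and g: "g \<in> L2per"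
    and lim: "AE t in lborel. (\<lambda>n. f n t) \<longlonglongrightarrow> g t"
    and w: "integrable lborel w" and dominated: "\<And>n t. (cmod (g t - f n t))\<^sup>2 \<le> w t"
  shows "approximable g"
proof (rule approximable_closure[OF g])
  fix e :: real assume e: "e > 0"
  have "(\<lambda>n. \<integral>t. (cmod (g t - f n t))\<^sup>2 \<partial>lborel) \<longlonglongrightarrow> (\<integral>t. 0 \<partial>(lborel :: real measure))"
  proof (rule integral_dominated_convergence[where w = w])
    show "AE t in lborel. (\<lambda>n. (cmod (g t - f n t))\<^sup>2) \<longlonglongrightarrow> 0"
      using lim
    proof eventually_elim
      case (elim t)
      have "(\<lambda>n. (cmod (g t - f n t))\<^sup>2) \<longlonglongrightarrow> (cmod (g t - g t))\<^sup>2"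
        by (intro tendsto_intros elim)
      then show ?case
        by simp
    qed
    show "(\<lambda>t. (cmod (g t - f n t))\<^sup>2) \<in> borel_measurable lborel" for n
      using L2perD(1)[OF g] L2perD(1)[OF approximable_imp_L2per[OF f[of n]]] by measurable
  qed (use w dominated in auto)
  then have "eventually (\<lambda>n. L2_sq (\<lambda>t. g t - f n t) < e) sequentially"
    unfolding L2_sq_def using e by (auto dest: order_tendstoD)
  then obtain n where "L2_sq (\<lambda>t. g t - f n t) < e"
    by (auto simp: eventually_sequentially)
  then show "\<exists>h. approximable h \<and> L2_sq (\<lambda>t. g t - h t) < e"
    using f by blast
qed

lemma cexp_0: "cexp 0 t = indicator {0..2*pi} t"
  by (simp add: cexp_def)

lemma trigpolys_circle_linear:
  assumes "bounded_linear (f :: complex \<Rightarrow> real)"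
  shows "(\<lambda>t. cexp 0 t * of_real (f (cis t))) \<in> trigpolys"
proof -
  interpret bounded_linear f by fact
  define a b where "a = of_real (f 1) / 2 + of_real (f \<i>) / (2 * \<i>)"
    and "b = of_real (f 1) / 2 - of_real (f \<i>) / (2 * \<i>)"
  have f_cis: "f (cis t) = cos t * f 1 + sin t * f \<i>" for t
  proof -
    have "cis t = cos t *\<^sub>R 1 + sin t *\<^sub>R \<i>"
      by (simp add: complex_eq_iff)
    then show ?thesis
      by (metis add scaleR real_scaleR_def)
  qed
  have euler: "complex_of_real (cos t) = (cis t + cis (- t)) / 2"
    "complex_of_real (sin t) = (cis t - cis (- t)) / (2 * \<i>)" for t
    by (auto simp: complex_eq_iff Re_divide Im_divide power2_eq_square)
  have "cexp 0 t * of_real (f (cis t)) = a * cexp (of_int 1) t + b * cexp (of_int (- 1)) t" for t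
    unfolding f_cis of_real_add of_real_mult euler a_def b_def by (simp add: cexp_def field_simps)
  then have "(\<lambda>t. cexp 0 t * of_real (f (cis t))) = (\<lambda>t. a * cexp (of_int 1) t + b * cexp (of_int (- 1)) t)"
    by blast
  also have "\<dots> \<in> trigpolys"
    by (intro trigpolys_add trigpolys_cexp)
  finally show ?thesis .
qed

lemma trigpolys_circle_polynomial:
  assumes "real_polynomial_function (q :: complex \<Rightarrow> real)"
  shows "(\<lambda>t. cexp 0 t * of_real (q (cis t))) \<in> trigpolys"
  using assms
proof (induction q)
  case (linear f)
  then show ?case
    by (rule trigpolys_circle_linear)
next
  case (const c)
  show ?case
    using trigpolys_cexp[of "of_real c" 0] by (simp add: mult.commute)
next
  case (add f g)
  then show ?case
    using trigpolys_add[OF add.IH] by (simp add: algebra_simps)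
next
  case (mult f g)
  have "cexp 0 t * of_real (f (cis t)) * (cexp 0 t * of_real (g (cis t)))
      = cexp 0 t * of_real (f (cis t) * g (cis t))" for t
    by (simp add: cexp_0 indicator_def)
  then show ?case
    using trigpolys_mult[OF mult.IH] by (simp only:)
qed

lemma L2_sq_le_bound:
  assumes g: "g \<in> L2per" and B: "\<And>t. t \<in> {0..2*pi} \<Longrightarrow> cmod (g t) \<le> B"
  shows "L2_sq g \<le> 2 * pi * B\<^sup>2"
proof -
  have "L2_sq g \<le> (\<integral>t. B\<^sup>2 * indicator {0..2*pi} t \<partial>lborel)"
    unfolding L2_sq_def
  proof (intro integral_mono)
    show "(cmod (g t))\<^sup>2 \<le> B\<^sup>2 * indicator {0..2*pi} t" for t
      using B[of t] L2perD(2)[OF g, of t] by (cases "t \<in> {0..2*pi}") (auto intro: power_mono)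
  qed (use L2perD(3)[OF g] in auto)
  then show ?thesis
    by (simp add: mult.commute)
qed

lemma L2per_circle_continuous:
  fixes F :: "complex \<Rightarrow> real"
  assumes F: "continuous_on (sphere 0 1) F"
  shows "(\<lambda>t. cexp 0 t * of_real (F (cis t))) \<in> L2per"
proof -
  have "bounded (F ` sphere 0 1)"
    by (intro compact_imp_bounded compact_continuous_image F) auto
  then obtain B where "\<forall>y\<in>F ` sphere 0 1. norm y \<le> B"
    unfolding bounded_iff by blast
  then have "cmod (of_real (F (cis t))) \<le> B" for t
    by simp
  moreover have "continuous_on UNIV (\<lambda>t. F (cis t))"
    by (rule continuous_on_compose2[OF F]) (auto intro!: continuous_intros)
  then have "(\<lambda>t. complex_of_real (F (cis t))) \<in> borel_measurable borel"
    by (intro borel_measurable_continuous_onI continuous_intros)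
  ultimately show ?thesis
    by (subst mult.commute) (rule L2per_mult_bounded[OF cexp_L2per])
qed

lemma approximable_circle_continuous:
  fixes F :: "complex \<Rightarrow> real"
  assumes F: "continuous_on (sphere 0 1) F"
  shows "approximable (\<lambda>t. cexp 0 t * of_real (F (cis t)))"
  unfolding approximable_def
proof (intro conjI L2per_circle_continuous F allI impI)
  fix e :: real assume e: "e > 0"
  define d where "d = sqrt (e / (4 * pi))"
  have d: "d > 0" "d\<^sup>2 = e / (4 * pi)"
    using e by (auto simp: d_def)
  obtain q where q: "real_polynomial_function q" "\<And>z. z \<in> sphere 0 1 \<Longrightarrow> \<bar>F z - q z\<bar> < d"
    using Stone_Weierstrass_real_polynomial_function[OF compact_sphere F d(1)] by blast
  let ?p = "\<lambda>t. cexp 0 t * of_real (q (cis t))"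
  have p: "?p \<in> trigpolys"
    by (rule trigpolys_circle_polynomial[OF q(1)])
  have "cmod (cexp 0 t * of_real (F (cis t)) - ?p t) \<le> d" if "t \<in> {0..2*pi}" for t
  proof -
    have "cexp 0 t * of_real (F (cis t)) - ?p t = of_real (F (cis t) - q (cis t))"
      using that by (simp add: cexp_0)
    then show ?thesis
      using q(2)[of "cis t"] by (simp only: norm_of_real) simp
  qed
  then have "L2_sq (\<lambda>t. cexp 0 t * of_real (F (cis t)) - ?p t) \<le> 2 * pi * d\<^sup>2"
    by (intro L2_sq_le_bound L2per_diff L2per_circle_continuous F trigpolys_L2per p)
  also have "\<dots> < e"
    using d e by simp
  finally show "\<exists>p\<in>trigpolys. L2_sq (\<lambda>t. cexp 0 t * of_real (F (cis t)) - p t) < e"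
    using p by (intro bexI[of _ ?p])
qed

lemma Arg2pi_cis: "0 \<le> t \<Longrightarrow> t < 2 * pi \<Longrightarrow> Arg2pi (cis t) = t"
  by (rule Arg2pi_unique[of 1]) (auto simp: cis_conv_exp)

lemma open_set_lift_circle:
  assumes "open U"
  obtains V where "open V" "V \<noteq> UNIV" "\<And>t. 0 < t \<Longrightarrow> t < 2 * pi \<Longrightarrow> cis t \<in> V \<longleftrightarrow> t \<in> U"
proof
  let ?V = "- \<real>\<^sub>\<ge>\<^sub>0 \<inter> Arg2pi -` U"
  have "continuous_on (- \<real>\<^sub>\<ge>\<^sub>0) Arg2pi"
    by (intro continuous_at_imp_continuous_on ballI continuous_at_Arg2pi) auto
  then show "open ?V"
    using assms by (intro continuous_open_preimage) (auto intro: closed_nonneg_Reals_complex simp: open_Compl)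
  show "?V \<noteq> UNIV"
    by (metis Compl_iff Int_iff UNIV_I nonneg_Reals_one_I)
  fix t :: real assume t: "0 < t" "t < 2 * pi"
  then have "Arg2pi (cis t) = t"
    by (simp add: Arg2pi_cis)
  moreover from this have "cis t \<notin> \<real>\<^sub>\<ge>\<^sub>0"
    using t Arg2pi_eq_0[of "cis t"] complex_nonneg_Reals_iff[of "cis t"] by (auto simp: complex_is_Real_iff)
  ultimately show "cis t \<in> ?V \<longleftrightarrow> t \<in> U"
    by simp
qed

lemma infdist_indicator_tendsto:
  assumes "closed C" "C \<noteq> {}"
  shows "(\<lambda>n. min 1 (real n * infdist z C)) \<longlonglongrightarrow> indicator (- C) z"
proof (cases "z \<in> C")
  case False
  then have pos: "infdist z C > 0"
    using assms by (simp add: infdist_pos_not_in_closed)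
  obtain N :: nat where N: "1 < real N * infdist z C"
    using reals_Archimedean3[OF pos] by blast
  have "min 1 (real n * infdist z C) = 1" if "N \<le> n" for n
  proof -
    have "real N * infdist z C \<le> real n * infdist z C"
      using that pos by (intro mult_right_mono) auto
    then show ?thesis
      using N by simp
  qed
  then show ?thesis
    using False by (auto intro!: tendsto_eventually eventually_sequentiallyI[of N])
qed simp

lemma approximable_open:
  assumes U: "open U"
  shows "approximable (\<lambda>t. indicator (U \<inter> {0..2*pi}) t)"
proof -
  obtain V where V: "open V" "V \<noteq> UNIV" and lift: "\<And>t. 0 < t \<Longrightarrow> t < 2 * pi \<Longrightarrow> cis t \<in> V \<longleftrightarrow> t \<in> U"
    using open_set_lift_circle[OF U] by blast
  define F where "F = (\<lambda>(n::nat) z. min 1 (real n * infdist z (- V)))"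
  define f where "f = (\<lambda>n t. cexp 0 t * of_real (F n (cis t)))"
  have F_range: "0 \<le> F n z" "F n z \<le> 1" for n z
    by (auto simp: F_def infdist_nonneg)
  show ?thesis
  proof (rule approximable_limit[of f])
    show "approximable (f n)" for n
      unfolding f_def F_def by (intro approximable_circle_continuous continuous_intros)
    show "(\<lambda>t. indicator (U \<inter> {0..2*pi}) t) \<in> L2per"
      using U by (intro L2per_indicator) auto
    show "integrable lborel (\<lambda>t. indicator {0..2*pi} t :: real)"
      by simp
    show "(cmod (indicator (U \<inter> {0..2*pi}) t - f n t))\<^sup>2 \<le> indicator {0..2*pi} t" for n t
    proof (cases "t \<in> {0..2*pi}")
      case True
      then have "indicator (U \<inter> {0..2*pi}) t - f n t = of_real (indicator U t - F n (cis t))"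
        by (simp add: f_def cexp_0 indicator_inter_arith of_real_indicator)
      moreover have "\<bar>indicator U t - F n (cis t)\<bar> \<le> 1"
        using F_range[of n "cis t"] by (auto simp: indicator_def)
      ultimately show ?thesis
        using True by (simp only: norm_of_real) (simp add: abs_square_le_1)
    qed (auto simp: f_def cexp_0)
    show "AE t in lborel. (\<lambda>n. f n t) \<longlonglongrightarrow> indicator (U \<inter> {0..2*pi}) t"
      using AE_lborel_singleton[of 0] AE_lborel_singleton[of "2 * pi"]
    proof eventually_elim
      case (elim t)
      have "(\<lambda>n. f n t) \<longlonglongrightarrow> cexp 0 t * of_real (indicator V (cis t))"
        unfolding f_def F_def using infdist_indicator_tendsto[of "- V" "cis t"] V
        by (intro tendsto_intros) (auto simp: closed_def)
      also have "cexp 0 t * of_real (indicator V (cis t)) = indicator (U \<inter> {0..2*pi}) t"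
        using elim lift[of t] by (auto simp: cexp_0 indicator_def)
      finally show ?case .
    qed
  qed
qed

lemma approximable_indicator:
  assumes A: "A \<in> sets borel"
  shows "approximable (\<lambda>t. indicator (A \<inter> {0..2*pi}) t)"
proof (rule approximable_closure)
  show "(\<lambda>t. indicator (A \<inter> {0..2*pi}) t) \<in> L2per"
    by (rule L2per_indicator[OF A])
  fix e :: real assume e: "e > 0"
  have "A \<in> sets lebesgue"
    using A by simp
  then obtain U where U: "open U" "A \<subseteq> U" "U - A \<in> lmeasurable" "emeasure lebesgue (U - A) < ennreal e"
    using e by (rule sets_lebesgue_outer_open)
  have meas: "(U - A) \<inter> {0..2*pi} \<in> sets borel"
    using U A by auto
  have "(\<lambda>t. (cmod (indicator (A \<inter> {0..2*pi}) t - indicator (U \<inter> {0..2*pi}) t))\<^sup>2)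
      = indicat_real ((U - A) \<inter> {0..2*pi})"
    using U(2) by (auto simp: indicator_def fun_eq_iff)
  then have "L2_sq (\<lambda>t. indicator (A \<inter> {0..2*pi}) t - indicator (U \<inter> {0..2*pi}) t)
      = measure lebesgue ((U - A) \<inter> {0..2*pi})"
    using meas by (simp add: L2_sq_def)
  also have "\<dots> \<le> measure lebesgue (U - A)"
    using U(3) meas by (intro measure_mono_fmeasurable) auto
  also have "\<dots> < e"
    using U(3,4) e by (simp add: emeasure_eq_measure2 ennreal_less_iff)
  finally show "\<exists>h. approximable h \<and> L2_sq (\<lambda>t. indicator (A \<inter> {0..2*pi}) t - h t) < e"
    using approximable_open[OF U(1)] by blast
qed

lemma approximable_simple_function:
  fixes s :: "real \<Rightarrow> complex"
  assumes s: "simple_function borel s" and supp: "\<And>t. t \<notin> {0..2*pi} \<Longrightarrow> s t = 0"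
  shows "approximable s"
proof -
  have "s t = (\<Sum>y\<in>range s. y * indicator (s -` {y} \<inter> {0..2*pi}) t)" for t
  proof (cases "t \<in> {0..2*pi}")
    case True
    have "s t = (\<Sum>y\<in>range s. indicator (s -` {y}) t *\<^sub>R y)"
      by (rule simple_function_indicator_representation_banach
          [OF s, unfolded space_borel Int_UNIV_right, OF UNIV_I])
    also have "\<dots> = (\<Sum>y\<in>range s. y * indicator (s -` {y} \<inter> {0..2*pi}) t)"
      using True by (intro sum.cong refl) (simp add: indicator_def)
    finally show ?thesis .
  qed (simp add: supp)
  then have "s = (\<lambda>t. \<Sum>y\<in>range s. y * indicator (s -` {y} \<inter> {0..2*pi}) t)"
    by (rule ext)
  moreover have "approximable (\<lambda>t. \<Sum>y\<in>range s. y * indicator (s -` {y} \<inter> {0..2*pi}) t)"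
  proof (intro approximable_sum approximable_scale approximable_indicator)
    show "s -` {y} \<in> sets borel" for y
      using simple_functionD(2)[OF s, of "{y}"] by simp
  qed
  ultimately show ?thesis
    by (rule ssubst[where P = approximable])
qed

lemma approximable_L2per:
  assumes g: "g \<in> L2per"
  shows "approximable g"
proof -
  obtain s where s: "\<And>i. simple_function borel (s i)" and lim: "\<And>t. (\<lambda>i. s i t) \<longlonglongrightarrow> g t"
    and bound: "\<And>i t. cmod (s i t) \<le> 2 * cmod (g t)"
    using borel_measurable_implies_sequence_metric[OF L2perD(1)[OF g], of 0] by (auto simp: dist_norm)
  show ?thesis
  proof (rule approximable_limit[OF _ g])
    show "approximable (s i)" for i
    proof (rule approximable_simple_function[OF s])
      show "s i t = 0" if "t \<notin> {0..2*pi}" for t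
        using bound[of i t] L2perD(2)[OF g that] by simp
    qed
    show "AE t in lborel. (\<lambda>n. s n t) \<longlonglongrightarrow> g t"
      using lim by simp
    show "integrable lborel (\<lambda>t. 9 * (cmod (g t))\<^sup>2)"
      using L2perD(3)[OF g] by simp
    show "(cmod (g t - s n t))\<^sup>2 \<le> 9 * (cmod (g t))\<^sup>2" for n t
    proof -
      have "cmod (g t - s n t) \<le> 3 * cmod (g t)"
        using norm_triangle_ineq4[of "g t" "s n t"] bound[of n t] by simp
      then have "(cmod (g t - s n t))\<^sup>2 \<le> (3 * cmod (g t))\<^sup>2"
        by (intro power_mono) auto
      then show ?thesis
        by (simp add: power_mult_distrib)
    qed
  qed
qed

theorem parseval:
  assumes g: "g \<in> L2per"
  shows "((\<lambda>k::int. (cmod (fourier g (of_int k)))\<^sup>2) has_sum 2 * pi * L2_sq g) UNIV"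
proof -
  let ?f = "\<lambda>k::int. (cmod (fourier g (of_int k)))\<^sup>2"
  have summable: "?f summable_on UNIV"
    using bessel[OF g] by (intro nonneg_bdd_above_summable_on bdd_aboveI[of _ "2 * pi * L2_sq g"]) auto
  have "infsum ?f UNIV = 2 * pi * L2_sq g"
  proof (rule antisym)
    show "infsum ?f UNIV \<le> 2 * pi * L2_sq g"
      using bessel[OF g] summable by (intro infsum_le_finite_sums)
    show "2 * pi * L2_sq g \<le> infsum ?f UNIV"
    proof (rule field_le_epsilon)
      fix e :: real assume "e > 0"
      then have "e / (2 * pi) > 0"
        by simp
      then obtain p where p: "p \<in> trigpolys" "L2_sq (\<lambda>t. g t - p t) < e / (2 * pi)"
        using approximableE[OF approximable_L2per[OF g]] by blast
      then obtain K c where K: "finite K" "p = trigpoly K c"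
        using trigpolysE by blast
      have "L2_sq g - sum ?f K / (2 * pi) \<le> L2_sq (\<lambda>t. g t - p t)"
        unfolding K(2) L2_sq_diff_trigpoly[OF g K(1)] by (simp add: sum_nonneg)
      also note p(2)
      finally have "2 * pi * (L2_sq g - sum ?f K / (2 * pi)) < 2 * pi * (e / (2 * pi))"
        by (rule mult_strict_left_mono) simp
      then have "2 * pi * L2_sq g < sum ?f K + e"
        by (simp add: right_diff_distrib)
      also have "sum ?f K \<le> infsum ?f UNIV"
        using summable K(1) by (intro finite_sum_le_infsum) auto
      finally show "2 * pi * L2_sq g \<le> infsum ?f UNIV + e"
        by simp
    qed
  qed
  then show ?thesis
    using has_sum_infsum[OF summable] by simp
qed

subsection \<open>Plancherel's identity\<close>

lemma L2per_modulate: "g \<in> L2per \<Longrightarrow> (\<lambda>t. cis (x * t) * g t) \<in> L2per"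
  by (rule L2per_mult_bounded[where B = 1]) auto

lemma fourier_modulate: "fourier (\<lambda>t. cis (x * t) * g t) y = fourier g (x + y)"
  unfolding fourier_def
  by (intro Bochner_Integration.integral_cong refl) (simp add: distrib_right cis_mult[symmetric])

lemma L2_sq_modulate: "L2_sq (\<lambda>t. cis (x * t) * g t) = L2_sq g"
  by (simp add: L2_sq_def norm_mult)

lemma L2per_integrable: "g \<in> L2per \<Longrightarrow> integrable lborel g"
  using fourier_integrable[of g 0] by simp

lemma continuous_fourier:
  assumes g: "g \<in> L2per"
  shows "continuous_on UNIV (fourier g)"
proof (rule continuous_on_sequentiallyI)
  fix u :: "nat \<Rightarrow> real" and a assume u: "u \<longlonglongrightarrow> a"
  show "(\<lambda>n. fourier g (u n)) \<longlonglongrightarrow> fourier g a"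
    unfolding fourier_def
  proof (rule integral_dominated_convergence[where w = "\<lambda>t. cmod (g t)"])
    show "(\<lambda>t. g t * cis (a * t)) \<in> borel_measurable lborel"
      "\<And>n. (\<lambda>t. g t * cis (u n * t)) \<in> borel_measurable lborel"
      using L2perD(1)[OF g] by measurable
    show "integrable lborel (\<lambda>t. cmod (g t))"
      using L2per_integrable[OF g] by simp
    have "continuous_on UNIV cis"
      by (intro continuous_intros)
    then have "isCont cis x" for x
      by (simp add: continuous_on_eq_continuous_at)
    then have "(\<lambda>n. cis (u n * t)) \<longlonglongrightarrow> cis (a * t)" for t
      by (rule isCont_tendsto_compose) (intro tendsto_intros u)
    then show "AE t in lborel. (\<lambda>n. g t * cis (u n * t)) \<longlonglongrightarrow> g t * cis (a * t)"
      by (intro AE_I2 tendsto_mult tendsto_const) auto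
  qed (auto simp: norm_mult)
qed

lemma nn_integral_count_space_has_sum:
  fixes f :: "'a \<Rightarrow> real"
  assumes sum: "(f has_sum S) A" and nonneg: "\<And>x. x \<in> A \<Longrightarrow> 0 \<le> f x"
  shows "(\<integral>\<^sup>+x. ennreal (f x) \<partial>count_space A) = ennreal S"
proof -
  have "f summable_on A"
    using sum by (rule has_sum_imp_summable)
  then have "(\<lambda>x. norm (f x)) summable_on A"
    by (rule summable_on_iff_abs_summable_on_real[THEN iffD1])
  then have abs: "Infinite_Set_Sum.abs_summable_on f A"
    by (rule abs_summable_equivalent[THEN iffD1])
  then have "(\<integral>\<^sup>+x. ennreal (f x) \<partial>count_space A) = ennreal (infsetsum f A)"
    unfolding infsetsum_def abs_summable_on_def using nonneg
    by (intro nn_integral_eq_integral) (auto intro: AE_I2)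
  then show ?thesis
    using infsetsum_infsum[OF abs] infsumI[OF sum] by simp
qed

lemma nn_integral_periodization:
  fixes F :: "real \<Rightarrow> ennreal"
  assumes [measurable]: "F \<in> borel_measurable borel"
  shows "(\<integral>\<^sup>+x. F x \<partial>lborel)
    = (\<integral>\<^sup>+x. indicator {0..<1} x * (\<integral>\<^sup>+k. F (of_int k + x) \<partial>count_space (UNIV :: int set)) \<partial>lborel)"
proof -
  have "(\<integral>\<^sup>+k. indicator {of_int k..<of_int k + 1} x * F x \<partial>count_space (UNIV :: int set)) = F x" for x
  proof -
    have "x \<in> {of_int k..<of_int k + 1} \<longleftrightarrow> k \<in> {\<lfloor>x\<rfloor>}" for k :: int
      by (auto simp: floor_eq_iff intro: floor_unique[symmetric])
    then have "(\<integral>\<^sup>+k. indicator {of_int k..<of_int k + 1} x * F x \<partial>count_space (UNIV :: int set))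
        = (\<integral>\<^sup>+k. F x * indicator {\<lfloor>x\<rfloor>} k \<partial>count_space UNIV)"
      by (intro nn_integral_cong) (simp add: indicator_def mult.commute del: atLeastLessThan_iff singleton_iff)
    then show ?thesis
      by simp
  qed
  then have "(\<integral>\<^sup>+x. F x \<partial>lborel)
      = (\<integral>\<^sup>+x. \<integral>\<^sup>+k. indicator {of_int k..<of_int k + 1} x * F x \<partial>count_space (UNIV :: int set) \<partial>lborel)"
    by simp
  also have "\<dots> = (\<integral>\<^sup>+k. \<integral>\<^sup>+x. indicator {of_int k..<of_int k + 1} x * F x \<partial>lborel \<partial>count_space (UNIV :: int set))"
    by (rule nn_integral_count_space_nn_integral) auto
  also have "\<dots> = (\<integral>\<^sup>+k. \<integral>\<^sup>+x. indicator {0..<1} x * F (of_int k + x) \<partial>lborel \<partial>count_space (UNIV :: int set))"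
  proof (rule nn_integral_cong)
    fix k :: int
    have "indicator {of_int k..<of_int k + 1} (of_int k + x) = (indicator {0..<1} x :: ennreal)" for x :: real
      by (auto simp: indicator_def)
    then show "(\<integral>\<^sup>+x. indicator {of_int k..<of_int k + 1} x * F x \<partial>lborel)
        = (\<integral>\<^sup>+x. indicator {0..<1} x * F (of_int k + x) \<partial>lborel)"
      by (subst nn_integral_real_affine[where c = 1 and t = "of_int k"]) auto
  qed
  also have "\<dots> = (\<integral>\<^sup>+x. \<integral>\<^sup>+k. indicator {0..<1} x * F (of_int k + x) \<partial>count_space (UNIV :: int set) \<partial>lborel)"
    by (rule nn_integral_count_space_nn_integral[symmetric]) auto
  finally show ?thesis
    by (simp add: nn_integral_cmult)
qed

text \<open>For every \<open>x\<close> the values of \<open>fourier g\<close> at \<open>x + k\<close>, \<open>k \<in> \<int>\<close>, are the Fourier coefficients of a modulation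
  of \<open>g\<close>.\<close>
theorem plancherel:
  assumes g: "g \<in> L2per"
  shows "has_bochner_integral lborel (\<lambda>x. (cmod (fourier g x))\<^sup>2) (2 * pi * L2_sq g)"
proof (rule has_bochner_integral_nn_integral)
  have [measurable]: "fourier g \<in> borel_measurable borel"
    by (intro borel_measurable_continuous_onI continuous_fourier g)
  show "(\<lambda>x. (cmod (fourier g x))\<^sup>2) \<in> borel_measurable lborel"
    by measurable
  have "(\<integral>\<^sup>+k. ennreal ((cmod (fourier g (of_int k + x)))\<^sup>2) \<partial>count_space (UNIV :: int set))
      = ennreal (2 * pi * L2_sq g)" for x
    using nn_integral_count_space_has_sum[OF parseval[OF L2per_modulate[OF g, of x]]]
    by (simp add: fourier_modulate L2_sq_modulate add.commute)
  then show "(\<integral>\<^sup>+x. ennreal ((cmod (fourier g x))\<^sup>2) \<partial>lborel) = ennreal (2 * pi * L2_sq g)"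
    by (subst nn_integral_periodization) (auto simp: nn_integral_multc)
qed (auto simp: L2_sq_nonneg)

section \<open>Densities in translation invariant families\<close>

definition set_tendsto :: "(nat \<Rightarrow> 'a set) \<Rightarrow> 'a set \<Rightarrow> bool" where
  "set_tendsto A B \<longleftrightarrow> (\<forall>x. \<forall>\<^sub>F k in sequentially. x \<in> A k \<longleftrightarrow> x \<in> B)"

lemma set_tendsto_eventually_Int_eq:
  assumes "set_tendsto A B" "finite K"
  shows "\<forall>\<^sub>F k in sequentially. A k \<inter> K = B \<inter> K"
proof -
  have "\<forall>\<^sub>F k in sequentially. \<forall>x\<in>K. x \<in> A k \<longleftrightarrow> x \<in> B"
    using assms by (intro eventually_ball_finite) (auto simp: set_tendsto_def)
  then show ?thesis
    by eventually_elim auto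
qed

lemma set_tendsto_subsequence:
  fixes A :: "nat \<Rightarrow> 'a::countable set"
  obtains r B where "strict_mono r" "set_tendsto (\<lambda>k. A (r k)) B"
proof -
  obtain r where r: "strict_mono (r :: nat \<Rightarrow> nat)"
    and lim: "\<And>x. x \<in> UNIV \<Longrightarrow> \<exists>l. (\<lambda>n. indicator (A (r n)) x :: real) \<longlonglongrightarrow> l"
    by (rule function_convergent_subsequence[of "UNIV :: 'a set" "\<lambda>n x. indicator (A n) x :: real" 1])
       (auto simp: indicator_def)
  have "\<forall>\<^sub>F k in sequentially. x \<in> A (r k) \<longleftrightarrow> (\<forall>\<^sub>F n in sequentially. x \<in> A (r n))" for x
  proof -
    have "Cauchy (\<lambda>n. indicator (A (r n)) x :: real)"
      using lim[of x] by (auto intro: LIMSEQ_imp_Cauchy)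
    then obtain N where N: "\<And>m n. N \<le> m \<Longrightarrow> N \<le> n \<Longrightarrow>
        dist (indicator (A (r m)) x :: real) (indicator (A (r n)) x) < 1"
      using metric_CauchyD[OF _ zero_less_one] by blast
    have "x \<in> A (r n) \<longleftrightarrow> x \<in> A (r N)" if "N \<le> n" for n
      using N[OF that order_refl] by (cases "x \<in> A (r n)"; cases "x \<in> A (r N)") simp_all
    then have const: "\<forall>\<^sub>F n in sequentially. x \<in> A (r n) \<longleftrightarrow> x \<in> A (r N)"
      by (rule eventually_sequentiallyI)
    have "(\<forall>\<^sub>F n in sequentially. x \<in> A (r n)) \<longleftrightarrow> x \<in> A (r N)"
      using eventually_subst[OF const] by simp
    then show ?thesis
      using const by simp
  qed
  then have "set_tendsto (\<lambda>k. A (r k)) {x. \<forall>\<^sub>F n in sequentially. x \<in> A (r n)}"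
    by (simp add: set_tendsto_def)
  then show thesis
    using r that by blast
qed

definition window_count :: "int set \<Rightarrow> int \<Rightarrow> int \<Rightarrow> real" where
  "window_count A a b = (\<Sum>x\<in>{a..<b}. indicator A x)"

lemma window_count_card: "window_count A a b = card (A \<inter> {a..<b})"
  by (simp add: window_count_def indicator_def of_bool_def sum.If_cases Int_def conj_commute)

lemma window_count_split: "a \<le> b \<Longrightarrow> b \<le> c \<Longrightarrow> window_count A a c = window_count A a b + window_count A b c"
  unfolding window_count_def by (subst sum.union_disjoint[symmetric]) (auto simp: ivl_disj_un)

lemma window_count_nonneg: "0 \<le> window_count A a b"
  by (simp add: window_count_def sum_nonneg)

lemma window_count_le:
  assumes "a \<le> b"
  shows "window_count A a b \<le> b - a"
proof -
  have "window_count A a b \<le> (\<Sum>x\<in>{a..<b}. 1)"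
    unfolding window_count_def by (intro sum_mono) (auto simp: indicator_def)
  then show ?thesis
    using assms by simp
qed

lemma window_count_shift: "window_count ((+) p ` A) (p + a) (p + b) = window_count A a b"
proof -
  have "window_count ((+) p ` A) (p + a) (p + b) = (\<Sum>x\<in>(+) p ` {a..<b}. indicator ((+) p ` A) x)"
    unfolding window_count_def by (simp add: image_add_atLeastLessThan add.commute)
  also have "\<dots> = (\<Sum>x\<in>{a..<b}. indicator ((+) p ` A) (p + x))"
    by (subst sum.reindex) auto
  also have "\<dots> = window_count A a b"
    unfolding window_count_def by (intro sum.cong refl) (auto simp: indicator_def)
  finally show ?thesis .
qed

lemma sum_window_count:
  "(\<Sum>y\<in>{a..<b}. window_count A y (y + int R)) = (\<Sum>i<R. window_count A (a + int i) (b + int i))"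
proof -
  have window: "window_count A y (y + int R) = (\<Sum>i<R. indicator A (y + int i))" for y
  proof -
    have "{y..<y + int R} = (\<lambda>i. y + int i) ` {..<R}"
    proof (intro set_eqI iffI)
      fix x assume "x \<in> {y..<y + int R}"
      then have "x = y + int (nat (x - y))" "nat (x - y) < R"
        by auto
      then show "x \<in> (\<lambda>i. y + int i) ` {..<R}"
        by blast
    qed auto
    then show ?thesis
      unfolding window_count_def by (simp add: sum.reindex inj_on_def)
  qed
  have "(\<Sum>y\<in>{a..<b}. window_count A y (y + int R)) = (\<Sum>i<R. \<Sum>y\<in>{a..<b}. indicator A (y + int i))"
    unfolding window by (rule sum.swap)
  also have "\<dots> = (\<Sum>i<R. window_count A (a + int i) (b + int i))"
  proof (intro sum.cong refl)
    fix i
    have "(\<Sum>x\<in>(\<lambda>x. x + int i) ` {a..<b}. indicat_real A x) = (\<Sum>y\<in>{a..<b}. indicator A (y + int i))"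
      by (subst sum.reindex) (auto simp: inj_on_def)
    then show "(\<Sum>y\<in>{a..<b}. indicator A (y + int i)) = window_count A (a + int i) (b + int i)"
      unfolding window_count_def by simp
  qed
  finally show ?thesis .
qed

lemma window_count_shift_approx:
  assumes "a \<le> b"
  shows "\<bar>window_count A (a + int i) (b + int i) - window_count A a b\<bar> \<le> i"
proof -
  have "window_count A a (a + int i) + window_count A (a + int i) (b + int i)
      = window_count A a b + window_count A b (b + int i)"
    using window_count_split[of a "a + int i" "b + int i" A] window_count_split[of a b "b + int i" A] assms
    by simp
  moreover have "window_count A c (c + int i) \<in> {0..real i}" for c
    using window_count_le[of c "c + int i" A] window_count_nonneg by simp
  ultimately show ?thesis
    by (smt (verit) atLeastAtMost_iff)
qed

lemma sum_window_count_approx: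
  assumes "a \<le> b"
  shows "\<bar>(\<Sum>y\<in>{a..<b}. window_count A y (y + int R)) - R * window_count A a b\<bar> \<le> (real R)\<^sup>2"
proof -
  have "\<bar>(\<Sum>i<R. window_count A (a + int i) (b + int i)) - R * window_count A a b\<bar>
      = \<bar>\<Sum>i<R. (window_count A (a + int i) (b + int i) - window_count A a b)\<bar>"
    by (simp add: sum_subtractf)
  also have "\<dots> \<le> (\<Sum>i<R. \<bar>window_count A (a + int i) (b + int i) - window_count A a b\<bar>)"
    by (rule sum_abs)
  also have "\<dots> \<le> (\<Sum>i<R. real R)"
  proof (intro sum_mono)
    fix i assume "i \<in> {..<R}"
    then show "\<bar>window_count A (a + int i) (b + int i) - window_count A a b\<bar> \<le> real R"
      using window_count_shift_approx[OF assms, of A i] by simp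
  qed
  finally show ?thesis
    unfolding sum_window_count by (simp add: power2_eq_square)
qed

subsection \<open>A maximal inequality\<close>

definition right_large :: "(int \<Rightarrow> real) \<Rightarrow> real \<Rightarrow> int \<Rightarrow> int \<Rightarrow> int set" where
  "right_large g T a b = {x \<in> {a..<b}. \<exists>y>x. y \<le> b \<and> T * of_int (y - x) < sum g {x..<y}}"

definition left_large :: "(int \<Rightarrow> real) \<Rightarrow> real \<Rightarrow> int \<Rightarrow> int \<Rightarrow> int set" where
  "left_large g T a b = {x \<in> {a..<b}. \<exists>y\<le>x. a \<le> y \<and> T * of_int (x + 1 - y) < sum g {y..x}}"

definition centred_large :: "(int \<Rightarrow> real) \<Rightarrow> real \<Rightarrow> int \<Rightarrow> int \<Rightarrow> int set" where
  "centred_large g T a b = {x \<in> {a..<b}. \<exists>n. a \<le> x - int n \<and> x + int n < b \<and>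
     T * (2 * real n + 2) < sum g {x - int n..<x + int n + 1}}"

lemma finite_large [simp]:
  "finite (right_large g T a b)" "finite (left_large g T a b)" "finite (centred_large g T a b)"
  by (rule finite_subset[of _ "{a..<b}"]; auto simp: right_large_def left_large_def centred_large_def)+

lemma right_large_step:
  assumes "a \<notin> right_large g T a b"
  shows "right_large g T a b \<subseteq> right_large g T (a + 1) b"
proof
  fix x assume x: "x \<in> right_large g T a b"
  then have "x \<noteq> a"
    using assms by blast
  then show "x \<in> right_large g T (a + 1) b"
    using x by (auto simp: right_large_def)
qed

lemma card_right_large_le:
  assumes "a \<le> y"
  shows "card (right_large g T a b) \<le> of_int (y - a) + real (card (right_large g T y b))"
proof -
  have "card (right_large g T a b) \<le> card ({a..<y} \<union> right_large g T y b)"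
    by (intro card_mono finite_UnI finite_large) (auto simp: right_large_def)
  also have "\<dots> \<le> card {a..<y} + card (right_large g T y b)"
    by (rule card_Un_le)
  finally show ?thesis
    using assms by simp
qed

lemma card_right_large:
  assumes g: "\<And>x. 0 \<le> g x" and T: "T > 0"
  shows "T * card (right_large g T a b) \<le> sum g {a..<b}"
proof (induction "nat (b - a)" arbitrary: a rule: less_induct)
  case less
  consider (empty) "b \<le> a" | (skip) "a < b" "a \<notin> right_large g T a b" | (jump) "a \<in> right_large g T a b"
    by linarith
  then show ?case
  proof cases
    case empty
    then show ?thesis
      by (simp add: right_large_def)
  next
    case skip
    have "T * card (right_large g T a b) \<le> T * card (right_large g T (a + 1) b)"
      using T right_large_step[OF skip(2)] by (intro mult_left_mono of_nat_mono card_mono) auto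
    also have "\<dots> \<le> sum g {a+1..<b}"
      using skip(1) by (intro less) auto
    also have "\<dots> \<le> sum g {a..<b}"
      using g by (intro sum_mono2) auto
    finally show ?thesis .
  next
    case jump
    then obtain y where y: "a < y" "y \<le> b" "T * of_int (y - a) < sum g {a..<y}"
      by (auto simp: right_large_def)
    have "T * card (right_large g T a b) \<le> T * (of_int (y - a) + real (card (right_large g T y b)))"
      using T y(1) by (intro mult_left_mono card_right_large_le) auto
    also have "\<dots> \<le> sum g {a..<y} + sum g {y..<b}"
      unfolding distrib_left using y by (intro add_mono less) auto
    also have "\<dots> = sum g {a..<b}"
      using y by (subst sum.union_disjoint[symmetric]) (auto simp: ivl_disj_un)
    finally show ?thesis .
  qed
qed

lemma card_left_large:
  assumes g: "\<And>x. 0 \<le> g x" and T: "T > 0"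
  shows "T * card (left_large g T a b) \<le> sum g {a..<b}"
proof -
  define reflect where "reflect = (\<lambda>x::int. - 1 - x)"
  define h where "h = g \<circ> reflect"
  have inj: "inj_on reflect A" for A
    by (auto simp: reflect_def inj_on_def)
  have sum_h: "sum h {- v..<- u} = sum g {u..<v}" for u v
  proof -
    have "reflect ` {- v..<- u} = {u..<v}"
      by (auto simp: reflect_def image_iff intro!: bexI[of _ "- 1 - _"])
    then show ?thesis
      using sum.reindex[OF inj, of g "{- v..<- u}"] by (simp add: h_def)
  qed
  have "reflect ` left_large g T a b \<subseteq> right_large h T (- b) (- a)"
  proof (rule image_subsetI)
    fix x assume "x \<in> left_large g T a b"
    then obtain y where y: "x \<in> {a..<b}" "y \<le> x" "a \<le> y" "T * of_int (x + 1 - y) < sum g {y..x}"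
      by (auto simp: left_large_def)
    have "{y..x} = {y..<x+1}"
      by auto
    then have "T * of_int (- y - reflect x) < sum h {reflect x..<- y}"
      using y(4) sum_h[of "x + 1" y] by (simp add: reflect_def algebra_simps)
    then show "reflect x \<in> right_large h T (- b) (- a)"
      using y by (auto simp: right_large_def reflect_def intro!: exI[of _ "- y"])
  qed
  then have "card (left_large g T a b) \<le> card (right_large h T (- b) (- a))"
    by (intro card_inj_on_le[OF inj] finite_large)
  then have "T * card (left_large g T a b) \<le> T * card (right_large h T (- b) (- a))"
    using T by (intro mult_left_mono) auto
  also have "\<dots> \<le> sum h {-b..<-a}"
    using g T by (intro card_right_large) (auto simp: h_def)
  finally show ?thesis
    unfolding sum_h .
qed

lemma large_one_sided_sum:
  fixes g :: "int \<Rightarrow> real"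
  assumes g: "\<And>x. 0 \<le> g x" and large: "T * (2 * real n + 2) < sum g {x - int n..<x + int n + 1}"
  shows "T * (real n + 1) < sum g {x - int n..x} \<or> T * (real n + 1) < sum g {x..<x + int n + 1}"
proof -
  let ?left = "{x - int n..x}" and ?right = "{x..<x + int n + 1}"
  have "sum g (?left \<union> ?right) \<le> sum g ?left + sum g ?right"
    using sum.union_inter[of ?left ?right g] sum_nonneg[of "?left \<inter> ?right" g] g by simp
  also have "?left \<union> ?right = {x - int n..<x + int n + 1}"
    by auto
  finally show ?thesis
    using large by (auto simp: algebra_simps)
qed

lemma centred_large_subset:
  assumes g: "\<And>x. 0 \<le> g x"
  shows "centred_large g T a b \<subseteq> right_large g T a b \<union> left_large g T a b"
proof
  fix x assume "x \<in> centred_large g T a b"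
  then obtain n where n: "x \<in> {a..<b}" "a \<le> x - int n" "x + int n < b"
    and large: "T * (2 * real n + 2) < sum g {x - int n..<x + int n + 1}"
    by (auto simp: centred_large_def)
  from large_one_sided_sum[OF g large] show "x \<in> right_large g T a b \<union> left_large g T a b"
  proof
    assume "T * (real n + 1) < sum g {x - int n..x}"
    then have "x \<in> left_large g T a b"
      using n by (auto simp: left_large_def algebra_simps intro!: exI[of _ "x - int n"])
    then show ?thesis ..
  next
    assume "T * (real n + 1) < sum g {x..<x + int n + 1}"
    then have "x \<in> right_large g T a b"
      using n by (auto simp: right_large_def algebra_simps intro!: exI[of _ "x + int n + 1"])
    then show ?thesis ..
  qed
qed

theorem card_centred_large:
  assumes g: "\<And>x. 0 \<le> g x" and T: "T > 0"
  shows "T * card (centred_large g T a b) \<le> 2 * sum g {a..<b}"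
proof -
  have "card (centred_large g T a b) \<le> card (right_large g T a b) + card (left_large g T a b)"
    by (rule order_trans[OF card_mono[OF _ centred_large_subset[OF g]] card_Un_le]) simp
  then have "T * card (centred_large g T a b) \<le> T * real (card (right_large g T a b) + card (left_large g T a b))"
    by (intro mult_left_mono of_nat_mono less_imp_le[OF T])
  also have "\<dots> = T * card (right_large g T a b) + T * card (left_large g T a b)"
    by (simp only: of_nat_add distrib_left)
  also have "\<dots> \<le> 2 * sum g {a..<b}"
    using card_right_large[of g T a b, OF g T] card_left_large[of g T a b, OF g T] by linarith
  finally show ?thesis .
qed

definition crowded_centres :: "int set \<Rightarrow> nat \<Rightarrow> real \<Rightarrow> real \<Rightarrow> real \<Rightarrow> int set" where
  "crowded_centres A N \<rho> \<epsilon> C = {x \<in> {0..<int N}. \<exists>n. int n \<le> x \<and> x + int n < int N \<and>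
     (2 * real n + 1) * \<rho> + \<epsilon> * (2 * real n + 2) + C < window_count A (x - int n) (x + int n + 1)}"

lemma finite_crowded_centres: "finite (crowded_centres A N \<rho> \<epsilon> C)"
  by (rule finite_subset[of _ "{0..<int N}"]) (auto simp: crowded_centres_def)

lemma card_crowded_centres_le:
  fixes N R :: nat and \<epsilon> :: real
  assumes R: "R > 0" and \<epsilon>: "\<epsilon> > 0" and lower: "\<And>a. real R * \<rho> \<le> window_count A a (a + int R)"
  shows "\<epsilon> * card (crowded_centres A N \<rho> \<epsilon> R) \<le> 2 * (window_count A 0 N + R - real N * \<rho>)"
proof -
  define g where "g = (\<lambda>y. window_count A y (y + int R) - R * \<rho>)"
  define T where "T = \<epsilon> * R"
  have g: "0 \<le> g y" for y
    using lower by (simp add: g_def)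
  have T: "T > 0"
    using R \<epsilon> by (simp add: T_def)
  have sum_g: "\<bar>sum g {a..<b} - R * (window_count A a b - of_int (b - a) * \<rho>)\<bar> \<le> (real R)\<^sup>2" if "a \<le> b" for a b
    using sum_window_count_approx[OF that, of A R] that by (simp add: g_def sum_subtractf algebra_simps)
  have "crowded_centres A N \<rho> \<epsilon> R \<subseteq> centred_large g T 0 (int N)"
  proof
    fix x assume "x \<in> crowded_centres A N \<rho> \<epsilon> R"
    then obtain n where x: "x \<in> {0..<int N}" "0 \<le> x - int n" "x + int n < int N"
      and "(2 * real n + 1) * \<rho> + \<epsilon> * (2 * real n + 2) + R < window_count A (x - int n) (x + int n + 1)"
      by (auto simp: crowded_centres_def)
    then have "R * ((2 * real n + 1) * \<rho> + \<epsilon> * (2 * real n + 2) + R)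
        < R * window_count A (x - int n) (x + int n + 1)"
      using R by simp
    then have "T * (2 * real n + 2) < sum g {x - int n..<x + int n + 1}"
      using sum_g[of "x - int n" "x + int n + 1"] by (simp add: T_def abs_le_iff power2_eq_square algebra_simps)
    then show "x \<in> centred_large g T 0 (int N)"
      using x unfolding centred_large_def by blast
  qed
  then have "T * card (crowded_centres A N \<rho> \<epsilon> R) \<le> T * card (centred_large g T 0 (int N))"
    using T by (intro mult_left_mono of_nat_mono card_mono) auto
  also have "\<dots> \<le> 2 * sum g {0..<int N}"
    by (rule card_centred_large[OF g T])
  also have "\<dots> \<le> 2 * (R * (window_count A 0 N - N * \<rho>) + (real R)\<^sup>2)"
    using sum_g[of 0 "int N"] by (simp add: abs_le_iff)
  also have "\<dots> = R * (2 * (window_count A 0 N + R - N * \<rho>))"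
    by (simp add: algebra_simps power2_eq_square)
  finally have "R * (\<epsilon> * card (crowded_centres A N \<rho> \<epsilon> R)) \<le> R * (2 * (window_count A 0 N + R - N * \<rho>))"
    by (simp add: T_def mult_ac)
  then show ?thesis
    using R by simp
qed

subsection \<open>Members of minimal density\<close>

abbreviation central_count :: "int set \<Rightarrow> nat \<Rightarrow> real" where
  "central_count A n \<equiv> window_count A (- int n) (int n + 1)"

lemma has_densityI:
  assumes "\<And>e. e > 0 \<Longrightarrow> \<exists>C. \<forall>n. \<bar>central_count A n - 2 * real n * h\<bar> \<le> e * real n + C"
  shows "has_density A h"
  unfolding has_density_def
proof (rule LIMSEQ_I)
  fix e :: real assume e: "e > 0"
  obtain C where C: "\<And>n. \<bar>central_count A n - 2 * real n * h\<bar> \<le> e * real n + C"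
    using assms[OF e] by blast
  have "norm (real (card (A \<inter> {- int n..int n})) / (2 * real n) - h) < e" if n: "n \<ge> nat \<lceil>C / e\<rceil> + 1" for n
  proof -
    have "C / e < n" "n > 0"
      using n by linarith+
    then have "e * n + C < e * (2 * real n)"
      using e by (simp add: field_simps)
    then have "\<bar>central_count A n - 2 * real n * h\<bar> < e * (2 * real n)"
      by (rule order_le_less_trans[OF C])
    moreover have "real (card (A \<inter> {- int n..int n})) = central_count A n"
      unfolding window_count_card by (intro arg_cong[of _ _ "\<lambda>S. real (card (A \<inter> S))"]) auto
    moreover have "central_count A n / (2 * real n) - h
        = (central_count A n - 2 * real n * h) / (2 * real n)"
      using \<open>n > 0\<close> by (simp add: field_simps)
    ultimately show ?thesis
      using \<open>n > 0\<close> by (simp add: abs_divide pos_divide_less_eq)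
  qed
  then show "\<exists>n0. \<forall>n\<ge>n0. norm (real (card (A \<inter> {- int n..int n})) / (2 * real n) - h) < e"
    by blast
qed

locale closed_shift_invariant_family =
  fixes X :: "int set set"
  assumes nonempty: "X \<noteq> {}"
    and shift: "A \<in> X \<Longrightarrow> (+) p ` A \<in> X"
    and closed: "(\<And>k. s k \<in> X) \<Longrightarrow> set_tendsto s A \<Longrightarrow> A \<in> X"
begin

definition min_count :: "nat \<Rightarrow> nat" where
  "min_count n = (INF A\<in>X. card (A \<inter> {0..<int n}))"

definition min_density :: real where
  "min_density = (SUP n\<in>{1..}. min_count n / real n)"

lemma min_count_attained: "\<exists>A\<in>X. window_count A 0 (int n) = min_count n"
proof -
  have "min_count n \<in> (\<lambda>A. card (A \<inter> {0..<int n})) ` X"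
    unfolding min_count_def using nonempty by (intro Inf_nat_def1) auto
  then show ?thesis
    by (auto simp: window_count_card)
qed

lemma min_count_le_window_count:
  assumes "A \<in> X"
  shows "min_count n \<le> window_count A a (a + int n)"
proof -
  have "min_count n \<le> card ((+) (- a) ` A \<inter> {0..<int n})"
    unfolding min_count_def by (intro cINF_lower shift assms) auto
  then have "min_count n \<le> window_count ((+) (- a) ` A) (- a + a) (- a + (a + int n))"
    by (simp add: window_count_card)
  then show ?thesis
    unfolding window_count_shift .
qed

lemma bdd_above_min_count_ratio: "bdd_above ((\<lambda>n. min_count n / real n) ` {1..})"
proof (rule bdd_aboveI2)
  fix n :: nat assume "n \<in> {1..}"
  obtain A where "window_count A 0 (int n) = min_count n"
    using min_count_attained by blast
  then show "min_count n / real n \<le> 1"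
    using window_count_le[of 0 "int n" A] \<open>n \<in> {1..}\<close> by (simp add: divide_le_eq)
qed

lemma min_count_le_min_density:
  assumes "n > 0"
  shows "min_count n \<le> n * min_density"
proof -
  have "min_count n / real n \<le> min_density"
    unfolding min_density_def using assms by (intro cSUP_upper bdd_above_min_count_ratio) auto
  then show ?thesis
    using assms by (simp add: divide_le_eq mult.commute)
qed

lemma min_density_le:
  assumes "\<And>n. \<exists>A\<in>X. window_count A 0 (int n) \<le> D * real n"
  shows "min_density \<le> D"
  unfolding min_density_def
proof (rule cSUP_least)
  fix n :: nat assume n: "n \<in> {1..}"
  obtain A where "A \<in> X" "window_count A 0 (int n) \<le> D * real n"
    using assms by blast
  then have "min_count n \<le> D * real n"
    using min_count_le_window_count[of A n 0] by simp
  then show "min_count n / real n \<le> D"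
    using n by (simp add: divide_le_eq)
qed simp

lemma min_density_approx:
  assumes "\<eta> > 0"
  obtains R where "R > 0" "min_density - \<eta> < min_count R / R"
proof -
  have "\<exists>R\<in>{1..}. min_density - \<eta> < min_count R / R"
    using assms bdd_above_min_count_ratio unfolding min_density_def by (subst less_cSUP_iff[symmetric]) auto
  then obtain R where "R \<in> {1..}" "min_density - \<eta> < min_count R / R"
    by blast
  then show thesis
    by (intro that[of R]) auto
qed

lemma window_count_lower_bound:
  assumes A: "A \<in> X" and R: "R > 0" and ab: "a \<le> b"
  shows "of_int (b - a) * (min_count R / R) - R \<le> window_count A a b"
proof -
  have "of_int (b - a) * min_count R \<le> (\<Sum>y\<in>{a..<b}. window_count A y (y + int R))"
    using sum_mono[of "{a..<b}" "\<lambda>_. real (min_count R)"] min_count_le_window_count[OF A] ab by simp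
  also have "\<dots> \<le> R * window_count A a b + (real R)\<^sup>2"
    using sum_window_count_approx[OF ab, of A R] by (simp add: abs_le_iff)
  finally show ?thesis
    using R by (simp add: field_simps power2_eq_square)
qed

lemma card_crowded_centres_extremal_le:
  fixes N R :: nat
  assumes A: "A \<in> X" "window_count A 0 (int N) = min_count N"
    and N: "N > 0" and R: "R > 0" "min_density - \<eta> < min_count R / R" and \<epsilon>: "\<epsilon> > 0"
  shows "card (crowded_centres A N (min_count R / R) \<epsilon> R) \<le> 2 * N * (\<eta> / \<epsilon>) + 2 * R / \<epsilon>"
proof -
  have "\<epsilon> * card (crowded_centres A N (min_count R / R) \<epsilon> R)
      \<le> 2 * (window_count A 0 N + R - N * (min_count R / R))"
    using min_count_le_window_count[OF A(1)] R(1) by (intro card_crowded_centres_le[OF R(1) \<epsilon>]) simp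
  also have "\<dots> \<le> 2 * (N * min_density + R - N * (min_density - \<eta>))"
    using min_count_le_min_density[OF N] R(2) A(2) by (intro mult_left_mono diff_mono add_right_mono) auto
  also have "\<dots> = \<epsilon> * (2 * N * (\<eta> / \<epsilon>) + 2 * R / \<epsilon>)"
    using \<epsilon> by (simp add: field_simps)
  finally show ?thesis
    using \<epsilon> by simp
qed

context
  fixes \<epsilon> :: "nat \<Rightarrow> real" and R :: "nat \<Rightarrow> nat"
  assumes \<epsilon>: "\<And>j. \<epsilon> j > 0"
    and R: "\<And>j. R j > 0" "\<And>j. min_density - \<epsilon> j / 2 ^ (j + 4) < min_count (R j) / R j"
begin

lemma card_UN_crowded_centres_le:
  assumes A: "A \<in> X" "window_count A 0 (int N) = min_count N" and N: "N > 0"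
  shows "card (\<Union>j\<le>k. crowded_centres A N (min_count (R j) / R j) (\<epsilon> j) (R j))
    \<le> N / 4 + (\<Sum>j\<le>k. 2 * R j / \<epsilon> j)"
proof -
  define B where "B = (\<lambda>j. crowded_centres A N (min_count (R j) / R j) (\<epsilon> j) (R j))"
  have "real (card (\<Union>j\<le>k. B j)) \<le> (\<Sum>j\<le>k. real (card (B j)))"
    using card_UN_le[of "{..k}" B] by (metis finite_atMost of_nat_le_iff of_nat_sum)
  also have "\<dots> \<le> (\<Sum>j\<le>k. 2 * N * ((1 / 2) ^ j / 16) + 2 * R j / \<epsilon> j)"
  proof (intro sum_mono)
    fix j
    have "\<epsilon> j / 2 ^ (j + 4) / \<epsilon> j = (1 / 2) ^ j / 16"
      using \<epsilon>[of j] by (simp add: power_add power_one_over)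
    then show "real (card (B j)) \<le> 2 * N * ((1 / 2) ^ j / 16) + 2 * R j / \<epsilon> j"
      using card_crowded_centres_extremal_le[OF A N R(1)[of j] R(2)[of j] \<epsilon>[of j]] by (simp only: B_def)
  qed
  also have "\<dots> = 2 * N * ((\<Sum>j\<le>k. (1 / 2) ^ j) / 16) + (\<Sum>j\<le>k. 2 * R j / \<epsilon> j)"
    by (simp add: sum.distrib sum_distrib_left sum_divide_distrib)
  also have "(\<Sum>j\<le>k. (1 / 2 :: real) ^ j) = 2 - (1 / 2) ^ k"
    by (induction k) (auto simp: field_simps)
  also have "2 * N * ((2 - (1 / 2) ^ k) / 16) \<le> 2 * N * (2 / 16)"
    by (intro mult_left_mono divide_right_mono) auto
  finally show ?thesis
    by (simp add: B_def)
qed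

lemma exists_uncrowded_centre:
  obtains A N x where "A \<in> X" "int k \<le> x" "x + int k < int N"
    "\<And>j. j \<le> k \<Longrightarrow> x \<notin> crowded_centres A N (min_count (R j) / R j) (\<epsilon> j) (R j)"
proof -
  define W where "W = (\<Sum>j\<le>k. 2 * R j / \<epsilon> j)"
  define Q where "Q = k + 1 + nat \<lceil>W\<rceil>"
  have Q: "real Q > W" "k < Q"
    unfolding Q_def by linarith+
  obtain A where A: "A \<in> X" "window_count A 0 (int (4 * Q)) = min_count (4 * Q)"
    using min_count_attained by blast
  define B where "B = (\<Union>j\<le>k. crowded_centres A (4 * Q) (min_count (R j) / R j) (\<epsilon> j) (R j))"
  have "real (card B) \<le> real (4 * Q) / 4 + W"
    unfolding B_def W_def using Q(2) by (intro card_UN_crowded_centres_le A) simp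
  then have "card B < 2 * Q"
    using Q(1) by simp
  moreover have "finite B"
    by (simp add: B_def finite_crowded_centres)
  ultimately have "\<not> {int Q..<3 * int Q} \<subseteq> B"
    using card_mono[of B "{int Q..<3 * int Q}"] by auto
  then obtain x where "x \<in> {int Q..<3 * int Q}" "x \<notin> B"
    by blast
  then show thesis
    using Q(2) by (intro that[OF A(1), of x "4 * Q"]) (auto simp: B_def)
qed

lemma exists_nearly_minimal_windows:
  "\<exists>A\<in>X. \<forall>j\<le>k. \<forall>n\<le>k. central_count A n
    \<le> (2 * real n + 1) * min_density + \<epsilon> j * (2 * real n + 2) + R j"
proof -
  obtain A N x where A: "A \<in> X" and x: "int k \<le> x" "x + int k < int N"
    and uncrowded: "\<And>j. j \<le> k \<Longrightarrow> x \<notin> crowded_centres A N (min_count (R j) / R j) (\<epsilon> j) (R j)"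
    using exists_uncrowded_centre by metis
  have "central_count ((+) (- x) ` A) n
      \<le> (2 * real n + 1) * min_density + \<epsilon> j * (2 * real n + 2) + R j" if "j \<le> k" "n \<le> k" for j n
  proof -
    have "central_count ((+) (- x) ` A) n = window_count A (x - int n) (x + int n + 1)"
      using window_count_shift[of "- x" A "x - int n" "x + int n + 1"] by simp
    also have "\<dots> \<le> (2 * real n + 1) * (min_count (R j) / R j) + \<epsilon> j * (2 * real n + 2) + R j"
    proof -
      have "int n \<le> x" "x + int n < int N" "x \<in> {0..<int N}"
        using x that(2) by auto
      then show ?thesis
        using uncrowded[OF that(1)] by (auto simp: crowded_centres_def not_less)
    qed
    also have "\<dots> \<le> (2 * real n + 1) * min_density + \<epsilon> j * (2 * real n + 2) + R j"
      using min_count_le_min_density[OF R(1), of j] R(1)[of j]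
      by (intro add_right_mono mult_left_mono) (auto simp: divide_le_eq mult.commute)
    finally show ?thesis .
  qed
  then show ?thesis
    using shift[OF A] by blast
qed

lemma exists_minimal_windows:
  "\<exists>A\<in>X. \<forall>j n. central_count A n
    \<le> (2 * real n + 1) * min_density + \<epsilon> j * (2 * real n + 2) + R j"
proof -
  obtain s where s: "\<And>k. s k \<in> X" "\<And>k j n. j \<le> k \<Longrightarrow> n \<le> k \<Longrightarrow> central_count (s k) n
      \<le> (2 * real n + 1) * min_density + \<epsilon> j * (2 * real n + 2) + R j"
    using exists_nearly_minimal_windows by metis
  obtain r A where r: "strict_mono r" and A: "set_tendsto (\<lambda>k. s (r k)) A"
    using set_tendsto_subsequence[of s] by blast
  have "central_count A n \<le> (2 * real n + 1) * min_density + \<epsilon> j * (2 * real n + 2) + R j" for j n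
  proof -
    have "\<forall>\<^sub>F k in sequentially. k \<ge> max j n \<and> s (r k) \<inter> {- int n..<int n + 1} = A \<inter> {- int n..<int n + 1}"
      by (intro eventually_conj eventually_ge_at_top set_tendsto_eventually_Int_eq[OF A]) simp
    then obtain k where k: "k \<ge> max j n" "s (r k) \<inter> {- int n..<int n + 1} = A \<inter> {- int n..<int n + 1}"
      by (auto simp: eventually_sequentially)
    have "central_count A n = central_count (s (r k)) n"
      unfolding window_count_card k(2) ..
    also have "\<dots> \<le> (2 * real n + 1) * min_density + \<epsilon> j * (2 * real n + 2) + R j"
      using k(1) seq_suble[OF r, of k] by (intro s) auto
    finally show ?thesis .
  qed
  moreover have "A \<in> X"
    using s(1) A by (rule closed)
  ultimately show ?thesis
    by blast
qed

end

text \<open>Every window of length \<open>R\<close> of every member has almost \<open>h R\<close> points, \<open>h\<close> being the minimal density, while a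
  long extremal window has at most \<open>h\<close> points per unit length. The excess is thus nonnegative with small
  mean, and the maximal inequality finds a centre around which all windows are nearly minimal.\<close>
theorem exists_density_eq_min_density: "\<exists>A\<in>X. has_density A min_density"
proof -
  define \<epsilon> where "\<epsilon> = (\<lambda>j. inverse (real (Suc j)))"
  have \<epsilon>: "\<epsilon> j > 0" for j
    by (simp add: \<epsilon>_def)
  then have "\<forall>j. \<exists>R>0. min_density - \<epsilon> j / 2 ^ (j + 4) < min_count R / R"
    using min_density_approx by (metis divide_pos_pos zero_less_numeral zero_less_power)
  then obtain R where R: "\<And>j. R j > 0" "\<And>j. min_density - \<epsilon> j / 2 ^ (j + 4) < min_count (R j) / R j"
    by metis
  obtain A where A: "A \<in> X" and upper: "\<And>j n. central_count A n
      \<le> (2 * real n + 1) * min_density + \<epsilon> j * (2 * real n + 2) + R j"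
    using exists_minimal_windows[OF \<epsilon> R] by blast
  have "has_density A min_density"
  proof (rule has_densityI)
    fix e :: real assume "e > 0"
    then obtain j where j: "\<epsilon> j < e / 2"
      using reals_Archimedean[of "e / 2"] unfolding \<epsilon>_def by auto
    have "\<epsilon> j / 2 ^ (j + 4) \<le> \<epsilon> j"
      using \<epsilon>[of j] by (simp add: divide_le_eq)
    then have "min_density - \<epsilon> j \<le> min_count (R j) / R j"
      using R(2)[of j] by linarith
    have "\<bar>central_count A n - 2 * real n * min_density\<bar>
        \<le> e * n + (\<bar>min_density\<bar> + 2 * \<epsilon> j + R j)" for n
    proof -
      have "(2 * real n + 1) * (min_density - \<epsilon> j) \<le> (2 * real n + 1) * (min_count (R j) / R j)"
        using \<open>min_density - \<epsilon> j \<le> min_count (R j) / R j\<close> by (intro mult_left_mono) auto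
      then have "(2 * real n + 1) * (min_density - \<epsilon> j) - R j \<le> central_count A n"
        using window_count_lower_bound[OF A R(1), of "- int n" "int n + 1" j] by simp
      moreover have "2 * real n * \<epsilon> j \<le> e * n"
        using mult_left_mono[OF less_imp_le[OF j], of "2 * real n"] by (simp add: mult_ac)
      ultimately show ?thesis
        using upper[of n j] \<epsilon>[of j] by (simp add: abs_le_iff algebra_simps) linarith
    qed
    then show "\<exists>C. \<forall>n. \<bar>central_count A n - 2 * real n * min_density\<bar> \<le> e * real n + C"
      by blast
  qed
  then show ?thesis
    using A by blast
qed

end

section \<open>Sampling sets\<close>

subsection \<open>The energy of the samples along a set of integers\<close>

definition sample_energy :: "int set \<Rightarrow> (real \<Rightarrow> complex) \<Rightarrow> real" where
  "sample_energy A g = (\<Sum>\<^sub>\<infinity>k\<in>A. (cmod (fourier g (of_int k)))\<^sup>2)"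

lemma sample_energy_UNIV: "g \<in> L2per \<Longrightarrow> sample_energy UNIV g = 2 * pi * L2_sq g"
  unfolding sample_energy_def by (rule infsumI[OF parseval])

lemma summable_samples: "g \<in> L2per \<Longrightarrow> (\<lambda>k::int. (cmod (fourier g (of_int k)))\<^sup>2) summable_on A"
  by (rule summable_on_subset_banach[OF has_sum_imp_summable[OF parseval]]) auto

lemma sample_energy_nonneg: "0 \<le> sample_energy A g"
  by (simp add: sample_energy_def infsum_nonneg)

lemma sample_energy_mono: "g \<in> L2per \<Longrightarrow> A \<subseteq> B \<Longrightarrow> sample_energy A g \<le> sample_energy B g"
  unfolding sample_energy_def by (intro infsum_mono2 summable_samples) auto

lemma sample_energy_Un_disjoint:
  "g \<in> L2per \<Longrightarrow> A \<inter> B = {} \<Longrightarrow> sample_energy (A \<union> B) g = sample_energy A g + sample_energy B g"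
  unfolding sample_energy_def by (intro infsum_Un_disjoint summable_samples)

lemma sample_energy_le_2pi: "g \<in> L2per \<Longrightarrow> sample_energy A g \<le> 2 * pi * L2_sq g"
  using sample_energy_mono[of g A UNIV] by (simp add: sample_energy_UNIV)

lemma sample_energy_shift: "sample_energy ((+) p ` A) g = sample_energy A (\<lambda>t. cis (of_int p * t) * g t)"
  unfolding sample_energy_def by (subst infsum_reindex) (auto simp: fourier_modulate o_def)

lemma cmod_sq_le_weighted:
  fixes a b :: complex
  assumes "\<eta> > 0"
  shows "(cmod a)\<^sup>2 \<le> (1 + \<eta>) * (cmod b)\<^sup>2 + (1 + 1 / \<eta>) * (cmod (b - a))\<^sup>2"
proof -
  have "cmod a \<le> cmod b + cmod (b - a)"
    using norm_triangle_ineq4[of b "b - a"] by simp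
  then have "(cmod a)\<^sup>2 \<le> (cmod b + cmod (b - a))\<^sup>2"
    by (intro power_mono) auto
  also have "\<dots> \<le> (1 + \<eta>) * (cmod b)\<^sup>2 + (1 + 1 / \<eta>) * (cmod (b - a))\<^sup>2"
  proof -
    have "0 \<le> (\<eta> * cmod b - cmod (b - a))\<^sup>2 / \<eta>"
      using assms by simp
    also have "\<dots> = \<eta> * (cmod b)\<^sup>2 + 1 / \<eta> * (cmod (b - a))\<^sup>2 - 2 * cmod b * cmod (b - a)"
      using assms by (simp add: power2_diff power2_eq_square field_simps)
    finally show ?thesis
      by (simp add: power2_sum algebra_simps)
  qed
  finally show ?thesis .
qed

lemma sample_energy_le_weighted:
  assumes g: "g \<in> L2per" and h: "h \<in> L2per" and \<eta>: "\<eta> > 0"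
  shows "sample_energy A h \<le> (1 + \<eta>) * sample_energy A g + (1 + 1 / \<eta>) * (2 * pi * L2_sq (\<lambda>t. g t - h t))"
proof -
  note diff = L2per_diff[OF g h]
  have "sample_energy A h \<le> (\<Sum>\<^sub>\<infinity>k\<in>A. (1 + \<eta>) * (cmod (fourier g (of_int k)))\<^sup>2
      + (1 + 1 / \<eta>) * (cmod (fourier (\<lambda>t. g t - h t) (of_int k)))\<^sup>2)"
    unfolding sample_energy_def
    by (intro infsum_mono summable_on_add summable_on_cmult_right summable_samples g h diff)
       (simp only: fourier_diff[OF g h] cmod_sq_le_weighted[OF \<eta>])
  also have "\<dots> = (1 + \<eta>) * sample_energy A g + (1 + 1 / \<eta>) * sample_energy A (\<lambda>t. g t - h t)"
    unfolding sample_energy_def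
    by (simp add: infsum_add infsum_cmult_right' summable_on_cmult_right summable_samples g diff)
  also have "\<dots> \<le> (1 + \<eta>) * sample_energy A g + (1 + 1 / \<eta>) * (2 * pi * L2_sq (\<lambda>t. g t - h t))"
    using \<eta> by (intro add_left_mono mult_left_mono sample_energy_le_2pi diff) auto
  finally show ?thesis .
qed

lemma le_sample_energy_set_tendsto:
  assumes g: "g \<in> L2per" and lim: "set_tendsto s A"
    and le: "\<forall>\<^sub>F k in sequentially. v \<le> sample_energy (s k) g"
  shows "v \<le> sample_energy A g"
proof (rule field_le_epsilon)
  fix e :: real assume "e > 0"
  then obtain K where K: "finite K" "dist (\<Sum>k\<in>K. (cmod (fourier g (of_int k)))\<^sup>2) (sample_energy UNIV g) \<le> e"
    using infsum_finite_approximation[OF summable_samples[OF g]] unfolding sample_energy_def by blast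
  then have "dist (sample_energy K g) (sample_energy UNIV g) \<le> e"
    by (simp add: sample_energy_def)
  then have tail: "sample_energy (- K) g \<le> e"
    using sample_energy_Un_disjoint[OF g, of K "- K"] by (simp add: dist_real_def)
  have "\<forall>\<^sub>F k in sequentially. s k \<inter> K = A \<inter> K \<and> v \<le> sample_energy (s k) g"
    using set_tendsto_eventually_Int_eq[OF lim K(1)] le by (rule eventually_conj)
  then obtain k where k: "s k \<inter> K = A \<inter> K" "v \<le> sample_energy (s k) g"
    by (auto simp: eventually_sequentially)
  have "sample_energy (s k) g = sample_energy (A \<inter> K \<union> (s k - K)) g"
    unfolding k(1)[symmetric] by (simp add: Int_Diff_Un)
  also have "\<dots> = sample_energy (A \<inter> K) g + sample_energy (s k - K) g"
    by (intro sample_energy_Un_disjoint g) auto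
  also have "\<dots> \<le> sample_energy A g + sample_energy (- K) g"
    by (intro add_mono sample_energy_mono g) auto
  also have "\<dots> \<le> sample_energy A g + e"
    using tail by simp
  finally show "v \<le> sample_energy A g + e"
    using k(2) by simp
qed

lemma has_sum_ennreal:
  assumes "(f has_sum S) A" "\<And>x. x \<in> A \<Longrightarrow> 0 \<le> f x"
  shows "((\<lambda>x. ennreal (f x)) has_sum ennreal S) A"
proof -
  have "((\<lambda>F. ennreal (sum f F)) \<longlongrightarrow> ennreal S) (finite_subsets_at_top A)"
    using assms(1) unfolding has_sum_def by (rule tendsto_ennrealI)
  moreover have "\<forall>\<^sub>F F in finite_subsets_at_top A. ennreal (sum f F) = (\<Sum>x\<in>F. ennreal (f x))"
    using assms(2) by (intro eventually_finite_subsets_at_top_weakI sum_ennreal[symmetric]) blast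
  ultimately show ?thesis
    unfolding has_sum_def by (rule Lim_transform_eventually)
qed

lemma infsum_ennreal_samples:
  assumes "g \<in> L2per"
  shows "(\<Sum>\<^sub>\<infinity>k\<in>A. ennreal ((cmod (fourier g (of_int k)))\<^sup>2)) = ennreal (sample_energy A g)"
  unfolding sample_energy_def
  by (intro infsumI has_sum_ennreal has_sum_infsum summable_samples assms) simp

subsection \<open>Families of sampling sets\<close>

definition supported_on :: "(real \<Rightarrow> complex) \<Rightarrow> real set \<Rightarrow> bool" where
  "supported_on g T \<longleftrightarrow> (\<forall>t. t \<notin> T \<longrightarrow> g t = 0)"

lemma supported_on_mono: "supported_on g S \<Longrightarrow> S \<subseteq> T \<Longrightarrow> supported_on g T"
  by (auto simp: supported_on_def)

definition sampling_family :: "real \<Rightarrow> real set \<Rightarrow> int set set" where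
  "sampling_family c T = {A. \<forall>g\<in>L2per. supported_on g T \<longrightarrow> c * L2_sq g \<le> sample_energy A g}"

lemma sampling_familyI:
  "(\<And>g. g \<in> L2per \<Longrightarrow> supported_on g T \<Longrightarrow> c * L2_sq g \<le> sample_energy A g) \<Longrightarrow> A \<in> sampling_family c T"
  by (simp add: sampling_family_def)

lemma sampling_familyD:
  "A \<in> sampling_family c T \<Longrightarrow> g \<in> L2per \<Longrightarrow> supported_on g T \<Longrightarrow> c * L2_sq g \<le> sample_energy A g"
  by (simp add: sampling_family_def)

lemma sampling_family_antimono:
  assumes "A \<in> sampling_family c' T'" "c \<le> c'" "T \<subseteq> T'"
  shows "A \<in> sampling_family c T"
proof (rule sampling_familyI)
  fix g assume "g \<in> L2per" "supported_on g T"
  then have "c' * L2_sq g \<le> sample_energy A g"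
    by (intro sampling_familyD[OF assms(1)] supported_on_mono[OF _ assms(3)])
  then show "c * L2_sq g \<le> sample_energy A g"
    using mult_right_mono[OF assms(2) L2_sq_nonneg] by (rule order_trans[rotated])
qed

lemma sampling_family_shift:
  assumes "A \<in> sampling_family c T"
  shows "(+) p ` A \<in> sampling_family c T"
proof (rule sampling_familyI)
  fix g assume g: "g \<in> L2per" "supported_on g T"
  then have "c * L2_sq (\<lambda>t. cis (of_int p * t) * g t) \<le> sample_energy A (\<lambda>t. cis (of_int p * t) * g t)"
    using assms by (intro sampling_familyD L2per_modulate) (auto simp: supported_on_def)
  then show "c * L2_sq g \<le> sample_energy ((+) p ` A) g"
    by (simp add: L2_sq_modulate sample_energy_shift)
qed

lemma sampling_family_closed:
  assumes ev: "\<forall>\<^sub>F k in sequentially. s k \<in> sampling_family c T" and lim: "set_tendsto s A"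
  shows "A \<in> sampling_family c T"
proof (rule sampling_familyI)
  fix g assume g: "g \<in> L2per" "supported_on g T"
  show "c * L2_sq g \<le> sample_energy A g"
    by (rule le_sample_energy_set_tendsto[OF g(1) lim eventually_mono[OF ev]])
      (rule sampling_familyD[OF _ g])
qed

lemma L2per_truncate:
  assumes "g \<in> L2per" "A \<in> sets borel"
  shows "(\<lambda>t. indicator A t * g t) \<in> L2per"
  using assms by (intro L2per_mult_bounded[where B = 1]) (auto simp: indicator_def)

lemma L2_sq_truncate:
  assumes g: "g \<in> L2per" and A: "A \<in> sets borel"
  shows "L2_sq (\<lambda>t. indicator A t * g t) = L2_sq g - L2_sq (\<lambda>t. g t - indicator A t * g t)"
proof -
  have "L2_sq g - L2_sq (\<lambda>t. g t - indicator A t * g t)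
     = (\<integral>t. (cmod (g t))\<^sup>2 - (cmod (g t - indicator A t * g t))\<^sup>2 \<partial>lborel)"
    unfolding L2_sq_def using L2perD(3)[OF g] L2perD(3)[OF L2per_diff[OF g L2per_truncate[OF g A]]] by simp
  also have "\<dots> = L2_sq (\<lambda>t. indicator A t * g t)"
    unfolding L2_sq_def by (intro Bochner_Integration.integral_cong refl) (auto simp: indicator_def)
  finally show ?thesis
    by simp
qed

lemma L2_sq_truncate_tendsto:
  assumes g: "g \<in> L2per" and K: "incseq K" "\<And>k. K k \<in> sets borel" and supp: "supported_on g (\<Union>k. K k)"
  shows "(\<lambda>k. L2_sq (\<lambda>t. g t - indicator (K k) t * g t)) \<longlonglongrightarrow> 0"
proof -
  have "(\<lambda>k. \<integral>t. (cmod (g t - indicator (K k) t * g t))\<^sup>2 \<partial>lborel) \<longlonglongrightarrow> (\<integral>t. 0 \<partial>(lborel :: real measure))"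
  proof (rule integral_dominated_convergence[where w = "\<lambda>t. (cmod (g t))\<^sup>2"])
    show "AE t in lborel. (\<lambda>k. (cmod (g t - indicator (K k) t * g t))\<^sup>2) \<longlonglongrightarrow> 0"
    proof (rule AE_I2)
      fix t
      show "(\<lambda>k. (cmod (g t - indicator (K k) t * g t))\<^sup>2) \<longlonglongrightarrow> 0"
      proof (cases "g t = 0")
        case False
        then obtain k0 where "t \<in> K k0"
          using supp by (auto simp: supported_on_def)
        then have "t \<in> K k" if "k0 \<le> k" for k
          using incseqD[OF K(1) that] by blast
        then show ?thesis
          by (intro tendsto_eventually eventually_sequentiallyI[of k0]) simp
      qed simp
    qed
    show "(\<lambda>t. (cmod (g t - indicator (K k) t * g t))\<^sup>2) \<in> borel_measurable lborel" for k
      using L2perD(1)[OF g] K(2)[of k] by measurable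
    show "AE t in lborel. norm ((cmod (g t - indicator (K k) t * g t))\<^sup>2) \<le> (cmod (g t))\<^sup>2" for k
      by (rule AE_I2) (auto simp: indicator_def)
  qed (use L2perD(3)[OF g] in auto)
  then show ?thesis
    by (simp add: L2_sq_def)
qed

lemma sampling_family_Union:
  assumes K: "incseq K" "\<And>k. K k \<in> sets borel" and A: "\<And>k. A \<in> sampling_family c (K k)"
  shows "A \<in> sampling_family c (\<Union>k. K k)"
proof (rule sampling_familyI)
  fix g assume g: "g \<in> L2per" and supp: "supported_on g (\<Union>k. K k)"
  define \<delta> where "\<delta> = (\<lambda>k. L2_sq (\<lambda>t. g t - indicator (K k) t * g t))"
  have \<delta>: "\<delta> \<longlonglongrightarrow> 0"
    unfolding \<delta>_def by (rule L2_sq_truncate_tendsto[OF g K supp])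
  have weighted: "c * L2_sq g \<le> (1 + \<eta>) * sample_energy A g" if \<eta>: "\<eta> > 0" for \<eta>
  proof -
    have "c * (L2_sq g - \<delta> k) \<le> (1 + \<eta>) * sample_energy A g + (1 + 1 / \<eta>) * (2 * pi * \<delta> k)" for k
    proof -
      let ?h = "\<lambda>t. indicator (K k) t * g t"
      have "c * L2_sq ?h \<le> sample_energy A ?h"
        by (intro sampling_familyD[OF A[of k]] L2per_truncate g K) (simp add: supported_on_def)
      also have "\<dots> \<le> (1 + \<eta>) * sample_energy A g + (1 + 1 / \<eta>) * (2 * pi * \<delta> k)"
        unfolding \<delta>_def by (intro sample_energy_le_weighted L2per_truncate g K \<eta>)
      finally show ?thesis
        by (simp add: L2_sq_truncate[OF g K(2)] \<delta>_def)
    qed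
    moreover have "(\<lambda>k. c * (L2_sq g - \<delta> k)) \<longlonglongrightarrow> c * (L2_sq g - 0)"
      by (intro tendsto_intros \<delta>)
    moreover have "(\<lambda>k. (1 + \<eta>) * sample_energy A g + (1 + 1 / \<eta>) * (2 * pi * \<delta> k))
        \<longlonglongrightarrow> (1 + \<eta>) * sample_energy A g + (1 + 1 / \<eta>) * (2 * pi * 0)"
      by (intro tendsto_intros \<delta>)
    ultimately show ?thesis
      using LIMSEQ_le[of "\<lambda>k. c * (L2_sq g - \<delta> k)"] by fastforce
  qed
  show "c * L2_sq g \<le> sample_energy A g"
  proof (rule field_le_epsilon)
    fix e :: real assume "e > 0"
    define \<eta> where "\<eta> = e / (sample_energy A g + 1)"
    have "\<eta> > 0" "\<eta> * sample_energy A g \<le> e"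
      using \<open>e > 0\<close> sample_energy_nonneg[of A g] by (auto simp: \<eta>_def field_simps)
    then show "c * L2_sq g \<le> sample_energy A g + e"
      using weighted[of \<eta>] by (simp add: distrib_right)
  qed
qed

text \<open>Densities are not preserved by pointwise limits of sets, but the minimal number of points in windows of
  a fixed length is.\<close>
lemma sampling_family_density:
  assumes K: "incseq K" "\<And>k. K k \<in> sets borel"
    and small: "\<And>k n. \<exists>A\<in>sampling_family c (K k). window_count A 0 (int n) \<le> D * real n"
  shows "\<exists>A\<in>sampling_family c (\<Union>k. K k). \<exists>h\<le>D. has_density A h"
proof -
  have windows: "\<exists>A\<in>sampling_family c (\<Union>k. K k). window_count A 0 (int n) \<le> D * real n" for n
  proof -
    obtain s where s: "\<And>k. s k \<in> sampling_family c (K k)" "\<And>k. window_count (s k) 0 (int n) \<le> D * real n"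
      using small[of _ n] by metis
    obtain r A where r: "strict_mono r" and A: "set_tendsto (\<lambda>i. s (r i)) A"
      using set_tendsto_subsequence[of s] by blast
    have "A \<in> sampling_family c (K k)" for k
    proof (rule sampling_family_closed[OF eventually_sequentiallyI A])
      fix i assume "k \<le> i"
      then have "K k \<subseteq> K (r i)"
        using seq_suble[OF r, of i] incseqD[OF K(1)] order_trans by blast
      then show "s (r i) \<in> sampling_family c (K k)"
        by (rule sampling_family_antimono[OF s(1) order_refl])
    qed
    then have "A \<in> sampling_family c (\<Union>k. K k)"
      by (rule sampling_family_Union[OF K])
    moreover obtain i where "s (r i) \<inter> {0..<int n} = A \<inter> {0..<int n}"
      using set_tendsto_eventually_Int_eq[OF A, of "{0..<int n}"] by (auto simp: eventually_sequentially)
    then have "window_count A 0 (int n) \<le> D * real n"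
      using s(2)[of "r i"] by (simp add: window_count_card)
    ultimately show ?thesis
      by blast
  qed
  interpret closed_shift_invariant_family "sampling_family c (\<Union>k. K k)"
  proof
    show "sampling_family c (\<Union>k. K k) \<noteq> {}"
      using windows by blast
  qed (auto intro!: sampling_family_shift sampling_family_closed intro: always_eventually)
  show ?thesis
    using exists_density_eq_min_density min_density_le[OF windows] by blast
qed

subsection \<open>Unions of residue classes\<close>

lemma sum_roots_of_unity:
  fixes m :: nat and k :: int
  assumes m: "m > 0" and k: "\<bar>k\<bar> < int m"
  shows "(\<Sum>j<m. cis (2 * pi * real j * of_int k / real m)) = (if k = 0 then of_nat m else 0)"
proof (cases "k = 0")
  case False
  define z where "z = cis (2 * pi * of_int k / real m)"
  have "z \<noteq> 1"
  proof
    assume "z = 1"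
    then have "cos (2 * pi * of_int k / real m) = 1"
      by (simp add: z_def complex_eq_iff)
    then obtain n :: int where "2 * pi * of_int k / real m = of_int n * 2 * pi"
      by (auto simp: cos_one_2pi_int)
    then have "real_of_int k = of_int (n * int m)"
      using m by (simp add: field_simps)
    then have "k = n * int m"
      by linarith
    then have "\<bar>int m\<bar> \<le> \<bar>k\<bar>"
      using False by (intro dvd_imp_le_int) auto
    then show False
      using k by simp
  qed
  have "z ^ m = 1"
    using m by (simp add: z_def Complex.DeMoivre cis_multiple_2pi)
  moreover have "(\<Sum>j<m. cis (2 * pi * real j * of_int k / real m)) = (\<Sum>j<m. z ^ j)"
    by (intro sum.cong refl) (simp add: z_def Complex.DeMoivre mult_ac)
  ultimately show ?thesis
    using False \<open>z \<noteq> 1\<close> by (simp add: sum_gp_strict)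
qed simp

definition cell :: "nat \<Rightarrow> nat \<Rightarrow> real set" where
  "cell m l = {2 * pi * l / m..<2 * pi * (l + 1) / m}"

lemma mem_cell_iff: "m > 0 \<Longrightarrow> x \<in> cell m l \<longleftrightarrow> \<lfloor>x * m / (2 * pi)\<rfloor> = int l"
  unfolding cell_def floor_eq_iff by (auto simp: field_simps)

lemma cell_sets [measurable]: "cell m l \<in> sets borel"
  by (simp add: cell_def)

lemma cell_fmeasurable: "cell m l \<in> fmeasurable lborel"
  by (simp add: fmeasurable_def cell_def divide_right_mono)

lemma disjoint_family_on_cell: "m > 0 \<Longrightarrow> disjoint_family_on (cell m) L"
  by (auto simp: disjoint_family_on_def mem_cell_iff)

lemma measure_cell: "m > 0 \<Longrightarrow> measure lborel (cell m l) = 2 * pi / m"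
  unfolding cell_def by (subst measure_lborel_Ico) (auto simp: divide_right_mono field_simps)

lemma affine_mem_cell_iff: "m > 0 \<Longrightarrow> 2 * pi * l / m + 1 / m * s \<in> cell m l \<longleftrightarrow> s \<in> {0..<2*pi}"
  by (auto simp: cell_def field_simps)

lemma sum_indicator_cells:
  fixes F :: "real \<Rightarrow> 'a :: real_vector"
  assumes "m > 0" "finite L" and supp: "\<And>x. x \<notin> (\<Union>l\<in>L. cell m l) \<Longrightarrow> F x = 0"
  shows "(\<Sum>l\<in>L. indicator (cell m l) x *\<^sub>R F x) = F x"
proof (cases "x \<in> (\<Union>l\<in>L. cell m l)")
  case True
  then obtain k where k: "k \<in> L" "x \<in> cell m k"
    by blast
  have "(\<Sum>l\<in>L. indicator (cell m l) x *\<^sub>R F x) = (\<Sum>l\<in>L. if l = k then F x else 0)"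
    using k assms(1) by (intro sum.cong refl) (auto simp: indicator_def mem_cell_iff)
  then show ?thesis
    using assms(2) k by simp
qed (simp add: supp)

lemma has_bochner_integral_cells:
  fixes F :: "real \<Rightarrow> 'a :: {banach, second_countable_topology}"
  assumes m: "m > 0" and L: "finite L" and int: "has_bochner_integral lborel F I"
    and supp: "\<And>x. x \<notin> (\<Union>l\<in>L. cell m l) \<Longrightarrow> F x = 0"
  shows "has_bochner_integral lborel
    (\<lambda>s. \<Sum>l\<in>L. (1 / m) *\<^sub>R (indicator {0..<2*pi} s *\<^sub>R F (2 * pi * l / m + 1 / m * s))) I"
proof -
  let ?C = "\<lambda>l x. indicator (cell m l) x *\<^sub>R F x"
  have F: "integrable lborel F" "integral\<^sup>L lborel F = I"
    using int by (auto simp: has_bochner_integral_iff)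
  have C: "has_bochner_integral lborel (?C l) (integral\<^sup>L lborel (?C l))" for l
    by (intro has_bochner_integral_integrable integrable_mult_indicator F) simp
  have "has_bochner_integral lborel (\<lambda>s. (1 / m) *\<^sub>R (indicator {0..<2*pi} s *\<^sub>R F (2 * pi * l / m + 1 / m * s)))
      (integral\<^sup>L lborel (?C l))" for l
  proof -
    have "indicator (cell m l) (2 * pi * l / m + 1 / m * s) = (indicator {0..<2*pi} s :: real)" for s
      unfolding indicator_def using affine_mem_cell_iff[OF m, of l s] by simp
    then have "has_bochner_integral lborel (\<lambda>s. indicator {0..<2*pi} s *\<^sub>R F (2 * pi * l / m + 1 / m * s))
        (integral\<^sup>L lborel (?C l) /\<^sub>R \<bar>1 / m\<bar>)"
      using C[of l] m
      by (subst (asm) lborel_has_bochner_integral_real_affine_iff[where c = "1 / m" and t = "2 * pi * l / m"]) auto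
    from has_bochner_integral_scaleR_right[OF this, of "1 / m"] show ?thesis
      using m by simp
  qed
  then have "has_bochner_integral lborel
      (\<lambda>s. \<Sum>l\<in>L. (1 / m) *\<^sub>R (indicator {0..<2*pi} s *\<^sub>R F (2 * pi * l / m + 1 / m * s)))
      (\<Sum>l\<in>L. integral\<^sup>L lborel (?C l))"
    by (intro has_bochner_integral_sum)
  moreover have "(\<Sum>l\<in>L. ?C l x) = F x" for x
    by (rule sum_indicator_cells[OF m L supp])
  moreover have "(\<Sum>l\<in>L. integral\<^sup>L lborel (?C l)) = (\<integral>x. (\<Sum>l\<in>L. ?C l x) \<partial>lborel)"
    using C by (intro Bochner_Integration.integral_sum[symmetric]) (auto dest: integrable.intros)
  ultimately show ?thesis
    using F(2) by simp
qed

definition cell_piece :: "nat \<Rightarrow> (real \<Rightarrow> complex) \<Rightarrow> nat \<Rightarrow> real \<Rightarrow> complex" where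
  "cell_piece m g l s = indicator {0..<2*pi} s * g (2 * pi * l / m + 1 / m * s)"

definition partial_dft :: "nat \<Rightarrow> nat set \<Rightarrow> (nat \<Rightarrow> complex) \<Rightarrow> nat \<Rightarrow> complex" where
  "partial_dft m L x j = (\<Sum>l\<in>L. cis (2 * pi * real j * real l / m) * x l)"

definition cell_dft :: "nat \<Rightarrow> nat set \<Rightarrow> (real \<Rightarrow> complex) \<Rightarrow> nat \<Rightarrow> real \<Rightarrow> complex" where
  "cell_dft m L g j s = 1 / of_nat m * cis (j * s / m) * partial_dft m L (\<lambda>l. cell_piece m g l s) j"

lemma cell_piece_L2per:
  assumes m: "m > 0" and g: "g \<in> L2per"
  shows "cell_piece m g l \<in> L2per"
proof -
  have [measurable]: "g \<in> borel_measurable borel"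
    by (rule L2perD(1)[OF g])
  have "cell_piece m g l \<in> borel_measurable borel"
    unfolding cell_piece_def by measurable
  moreover have "integrable lborel (\<lambda>s. (cmod (g (2 * pi * l / m + 1 / m * s)))\<^sup>2)"
    using m by (intro lborel_integrable_real_affine L2perD(3) g) simp
  then have "integrable lborel (\<lambda>s. (cmod (g (2 * pi * l / m + 1 / m * s)))\<^sup>2 * indicator {0..<2*pi} s)"
    by (rule integrable_real_mult_indicator[rotated]) simp
  then have "integrable lborel (\<lambda>s. (cmod (cell_piece m g l s))\<^sup>2)"
    by (rule Bochner_Integration.integrable_cong[THEN iffD1, rotated -1])
      (auto simp: cell_piece_def indicator_def)
  ultimately show ?thesis
    by (auto simp: L2per_def cell_piece_def)
qed

lemma cell_dft_L2per:
  assumes "m > 0" "g \<in> L2per"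
  shows "cell_dft m L g j \<in> L2per"
  unfolding cell_dft_def partial_dft_def using assms
  by (intro L2per_mult_bounded[where B = "1 / m"] L2per_sum L2per_scale cell_piece_L2per)
     (auto simp: norm_mult norm_divide)

lemma sum_L2_sq_cell_piece:
  assumes m: "m > 0" and L: "finite L" and g: "g \<in> L2per" and supp: "supported_on g (\<Union>l\<in>L. cell m l)"
  shows "(\<Sum>l\<in>L. L2_sq (cell_piece m g l)) = m * L2_sq g"
proof -
  have "has_bochner_integral lborel (\<lambda>t. (cmod (g t))\<^sup>2) (L2_sq g)"
    unfolding L2_sq_def by (intro has_bochner_integral_integrable L2perD(3) g)
  then have "has_bochner_integral lborel (\<lambda>s. \<Sum>l\<in>L. (1 / m) *\<^sub>R (indicator {0..<2*pi} s *\<^sub>R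
      (cmod (g (2 * pi * l / m + 1 / m * s)))\<^sup>2)) (L2_sq g)"
    using supp by (intro has_bochner_integral_cells[OF m L]) (auto simp: supported_on_def)
  moreover have "(\<Sum>l\<in>L. (1 / m) *\<^sub>R (indicator {0..<2*pi} s *\<^sub>R (cmod (g (2 * pi * l / m + 1 / m * s)))\<^sup>2))
      = (1 / m) * (\<Sum>l\<in>L. (cmod (cell_piece m g l s))\<^sup>2)" for s
    by (simp add: cell_piece_def norm_mult indicator_def sum_distrib_left)
  ultimately have "L2_sq g = (\<integral>s. (1 / m) * (\<Sum>l\<in>L. (cmod (cell_piece m g l s))\<^sup>2) \<partial>lborel)"
    by (simp add: has_bochner_integral_iff)
  also have "\<dots> = (1 / m) * (\<Sum>l\<in>L. L2_sq (cell_piece m g l))"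
    unfolding L2_sq_def using L2perD(3)[OF cell_piece_L2per[OF m g]] by simp
  finally show ?thesis
    using m by simp
qed

lemma fourier_cell_dft:
  assumes m: "m > 0" and L: "finite L" and g: "g \<in> L2per" and supp: "supported_on g (\<Union>l\<in>L. cell m l)"
  shows "fourier (cell_dft m L g j) (of_int q) = fourier g (of_int (int j + int m * q))"
proof -
  let ?x = "real_of_int (int j + int m * q)" and ?y = "\<lambda>l s. 2 * pi * real l / m + 1 / m * s"
  have "has_bochner_integral lborel (\<lambda>t. g t * cis (?x * t)) (fourier g ?x)"
    unfolding fourier_def by (intro has_bochner_integral_integrable fourier_integrable g)
  then have int: "has_bochner_integral lborel
      (\<lambda>s. \<Sum>l\<in>L. (1 / m) *\<^sub>R (indicator {0..<2*pi} s *\<^sub>R (g (?y l s) * cis (?x * ?y l s)))) (fourier g ?x)"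
    using supp by (intro has_bochner_integral_cells[OF m L]) (auto simp: supported_on_def)
  have cis: "cis (?x * ?y l s) = cis (j * s / m) * cis (2 * pi * real j * real l / m) * cis (of_int q * s)"
    for l and s :: real
  proof -
    have "?x * ?y l s = j * s / m + 2 * pi * real j * real l / m + of_int q * s + 2 * pi * of_int (q * int l)"
      using m by (simp add: field_simps)
    moreover have "cis (2 * pi * of_int (q * int l)) = 1"
      by (rule cis_multiple_2pi) simp
    ultimately show ?thesis
      by (simp only: cis_mult[symmetric] mult_1_right)
  qed
  have "(\<Sum>l\<in>L. (1 / m) *\<^sub>R (indicator {0..<2*pi} s *\<^sub>R (g (?y l s) * cis (?x * ?y l s))))
      = cell_dft m L g j s * cis (of_int q * s)" for s
    unfolding cell_dft_def partial_dft_def cell_piece_def cis sum_distrib_left sum_distrib_right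
    by (intro sum.cong refl) (simp add: scaleR_conv_of_real indicator_def mult_ac)
  then show ?thesis
    using int by (simp add: has_bochner_integral_iff fourier_def[of "cell_dft m L g j"])
qed

lemma L2_sq_le_sum_cell_dft:
  assumes m: "m > 0" and L: "finite L" and g: "g \<in> L2per" and supp: "supported_on g (\<Union>l\<in>L. cell m l)"
    and frame: "\<And>x. B * (\<Sum>l\<in>L. (cmod (x l))\<^sup>2)
      \<le> (\<Sum>j\<in>J. (cmod (partial_dft m L x j))\<^sup>2)"
  shows "B / m * L2_sq g \<le> (\<Sum>j\<in>J. L2_sq (cell_dft m L g j))"
proof -
  note piece = L2perD(3)[OF cell_piece_L2per[OF m g]] and dft = L2perD(3)[OF cell_dft_L2per[OF m g]]
  have "B / m * L2_sq g = B / m\<^sup>2 * (\<Sum>l\<in>L. L2_sq (cell_piece m g l))"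
    unfolding sum_L2_sq_cell_piece[OF m L g supp] using m by (simp add: power2_eq_square)
  also have "\<dots> = (\<integral>s. B / m\<^sup>2 * (\<Sum>l\<in>L. (cmod (cell_piece m g l s))\<^sup>2) \<partial>lborel)"
    unfolding L2_sq_def using piece by simp
  also have "\<dots> \<le> (\<integral>s. (\<Sum>j\<in>J. (cmod (cell_dft m L g j s))\<^sup>2) \<partial>lborel)"
  proof (rule Bochner_Integration.integral_mono)
    fix s
    have "(cmod (cell_dft m L g j s))\<^sup>2
        = (cmod (partial_dft m L (\<lambda>l. cell_piece m g l s) j))\<^sup>2 / m\<^sup>2" for j
      by (simp add: cell_dft_def norm_mult norm_divide power_divide)
    then show "B / m\<^sup>2 * (\<Sum>l\<in>L. (cmod (cell_piece m g l s))\<^sup>2) \<le> (\<Sum>j\<in>J. (cmod (cell_dft m L g j s))\<^sup>2)"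
      using divide_right_mono[OF frame[of "\<lambda>l. cell_piece m g l s"], of "(real m)\<^sup>2"]
      by (simp add: sum_divide_distrib[symmetric])
  qed (use piece dft in simp_all)
  also have "\<dots> = (\<Sum>j\<in>J. L2_sq (cell_dft m L g j))"
    unfolding L2_sq_def using dft by (intro Bochner_Integration.integral_sum)
  finally show ?thesis .
qed

definition residue_set :: "nat \<Rightarrow> nat set \<Rightarrow> int set" where
  "residue_set m J = {k. nat (k mod int m) \<in> J}"

lemma residue_set_eq_Union:
  assumes m: "m > 0" and J: "J \<subseteq> {..<m}"
  shows "residue_set m J = (\<Union>j\<in>J. range (\<lambda>q. int j + int m * q))"
proof (intro equalityI subsetI)
  fix k assume "k \<in> residue_set m J"
  moreover have "k = int (nat (k mod int m)) + int m * (k div int m)"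
    using m by simp
  ultimately show "k \<in> (\<Union>j\<in>J. range (\<lambda>q. int j + int m * q))"
    unfolding residue_set_def by blast
qed (use J in \<open>auto simp: residue_set_def\<close>)

lemma sample_energy_residue_set:
  assumes m: "m > 0" and L: "finite L" and J: "J \<subseteq> {..<m}"
    and g: "g \<in> L2per" and supp: "supported_on g (\<Union>l\<in>L. cell m l)"
  shows "sample_energy (residue_set m J) g = 2 * pi * (\<Sum>j\<in>J. L2_sq (cell_dft m L g j))"
proof -
  let ?class = "\<lambda>j. range (\<lambda>q. int j + int m * q)"
  have "((\<lambda>k. (cmod (fourier g (of_int k)))\<^sup>2) has_sum 2 * pi * L2_sq (cell_dft m L g j)) (?class j)" for j
  proof -
    have inj: "inj (\<lambda>q. int j + int m * q)"
      using m by (simp add: inj_on_def)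
    show ?thesis
      unfolding has_sum_reindex[OF inj] o_def fourier_cell_dft[OF m L g supp, symmetric]
      by (rule parseval[OF cell_dft_L2per[OF m g]])
  qed
  moreover have "?class j \<inter> ?class j' = {}" if "j \<in> J" "j' \<in> J" "j \<noteq> j'" for j j'
  proof -
    have "k mod int m = int i" if "k \<in> ?class i" "i \<in> J" for k i
      using that J by auto
    then show ?thesis
      using that by (metis disjoint_iff of_nat_eq_iff)
  qed
  moreover have "finite J"
    using J finite_subset by blast
  ultimately have "((\<lambda>k. (cmod (fourier g (of_int k)))\<^sup>2) has_sum (\<Sum>j\<in>J. 2 * pi * L2_sq (cell_dft m L g j)))
      (residue_set m J)"
    unfolding residue_set_eq_Union[OF m J] by (intro sum_has_sum)
  then show ?thesis
    unfolding sample_energy_def by (simp add: infsumI sum_distrib_left)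
qed

lemma residue_set_sampling_family:
  assumes m: "m > 0" and L: "finite L" and J: "J \<subseteq> {..<m}"
    and frame: "\<And>x. B * (\<Sum>l\<in>L. (cmod (x l))\<^sup>2)
      \<le> (\<Sum>j\<in>J. (cmod (partial_dft m L x j))\<^sup>2)"
  shows "residue_set m J \<in> sampling_family (2 * pi * B / m) (\<Union>l\<in>L. cell m l)"
proof (rule sampling_familyI)
  fix g assume g: "g \<in> L2per" "supported_on g (\<Union>l\<in>L. cell m l)"
  have "2 * pi * (B / m * L2_sq g) \<le> 2 * pi * (\<Sum>j\<in>J. L2_sq (cell_dft m L g j))"
    by (intro mult_left_mono L2_sq_le_sum_cell_dft[OF m L g frame]) simp
  then show "2 * pi * B / m * L2_sq g \<le> sample_energy (residue_set m J) g"
    by (simp add: sample_energy_residue_set[OF m L J g])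
qed

lemma residue_set_shift: "(+) (int m) ` residue_set m J = residue_set m J"
proof (intro set_eqI iffI)
  fix x assume "x \<in> residue_set m J"
  then have "x - int m \<in> residue_set m J"
    by (simp add: residue_set_def)
  then show "x \<in> (+) (int m) ` residue_set m J"
    by (intro image_eqI[of _ _ "x - int m"]) auto
qed (auto simp: residue_set_def)

lemma window_count_residue_set:
  assumes J: "J \<subseteq> {..<m}"
  shows "window_count (residue_set m J) (int i) (int m + int i) = card J"
proof -
  let ?A = "residue_set m J"
  have "?A \<inter> {0..<int m} = int ` J"
  proof (intro set_eqI iffI)
    fix x assume "x \<in> ?A \<inter> {0..<int m}"
    then have "nat x \<in> J" "x = int (nat x)"
      by (auto simp: residue_set_def)
    then show "x \<in> int ` J"
      by blast
  qed (use J in \<open>auto simp: residue_set_def\<close>)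
  then have "window_count ?A 0 (int m) = card J"
    by (simp add: window_count_card card_image)
  moreover have "window_count ?A (int m) (int m + int i) = window_count ?A 0 (int i)"
    using window_count_shift[of "int m" ?A 0 "int i"] unfolding residue_set_shift by simp
  ultimately show ?thesis
    using window_count_split[of 0 "int i" "int m + int i" ?A]
      window_count_split[of 0 "int m" "int m + int i" ?A]
    by simp
qed

lemma residue_set_shift_small_window:
  assumes m: "m > 0" and J: "J \<subseteq> {..<m}"
  obtains p where "window_count ((+) p ` residue_set m J) 0 (int n) \<le> card J / m * n"
proof -
  let ?A = "residue_set m J"
  have total: "(\<Sum>y\<in>{0..<int m}. window_count ?A y (y + int n)) = n * card J"
    unfolding sum_window_count by (simp add: window_count_residue_set[OF J])
  have "\<exists>y\<in>{0..<int m}. window_count ?A y (y + int n) \<le> card J / m * n"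
  proof (rule ccontr)
    assume "\<not> ?thesis"
    then have "(\<Sum>y\<in>{0..<int m}. card J / m * n) < (\<Sum>y\<in>{0..<int m}. window_count ?A y (y + int n))"
      using m by (intro sum_strict_mono) (auto simp: not_le)
    then show False
      unfolding total using m by simp
  qed
  then obtain y where y: "window_count ?A y (y + int n) \<le> card J / m * n"
    by blast
  have "window_count ((+) (- y) ` ?A) (- y + y) (- y + (y + int n)) = window_count ?A y (y + int n)"
    by (rule window_count_shift)
  then show thesis
    using y by (intro that[of "- y"]) simp
qed

lemma fourier_row_selection:
  fixes d :: real
  assumes L: "L \<subseteq> {..<m}" and d: "d > 0" and large: "4 \<le> d * card L"
  shows "\<exists>J\<subseteq>{..<m}. card J \<le> (1 + d) * card L \<and>
    (\<forall>x. frame_constant d * card L * (\<Sum>l\<in>L. (cmod (x l))\<^sup>2)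
      \<le> (\<Sum>j\<in>J. (cmod (partial_dft m L x j))\<^sup>2))"
proof -
  define u where "u = (\<lambda>(j::nat) (l::nat). cis (- (2 * pi * real j * real l / m)))"
  have fin: "finite L"
    using L finite_subset by blast
  have nonempty: "L \<noteq> {}"
    using large by auto
  then have m: "m > 0"
    using L by fastforce
  interpret finite_matrices L
    by standard (rule fin)
  interpret tight_frame L u "{..<m}"
  proof
    fix i l assume mem: "i \<in> L" "l \<in> L"
    have "gram u {..<m} i l = (\<Sum>j<m. cis (2 * pi * real j * of_int (int l - int i) / m))"
      unfolding gram_def u_def
      by (intro sum.cong refl) (simp add: cis_cnj cis_mult diff_divide_distrib right_diff_distrib)
    also have "\<dots> = (if int l - int i = 0 then of_nat m else 0)"
      using mem L m by (intro sum_roots_of_unity) (auto simp: abs_less_iff)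
    finally show "gram u {..<m} i l = (if i = l then of_nat (card {..<m}) else 0)"
      by auto
  qed (use nonempty in auto)
  have "card L \<le> card {..<m}"
    using L by (intro card_mono) auto
  from row_selection[OF d this large] show ?thesis
    by (simp add: norm_sq_def inner_prod_def u_def cis_cnj partial_dft_def)
qed

lemma sampling_family_cells_small_windows:
  fixes d :: real
  assumes L: "L \<subseteq> {..<m}" and d: "d > 0" and large: "4 \<le> d * card L"
  shows "\<exists>A\<in>sampling_family (2 * pi * (frame_constant d * card L) / m) (\<Union>l\<in>L. cell m l).
    window_count A 0 (int n) \<le> (1 + d) * card L / m * n"
proof -
  have fin: "finite L"
    using L finite_subset by blast
  have "L \<noteq> {}"
    using large by auto
  then have m: "m > 0"
    using L by fastforce
  obtain J where J: "J \<subseteq> {..<m}" "card J \<le> (1 + d) * card L"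
    and frame: "\<And>x. frame_constant d * card L * (\<Sum>l\<in>L. (cmod (x l))\<^sup>2)
      \<le> (\<Sum>j\<in>J. (cmod (partial_dft m L x j))\<^sup>2)"
    using fourier_row_selection[OF L d large] by blast
  obtain p where "window_count ((+) p ` residue_set m J) 0 (int n) \<le> card J / m * n"
    using residue_set_shift_small_window[OF m J(1)] .
  also have "\<dots> \<le> (1 + d) * card L / m * n"
    using J(2) by (intro mult_right_mono divide_right_mono) auto
  finally show ?thesis
    using sampling_family_shift[OF residue_set_sampling_family[OF m fin J(1) frame]] by blast
qed

subsection \<open>Covering compact sets by cells\<close>

definition cells_meeting :: "nat \<Rightarrow> real set \<Rightarrow> nat set" where
  "cells_meeting m K = {l. l < m \<and> cell m l \<inter> K \<noteq> {}}"

lemma finite_cells_meeting [simp]: "finite (cells_meeting m K)"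
  by (simp add: cells_meeting_def)

lemma subset_Union_cells_meeting:
  assumes m: "m > 0" and K: "K \<subseteq> {0..<2*pi}"
  shows "K \<subseteq> (\<Union>l\<in>cells_meeting m K. cell m l)"
proof
  fix x assume x: "x \<in> K"
  define l where "l = nat \<lfloor>x * m / (2 * pi)\<rfloor>"
  have "0 \<le> x" "x < 2 * pi"
    using x K by auto
  then have "0 \<le> x * m / (2 * pi)" "x * m / (2 * pi) < m"
    using m by (auto simp: divide_less_eq)
  then have "int l = \<lfloor>x * m / (2 * pi)\<rfloor>" "l < m"
    by (auto simp: l_def nat_less_iff floor_less_iff)
  then have "x \<in> cell m l" "l \<in> cells_meeting m K"
    using x m by (auto simp: cells_meeting_def mem_cell_iff)
  then show "x \<in> (\<Union>l\<in>cells_meeting m K. cell m l)"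
    by blast
qed

lemma measure_Union_cells:
  assumes "m > 0" "finite L"
  shows "measure lborel (\<Union>l\<in>L. cell m l) = 2 * pi * (card L / m)"
proof -
  have "measure lborel (\<Union>l\<in>L. cell m l) = (\<Sum>l\<in>L. measure lborel (cell m l))"
  proof (rule measure_finite_Union)
    show "emeasure lborel (cell m l) \<noteq> \<infinity>" for l
      using cell_fmeasurable[of m l] by (simp add: fmeasurable_def)
  qed (use assms in \<open>auto simp: disjoint_family_on_cell\<close>)
  then show ?thesis
    using assms by (simp add: measure_cell)
qed

lemma cells_fmeasurable: "(\<Union>l\<in>cells_meeting m K. cell m l) \<in> fmeasurable lborel"
  by (intro fmeasurable.finite_UN) (auto simp: cell_fmeasurable)

lemma Union_cells_meeting_subset:
  assumes m: "m > 0" "2 * pi / m < r"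
  shows "(\<Union>l\<in>cells_meeting m K. cell m l) \<subseteq> (\<Union>x\<in>K. ball x r)"
proof
  fix y assume "y \<in> (\<Union>l\<in>cells_meeting m K. cell m l)"
  then obtain l x where x: "x \<in> K" "x \<in> cell m l" "y \<in> cell m l"
    by (auto simp: cells_meeting_def)
  then have "\<bar>x - y\<bar> < 2 * pi / m"
    by (auto simp: cell_def add_divide_distrib algebra_simps)
  then have "y \<in> ball x r"
    using m(2) by (simp add: dist_real_def)
  then show "y \<in> (\<Union>x\<in>K. ball x r)"
    using x(1) by blast
qed

lemma lmeasurable_outer_open_less:
  assumes K: "K \<in> lmeasurable" and e: "e > 0"
  obtains U where "open U" "K \<subseteq> U" "U \<in> lmeasurable" "measure lebesgue U < measure lebesgue K + e"
proof -
  obtain U where U: "open U" "K \<subseteq> U" "U - K \<in> lmeasurable" "emeasure lebesgue (U - K) < ennreal e"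
    using sets_lebesgue_outer_open[OF fmeasurableD[OF K] e] .
  have K_Un: "K \<union> (U - K) = U"
    using U(2) by blast
  have "U \<in> lmeasurable"
    using fmeasurable.Un[OF K U(3)] unfolding K_Un .
  moreover have "measure lebesgue U \<le> measure lebesgue K + measure lebesgue (U - K)"
    using measure_Un_le[OF fmeasurableD[OF K] fmeasurableD[OF U(3)]] unfolding K_Un .
  moreover have "measure lebesgue (U - K) < e"
    using U(3,4) e by (simp add: emeasure_eq_measure2 ennreal_less_iff)
  ultimately show thesis
    using U(1,2) by (intro that[of U]) auto
qed

lemma eventually_card_cells_meeting:
  assumes K: "compact K" "K \<subseteq> {0..<2*pi}" and e: "e > 0"
  shows "\<forall>\<^sub>F m in sequentially. measure lborel K \<le> 2 * pi * (card (cells_meeting m K) / m) \<and>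
    2 * pi * (card (cells_meeting m K) / m) \<le> measure lborel K + e"
proof -
  have borel_K: "K \<in> sets borel"
    using K(1) by (rule borel_compact)
  obtain U where U: "open U" "K \<subseteq> U" "U \<in> lmeasurable" "measure lebesgue U < measure lebesgue K + e"
    using lmeasurable_outer_open_less[OF lmeasurable_compact[OF K(1)] e] .
  obtain r where r: "r > 0" "(\<Union>x\<in>K. ball x r) \<subseteq> U"
    using compact_subset_open_imp_ball_epsilon_subset[OF K(1) U(1,2)] .
  show ?thesis
  proof (rule eventually_sequentiallyI[of "nat \<lceil>2 * pi / r\<rceil> + 1"], intro conjI)
    fix m assume "nat \<lceil>2 * pi / r\<rceil> + 1 \<le> m"
    then have m: "m > 0" "2 * pi / r < m"
      by linarith+
    let ?C = "\<Union>l\<in>cells_meeting m K. cell m l"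
    have C: "measure lborel ?C = 2 * pi * (card (cells_meeting m K) / m)"
      using m by (intro measure_Union_cells) auto
    show "measure lborel K \<le> 2 * pi * (card (cells_meeting m K) / m)"
      unfolding C[symmetric]
      by (intro measure_mono_fmeasurable subset_Union_cells_meeting m K cells_fmeasurable) (simp add: borel_K)
    have "2 * pi / m < r"
      using m r(1) by (simp add: field_simps)
    then have "?C \<subseteq> U"
      by (intro order_trans[OF Union_cells_meeting_subset[OF m(1)] r(2)])
    then have "measure lebesgue ?C \<le> measure lebesgue U"
      by (intro measure_mono_fmeasurable U(3)) auto
    then show "2 * pi * (card (cells_meeting m K) / m) \<le> measure lborel K + e"
      using U(4) C borel_K by simp
  qed
qed

lemma compact_sampling_family_small_windows:
  assumes K: "compact K" "K \<subseteq> {0..<2*pi}" and pos: "0 < measure lborel K" and d: "d > 0" and e: "e > 0"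
  shows "\<exists>A\<in>sampling_family (frame_constant d * measure lborel K) K.
    window_count A 0 (int n) \<le> (1 + d) * (measure lborel K + e) / (2 * pi) * n"
proof -
  let ?L = "\<lambda>m. cells_meeting m K"
  obtain m where m: "m > nat \<lceil>8 * pi / (d * measure lborel K)\<rceil>"
    and lower: "measure lborel K \<le> 2 * pi * (card (?L m) / m)"
    and upper: "2 * pi * (card (?L m) / m) \<le> measure lborel K + e"
    using eventually_conj[OF eventually_gt_at_top eventually_card_cells_meeting[OF K e]]
    by (metis (no_types, lifting) eventually_happens' sequentially_bot)
  have m_pos: "m > 0"
    using m by simp
  have "8 * pi / (d * measure lborel K) < m"
    using m by linarith
  then have "8 * pi < d * (m * measure lborel K)"
    using d pos by (simp add: field_simps)
  also have "\<dots> \<le> d * (2 * pi * card (?L m))"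
    using d lower m_pos by (intro mult_left_mono) (auto simp: field_simps)
  finally have large: "4 \<le> d * card (?L m)"
    by simp
  have "?L m \<subseteq> {..<m}"
    by (auto simp: cells_meeting_def)
  then obtain A
    where A: "A \<in> sampling_family (2 * pi * (frame_constant d * card (?L m)) / m) (\<Union>l\<in>?L m. cell m l)"
    and window: "window_count A 0 (int n) \<le> (1 + d) * card (?L m) / m * n"
    using sampling_family_cells_small_windows[OF _ d large] by blast
  have "frame_constant d * measure lborel K \<le> frame_constant d * (2 * pi * (card (?L m) / m))"
    using lower frame_constant_pos[OF d] by (intro mult_left_mono) auto
  then have "A \<in> sampling_family (frame_constant d * measure lborel K) K"
    using subset_Union_cells_meeting[OF m_pos K(2)]
    by (intro sampling_family_antimono[OF A]) (auto simp: mult_ac)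
  moreover have "(1 + d) * card (?L m) / m \<le> (1 + d) * ((measure lborel K + e) / (2 * pi))"
    unfolding times_divide_eq_right[symmetric] using upper d
    by (intro mult_left_mono) (auto simp: field_simps)
  then have "window_count A 0 (int n) \<le> (1 + d) * (measure lborel K + e) / (2 * pi) * n"
    using window mult_right_mono[of _ _ "real n"] by fastforce
  ultimately show ?thesis
    by blast
qed

subsection \<open>Exhaustion by compact sets\<close>

lemma lebesgue_set_inner_compact_exhaustion:
  fixes S :: "real set"
  assumes S: "S \<in> sets lebesgue"
  obtains K where "incseq K" "\<And>k::nat. compact (K k)" "(\<Union>k. K k) \<subseteq> S" "S - (\<Union>k. K k) \<in> null_sets lebesgue"
proof -
  obtain C N where C: "fsigma C" "N \<in> null_sets lebesgue" "C \<union> N = S" "disjnt C N"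
    using lebesgue_set_almost_fsigma[OF S] .
  obtain F :: "nat \<Rightarrow> real set" where F: "range F \<subseteq> Collect compact" "C = (\<Union>k. F k)"
    using C(1) unfolding fsigma_Union_compact by blast
  define K where "K = (\<lambda>k. \<Union>i\<le>k. F i)"
  have "(\<Union>k. K k) = C"
    unfolding F(2) K_def by blast
  moreover have "S - C = N"
    using C(3,4) by (auto simp: disjnt_def)
  moreover have "incseq K"
    unfolding K_def by (intro incseq_SucI UN_mono) auto
  moreover have "compact (K k)" for k
    unfolding K_def using F(1) by (intro compact_UN) auto
  ultimately show thesis
    using C(2,3) by (intro that[of K]) auto
qed

lemma finite_measure_compact_exhaustion:
  fixes S :: "real set"
  assumes S: "S \<in> lmeasurable" "0 < measure lebesgue S"
  obtains K where "incseq K" "\<And>k::nat. compact (K k)" "(\<Union>k. K k) \<subseteq> S" "S - (\<Union>k. K k) \<in> null_sets lebesgue"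
    "\<And>k. measure lebesgue S / 2 \<le> measure lborel (K k)" "\<And>k. measure lborel (K k) \<le> measure lebesgue S"
proof -
  obtain K where K: "incseq K" "\<And>k::nat. compact (K k)" "(\<Union>k. K k) \<subseteq> S"
    and null: "S - (\<Union>k. K k) \<in> null_sets lebesgue"
    using lebesgue_set_inner_compact_exhaustion[OF fmeasurableD[OF S(1)]] by blast
  define T where "T = (\<Union>k. K k)"
  have borel_K [measurable]: "K k \<in> sets borel" for k
    using K(2) by (rule borel_compact)
  have borel_T [measurable]: "T \<in> sets borel"
    unfolding T_def by measurable
  have "emeasure lebesgue T \<le> emeasure lebesgue S"
    using K(3) S(1) by (intro emeasure_mono) (auto simp: T_def)
  then have fin: "emeasure lborel T < \<infinity>"
    using S(1) by (auto simp: fmeasurable_def intro: order_le_less_trans)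
  have "measure lebesgue S = measure lebesgue (S - (S - T))"
    using null S(1) by (simp add: measure_Diff_null_set T_def fmeasurableD)
  also have "S - (S - T) = T"
    using K(3) by (auto simp: T_def)
  finally have S_T: "measure lebesgue S = measure lborel T"
    by simp
  have "(\<lambda>k. measure lborel (K k)) \<longlonglongrightarrow> measure lborel T"
    unfolding T_def using K(1) fin by (intro Lim_measure_incseq) (auto simp: T_def)
  then have "\<forall>\<^sub>F k in sequentially. measure lborel T / 2 < measure lborel (K k)"
    using S(2) by (intro order_tendstoD) (auto simp: S_T)
  then obtain k\<^sub>0 where k\<^sub>0: "\<And>k. k\<^sub>0 \<le> k \<Longrightarrow> measure lborel T / 2 < measure lborel (K k)"
    by (auto simp: eventually_sequentially)
  have tail: "(\<Union>k. K (k + k\<^sub>0)) = T"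
    unfolding T_def using K(1) by (auto dest: incseqD[of K _ "_ + k\<^sub>0", OF _ le_add1])
  show thesis
  proof (rule that[of "\<lambda>k. K (k + k\<^sub>0)"])
    show "incseq (\<lambda>k. K (k + k\<^sub>0))"
      using K(1) by (auto simp: incseq_def)
    show "measure lborel (K (k + k\<^sub>0)) \<le> measure lebesgue S" for k
      unfolding S_T using fin by (intro measure_mono_fmeasurable) (auto simp: T_def fmeasurable_def)
  qed (use K null k\<^sub>0 S_T tail in \<open>auto simp: T_def less_imp_le\<close>)
qed

lemma compact_sampling_family_windows_of_half_measure:
  assumes K: "compact K" "K \<subseteq> {0..<2*pi}" and \<sigma>: "\<sigma> > 0" "\<sigma> / 2 \<le> measure lborel K" "measure lborel K \<le> \<sigma>"
    and d: "d > 0"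
  shows "\<exists>A\<in>sampling_family (frame_constant d * (\<sigma> / 2)) K.
    window_count A 0 (int n) \<le> (1 + 2 * d) * (\<sigma> / (2 * pi)) * n"
proof -
  define e where "e = \<sigma> * d / (1 + d)"
  have e: "e > 0" "(1 + d) * (\<sigma> + e) = (1 + 2 * d) * \<sigma>"
    using \<sigma>(1) d by (auto simp: e_def field_simps)
  have "0 < measure lborel K"
    using \<sigma> by linarith
  then obtain A where A: "A \<in> sampling_family (frame_constant d * measure lborel K) K"
    and "window_count A 0 (int n) \<le> (1 + d) * (measure lborel K + e) / (2 * pi) * n"
    using compact_sampling_family_small_windows[OF K _ d e(1)] by blast
  note this(2)
  also have "(1 + d) * (measure lborel K + e) / (2 * pi) * n \<le> (1 + d) * (\<sigma> + e) / (2 * pi) * n"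
    using d \<sigma>(3) by (intro mult_right_mono divide_right_mono mult_left_mono add_right_mono) auto
  finally have "window_count A 0 (int n) \<le> (1 + 2 * d) * (\<sigma> / (2 * pi)) * n"
    by (simp add: e(2))
  moreover have "A \<in> sampling_family (frame_constant d * (\<sigma> / 2)) K"
    using frame_constant_pos[OF d] \<sigma>(2) by (intro sampling_family_antimono[OF A] mult_left_mono) auto
  ultimately show ?thesis
    by blast
qed

lemma sampling_set_exists_half_open:
  assumes S: "S \<in> lmeasurable" "S \<subseteq> {0..<2*pi}" "0 < measure lebesgue S" and d: "d > 0"
  obtains A h T where "has_density A h" "h \<le> (1 + 2 * d) * nmeasure S"
    "T \<in> sets borel" "T \<subseteq> S" "S - T \<in> null_sets lebesgue"
    "A \<in> sampling_family (pi * frame_constant d * nmeasure S) T"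
proof -
  obtain K where K: "incseq K" "\<And>k::nat. compact (K k)" "(\<Union>k. K k) \<subseteq> S"
    and null: "S - (\<Union>k. K k) \<in> null_sets lebesgue"
    and measure_K: "\<And>k. measure lebesgue S / 2 \<le> measure lborel (K k)"
      "\<And>k. measure lborel (K k) \<le> measure lebesgue S"
    using finite_measure_compact_exhaustion[OF S(1,3)] by blast
  have borel_K: "K k \<in> sets borel" for k
    using K(2) by (rule borel_compact)
  have K_subset: "K k \<subseteq> {0..<2*pi}" for k
    using K(3) S(2) by blast
  have nmeasure_S: "measure lebesgue S / (2 * pi) = nmeasure S"
    "frame_constant d * (measure lebesgue S / 2) = pi * frame_constant d * nmeasure S"
    by (simp_all add: nmeasure_def)
  have "\<exists>A\<in>sampling_family (pi * frame_constant d * nmeasure S) (K k).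
      window_count A 0 (int n) \<le> (1 + 2 * d) * nmeasure S * real n" for k n
    using compact_sampling_family_windows_of_half_measure[OF K(2) K_subset S(3) measure_K d]
    unfolding nmeasure_S .
  then obtain A h where "A \<in> sampling_family (pi * frame_constant d * nmeasure S) (\<Union>k. K k)"
      "has_density A h" "h \<le> (1 + 2 * d) * nmeasure S"
    using sampling_family_density[OF K(1) borel_K] by blast
  moreover have "(\<Union>k. K k) \<in> sets borel"
    by (rule sets.countable_UN) (use borel_K in auto)
  ultimately show thesis
    using K(3) null by (intro that[of A h "\<Union>k. K k"])
qed

theorem sampling_set_exists:
  assumes S: "S \<in> sets lebesgue" "S \<subseteq> {0..2*pi}" "0 < nmeasure S" and d: "d > 0"
  obtains A h T where "has_density A h" "h \<le> (1 + 2 * d) * nmeasure S"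
    "T \<in> sets borel" "T \<subseteq> S" "S - T \<in> null_sets lebesgue"
    "A \<in> sampling_family (pi * frame_constant d * nmeasure S) T"
proof -
  let ?S = "S - {2 * pi}"
  have "?S \<subseteq> {0..<2*pi}"
    using S(2) by force
  moreover have "bounded ?S"
    by (rule bounded_subset[of "{0..2*pi}"]) (use S(2) in auto)
  then have "?S \<in> lmeasurable"
    using S(1) by (intro bounded_set_imp_lmeasurable) auto
  moreover have measure_S: "measure lebesgue ?S = measure lebesgue S"
    using S(1) by (intro measure_Diff_null_set) auto
  then have "0 < measure lebesgue ?S"
    using S(3) by (simp add: nmeasure_def zero_less_divide_iff)
  moreover have "nmeasure ?S = nmeasure S"
    by (simp add: nmeasure_def measure_S)
  ultimately obtain A h T where A: "has_density A h" "h \<le> (1 + 2 * d) * nmeasure S"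
      "A \<in> sampling_family (pi * frame_constant d * nmeasure S) T"
    and T: "T \<in> sets borel" "T \<subseteq> ?S" "?S - T \<in> null_sets lebesgue"
    using sampling_set_exists_half_open[of ?S d] d by metis
  have "S - T \<in> null_sets lebesgue"
  proof (rule null_sets_subset)
    show "(?S - T) \<union> {2 * pi} \<in> null_sets lebesgue"
      by (intro null_sets.Un T) simp
    show "S - T \<in> sets lebesgue"
      using T(1) by (intro sets.Diff[OF S(1)]) simp
  qed blast
  then show thesis
    using A T(1,2) by (intro that[of A h T]) auto
qed

subsection \<open>Paley--Wiener spaces\<close>

lemma borel_measurable_lebesgue_complexE:
  fixes G :: "real \<Rightarrow> complex"
  assumes "G \<in> borel_measurable lebesgue"
  obtains g where "g \<in> borel_measurable borel" "AE t in lborel. G t = g t"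
proof -
  have "(\<lambda>t. Re (G t)) \<in> borel_measurable lebesgue" "(\<lambda>t. Im (G t)) \<in> borel_measurable lebesgue"
    using assms by measurable
  from this[THEN completion_ex_borel_measurable_real] obtain g1 g2
    where [measurable]: "g1 \<in> borel_measurable lborel" "g2 \<in> borel_measurable lborel"
      and AE: "AE t in lborel. Re (G t) = g1 t" "AE t in lborel. Im (G t) = g2 t"
    by blast
  have "AE t in lborel. G t = Complex (g1 t) (g2 t)"
    using AE by eventually_elim (simp add: complex_eq_iff)
  moreover have "(\<lambda>t. Complex (g1 t) (g2 t)) \<in> borel_measurable borel"
    unfolding Complex_eq by measurable
  ultimately show thesis
    using that by blast
qed

lemma L2per_representative:
  assumes F [measurable]: "F \<in> borel_measurable lebesgue"
    and int: "integrable lebesgue (\<lambda>t. indicator S t * (cmod (F t))\<^sup>2)"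
    and S: "S \<in> sets lebesgue" "S \<subseteq> {0..2*pi}"
    and T: "T \<in> sets borel" "T \<subseteq> S" "S - T \<in> null_sets lebesgue"
  obtains g where "g \<in> L2per" "supported_on g T" "AE t in lebesgue. indicator S t *\<^sub>R F t = g t"
proof -
  note [measurable] = T(1) S(1)
  obtain F' where F' [measurable]: "F' \<in> borel_measurable borel" and F_eq: "AE t in lborel. F t = F' t"
    using borel_measurable_lebesgue_complexE[OF F] .
  define g where "g = (\<lambda>t. indicator T t *\<^sub>R F' t)"
  have borel_g [measurable]: "g \<in> borel_measurable borel"
    unfolding g_def by measurable
  then have [measurable]: "g \<in> borel_measurable lebesgue"
    by (intro measurable_completion) simp
  have g_eq: "AE t in lebesgue. indicator S t *\<^sub>R F t = g t"
    using AE_completion[OF F_eq] AE_not_in[OF T(3)]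
    by eventually_elim (use T(2) in \<open>auto simp: g_def indicator_def\<close>)
  have "integrable lebesgue (\<lambda>t. (cmod (g t))\<^sup>2)"
  proof (rule integrable_cong_AE_imp[OF int])
    show "AE t in lebesgue. indicator S t * (cmod (F t))\<^sup>2 = (cmod (g t))\<^sup>2"
      using g_eq by eventually_elim (auto simp: indicator_def)
  qed measurable
  then have "integrable lborel (\<lambda>t. (cmod (g t))\<^sup>2)"
    by (subst (asm) integrable_completion) auto
  moreover have "g t = 0" if "t \<notin> {0..2*pi}" for t
    using that S(2) T(2) by (auto simp: g_def indicator_def)
  ultimately have "g \<in> L2per"
    using borel_g by (auto simp: L2per_def)
  then show thesis
    using g_eq by (intro that[of g]) (auto simp: supported_on_def g_def)
qed

lemma PW_eq_fourier:
  assumes f: "f \<in> PW S" and S: "S \<in> sets lebesgue" "S \<subseteq> {0..2*pi}"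
    and T: "T \<in> sets borel" "T \<subseteq> S" "S - T \<in> null_sets lebesgue"
  obtains g where "g \<in> L2per" "supported_on g T" "f = fourier g"
proof -
  obtain F where F [measurable]: "F \<in> borel_measurable lebesgue"
    and int: "integrable lebesgue (\<lambda>t. indicator S t * (cmod (F t))\<^sup>2)"
    and f_eq: "\<And>x. f x = (\<integral>t. indicator S t *\<^sub>R (F t * cis (x * t)) \<partial>lebesgue)"
    using f unfolding PW_def by blast
  obtain g where g: "g \<in> L2per" "supported_on g T" and g_eq: "AE t in lebesgue. indicator S t *\<^sub>R F t = g t"
    using L2per_representative[OF F int S T] .
  note [measurable] = S(1) L2perD(1)[OF g(1)]
  have [measurable]: "g \<in> borel_measurable lebesgue" "(\<lambda>t. cis (x * t)) \<in> borel_measurable lebesgue" for x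
    by (rule measurable_completion, measurable)+
  have "f x = fourier g x" for x
  proof -
    have "f x = (\<integral>t. g t * cis (x * t) \<partial>lebesgue)"
      unfolding f_eq
    proof (rule integral_cong_AE)
      show "AE t in lebesgue. indicator S t *\<^sub>R (F t * cis (x * t)) = g t * cis (x * t)"
        using g_eq by eventually_elim (auto simp: indicator_def)
    qed measurable
    also have "\<dots> = fourier g x"
      unfolding fourier_def by (rule integral_completion) measurable
    finally show ?thesis .
  qed
  then show thesis
    using g by (intro that[of g]) auto
qed

lemma L2norm_sq_fourier:
  assumes "g \<in> L2per"
  shows "L2norm_sq (fourier g) = 2 * pi * L2_sq g"
proof -
  note int = plancherel[OF assms]
  then have "(\<lambda>x. (cmod (fourier g x))\<^sup>2) \<in> borel_measurable lborel"
    by (auto simp: has_bochner_integral_iff)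
  then show ?thesis
    unfolding L2norm_sq_def using int by (subst integral_completion) (auto simp: has_bochner_integral_iff)
qed

lemma sampling_family_PW:
  assumes A: "A \<in> sampling_family c T" and f: "f \<in> PW S" and S: "S \<in> sets lebesgue" "S \<subseteq> {0..2*pi}"
    and T: "T \<in> sets borel" "T \<subseteq> S" "S - T \<in> null_sets lebesgue"
  shows "ennreal (c / (2 * pi) * L2norm_sq f) \<le> (\<Sum>\<^sub>\<infinity>k\<in>A. ennreal ((cmod (f (of_int k)))\<^sup>2))"
proof -
  obtain g where g: "g \<in> L2per" "supported_on g T" "f = fourier g"
    using PW_eq_fourier[OF f S T] .
  have "c / (2 * pi) * L2norm_sq f = c * L2_sq g"
    unfolding g(3) L2norm_sq_fourier[OF g(1)] by simp
  also have "\<dots> \<le> sample_energy A g"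
    by (rule sampling_familyD[OF A g(1,2)])
  finally show ?thesis
    unfolding g(3) infsum_ennreal_samples[OF g(1)] by (rule ennreal_leI)
qed

theorem theorem2:
  fixes d :: real
  assumes "d > 0"
  shows "\<exists>C>0. \<forall>S. S \<in> sets lebesgue \<and> S \<subseteq> {0..2*pi} \<and> nmeasure S > 0 \<longrightarrow>
           (\<exists>\<Lambda> :: int set. \<exists>D. has_density \<Lambda> D \<and> D < (1 + d) * nmeasure S \<and>
              (\<forall>f \<in> PW S. ennreal (C * nmeasure S * L2norm_sq f)
                  \<le> (\<Sum>\<^sub>\<infinity>k\<in>\<Lambda>. ennreal ((cmod (f (of_int k)))\<^sup>2))))"
proof (intro exI[of _ "frame_constant (d / 3) / 2"] conjI allI impI)
  show "0 < frame_constant (d / 3) / 2"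
    using assms by (simp add: frame_constant_pos)
  fix S :: "real set" assume "S \<in> sets lebesgue \<and> S \<subseteq> {0..2*pi} \<and> nmeasure S > 0"
  then have S: "S \<in> sets lebesgue" "S \<subseteq> {0..2*pi}" "nmeasure S > 0"
    by auto
  obtain \<Lambda> D T where "has_density \<Lambda> D" and D: "D \<le> (1 + 2 * (d / 3)) * nmeasure S"
    and T: "T \<in> sets borel" "T \<subseteq> S" "S - T \<in> null_sets lebesgue"
    and \<Lambda>: "\<Lambda> \<in> sampling_family (pi * frame_constant (d / 3) * nmeasure S) T"
    using sampling_set_exists[OF S, of "d / 3"] assms by auto
  note D
  also have "(1 + 2 * (d / 3)) * nmeasure S < (1 + d) * nmeasure S"
    using assms S(3) by (intro mult_strict_right_mono) auto
  finally have "D < (1 + d) * nmeasure S" .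
  moreover have "pi * frame_constant (d / 3) * nmeasure S / (2 * pi) = frame_constant (d / 3) / 2 * nmeasure S"
    by simp
  ultimately show "\<exists>\<Lambda>. \<exists>D. has_density \<Lambda> D \<and> D < (1 + d) * nmeasure S \<and>
      (\<forall>f\<in>PW S. ennreal (frame_constant (d / 3) / 2 * nmeasure S * L2norm_sq f)
        \<le> (\<Sum>\<^sub>\<infinity>k\<in>\<Lambda>. ennreal ((cmod (f (of_int k)))\<^sup>2)))"
    using \<open>has_density \<Lambda> D\<close> sampling_family_PW[OF \<Lambda> _ S(1,2) T] by metis
qed

end
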